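(* Let $T>0$, $\nu>0$, $\tilde F\in L^2(0,T;H)$ and $u_0\in V$. The function $u$ satisfying $u\in L^2(0,T;D(A))\cap L^\infty(0,T;V)$, $u'\in L^2(0,T;H)$, $u'+\nu Au+Bu=\tilde F$ on $]0,T[$ (as an equality in $V'$) and $u(0)=u_0$ is unique. Moreover it is a.e. equal to a continuous function from $[0,T]$ into $V$.
   Context: Let $a,b>0$ and $R=]0,a[\times]0,b[$, with unit normal $\mathbf n$ on $\partial R$. Write $\nabla^\bot=(-\partial_{x_2},\partial_{x_1})$, so $\nabla^\bot\cdot u=-\partial_{x_2}u_1+\partial_{x_1}u_2$; $\mathbf L^2(R)=L^2(R)^2$, $\mathbf H^k(R)=H^k(R)^2$. Let $\mathcal D_1(R)=\{u\in C^\infty(\overline R)^2: \nabla\cdot u=0 \text{ in } R,\ u\cdot\mathbf n=0 \text{ and } \nabla^\bot\cdot u=0\text{ on }\partial R\}$. Define $H=\{u\in\mathbf L^2(R):\nabla\cdot u=0,\ u\cdot\mathbf n=0\text{ on }\partial R\}$ with the $\mathbf L^2$ scalar product $(\cdot,\cdot)$ and norm $|\cdot|$; $V$ = closure of $\mathcal D_1(R)$ in $\mathbf H^1(R)$, with scalar product $((u,v))=\sum_{i=1}^2\int_R\nabla u_i\cdot\nabla v_i\,dx$ and norm $\|\cdot\|$ (equivalent to the $\mathbf H^1$ norm on $V$); $D(A)=\{u\in\mathbf H^2(R):\nabla\cdot u=0,\ u\cdot\mathbf n=0\text{ and }\nabla^\bot\cdot u=0\text{ on }\partial R\}$ with the $\mathbf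 H^2$ norm. $H$ is identified with its dual, so $D(A)\subset V\subset H\subset V'$, and $\langle f,v\rangle=(f,v)$ for $f\in H$, $v\in V$. $A:V\to V'$ is defined by $\langle Au,v\rangle=((u,v))$; on $D(A)$ it coincides with $-\Delta$ and maps $D(A)$ into $H$. For $u,v,w\in\mathbf H^1(R)$, $b(u,v,w)=\sum_{i,j=1}^2\int_R u_i(\partial_i v_j)w_j\,dx$, and for $u\in V$, $Bu\in V'$ is defined by $\langle Bu,w\rangle=b(u,u,w)$, $w\in V$. $u'$ denotes the distributional time derivative. At least one such solution $u$ is known to exist. *)

theory Defs
  imports "HOL-Analysis.Analysis"
begin

text \<open>
  Elements of \<open>L\<^sup>2\<close> and of the Sobolev spaces are represented by functions on the whole plane of
  which only the values on the domain matter; equality of elements is equality almost everywhere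
  (\<open>ae_eq\<close>), and all norms below are seminorms on representatives.
\<close>

section \<open>Smooth functions\<close>

text \<open>
  Derivatives are taken within \<open>S\<close>.  For open \<open>S\<close> these are the usual ones.  If \<open>S\<close> is a closed box
  with nonempty interior, derivatives within \<open>S\<close> are unique, and being \<open>C\<^sup>k\<close> on \<open>S\<close> means that
  the function is \<open>C\<^sup>k\<close> inside with all derivatives up to order \<open>k\<close> extending continuously to the
  boundary; the partial derivatives at a boundary point are the values of these extensions.
\<close>

definition pd :: "'a::euclidean_space set \<Rightarrow> 'a \<Rightarrow> ('a \<Rightarrow> 'b::real_normed_vector) \<Rightarrow> 'a \<Rightarrow> 'b"
  where "pd S e f x = frechet_derivative f (at x within S) e"

primrec Ck_on :: "nat \<Rightarrow> 'a::euclidean_space set \<Rightarrow> ('a \<Rightarrow> 'b::real_normed_vector) \<Rightarrow> bool" where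
  "Ck_on 0 S f \<longleftrightarrow> continuous_on S f"
| "Ck_on (Suc k) S f \<longleftrightarrow> f differentiable_on S \<and> (\<forall>e\<in>Basis. Ck_on k S (pd S e f))"

definition smooth_on :: "'a::euclidean_space set \<Rightarrow> ('a \<Rightarrow> 'b::real_normed_vector) \<Rightarrow> bool"
  where "smooth_on S f \<longleftrightarrow> (\<forall>k. Ck_on k S f)"

definition test_fun :: "'a::euclidean_space set \<Rightarrow> ('a \<Rightarrow> real) \<Rightarrow> bool"
  where "test_fun S \<phi> \<longleftrightarrow> smooth_on UNIV \<phi> \<and> (\<exists>K\<subseteq>S. compact K \<and> (\<forall>x. x \<notin> K \<longrightarrow> \<phi> x = 0))"

section \<open>Lebesgue and Sobolev spaces over a domain\<close>

definition ae_eq :: "'a::euclidean_space set \<Rightarrow> ('a \<Rightarrow> 'b) \<Rightarrow> ('a \<Rightarrow> 'b) \<Rightarrow> bool"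
  where "ae_eq S f g \<longleftrightarrow> (AE x in lebesgue_on S. f x = g x)"

definition L2_space :: "'a::euclidean_space set \<Rightarrow> ('a \<Rightarrow> 'b::euclidean_space) set"
  where "L2_space S = {f. f \<in> borel_measurable (lebesgue_on S) \<and>
    integrable (lebesgue_on S) (\<lambda>x. (norm (f x))\<^sup>2)}"

definition weak_pd :: "'a::euclidean_space set \<Rightarrow> 'a \<Rightarrow> ('a \<Rightarrow> 'b::euclidean_space) \<Rightarrow> ('a \<Rightarrow> 'b) \<Rightarrow> bool"
  where "weak_pd S e f g \<longleftrightarrow> (\<forall>\<phi>. test_fun S \<phi> \<longrightarrow>
    (LINT x|lebesgue_on S. pd UNIV e \<phi> x *\<^sub>R f x) = - (LINT x|lebesgue_on S. \<phi> x *\<^sub>R g x))"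

text \<open>The weak partial derivative of a function having one in \<open>L\<^sup>2\<close>; unique up to null sets.\<close>

definition wd :: "'a::euclidean_space set \<Rightarrow> 'a \<Rightarrow> ('a \<Rightarrow> 'b::euclidean_space) \<Rightarrow> 'a \<Rightarrow> 'b"
  where "wd S e f = (SOME g. g \<in> L2_space S \<and> weak_pd S e f g)"

primrec sobolev :: "nat \<Rightarrow> 'a::euclidean_space set \<Rightarrow> ('a \<Rightarrow> 'b::euclidean_space) set" where
  "sobolev 0 S = L2_space S"
| "sobolev (Suc k) S =
    {f \<in> L2_space S. \<forall>e\<in>Basis. \<exists>g. g \<in> sobolev k S \<and> weak_pd S e f g}"

primrec sobolev_sq :: "nat \<Rightarrow> 'a::euclidean_space set \<Rightarrow> ('a \<Rightarrow> 'b::euclidean_space) \<Rightarrow> real" where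
  "sobolev_sq 0 S f = (LINT x|lebesgue_on S. (norm (f x))\<^sup>2)"
| "sobolev_sq (Suc k) S f =
    (LINT x|lebesgue_on S. (norm (f x))\<^sup>2) + (\<Sum>e\<in>Basis. sobolev_sq k S (wd S e f))"

definition sobolev_norm :: "nat \<Rightarrow> 'a::euclidean_space set \<Rightarrow> ('a \<Rightarrow> 'b::euclidean_space) \<Rightarrow> real"
  where "sobolev_norm k S f = sqrt (sobolev_sq k S f)"

section \<open>The rectangle and its boundary\<close>

type_synonym plane = "real \<times> real"
type_synonym field = "plane \<Rightarrow> plane"

definition rect :: "real \<Rightarrow> real \<Rightarrow> plane set"
  where "rect a b = {0<..<a} \<times> {0<..<b}"

text \<open>Arc length parametrisation of the boundary, its arc length measure, and the outward normal
  (at a corner: the normal of one of the two adjacent edges).\<close>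

definition bdry_param :: "real \<Rightarrow> real \<Rightarrow> real \<Rightarrow> plane"
  where "bdry_param a b s =
    (if s < a then (s, 0)
     else if s < a + b then (a, s - a)
     else if s < 2 * a + b then (2 * a + b - s, b)
     else (0, 2 * a + 2 * b - s))"

definition bdry_measure :: "real \<Rightarrow> real \<Rightarrow> plane measure"
  where "bdry_measure a b = distr (lebesgue_on {0<..<2 * a + 2 * b}) borel (bdry_param a b)"

definition bdry_normal :: "real \<Rightarrow> real \<Rightarrow> plane \<Rightarrow> plane"
  where "bdry_normal a b x =
    (if snd x = 0 then (0, -1)
     else if fst x = a then (1, 0)
     else if snd x = b then (0, 1)
     else (-1, 0))"

text \<open>The trace of an \<open>H\<^sup>1\<close> function: the continuous extension to \<open>H\<^sup>1\<close>, with values in \<open>L\<^sup>2\<close> of the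
  boundary, of the restriction map on functions smooth up to the boundary.\<close>

definition has_trace ::
    "real \<Rightarrow> real \<Rightarrow> (plane \<Rightarrow> 'b::euclidean_space) \<Rightarrow> (plane \<Rightarrow> 'b) \<Rightarrow> bool"
  where "has_trace a b f g \<longleftrightarrow> f \<in> sobolev 1 (rect a b) \<and>
    g \<in> borel_measurable (bdry_measure a b) \<and>
    (\<exists>\<phi>. (\<forall>n::nat. smooth_on (closure (rect a b)) (\<phi> n)) \<and>
      (\<lambda>n. sobolev_norm 1 (rect a b) (\<lambda>x. \<phi> n x - f x)) \<longlonglongrightarrow> 0 \<and>
      (\<lambda>n. \<integral>\<^sup>+x. ennreal ((norm (\<phi> n x - g x))\<^sup>2) \<partial>bdry_measure a b) \<longlonglongrightarrow> 0)"

section \<open>Function spaces of the problem\<close>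

definition div_free :: "real \<Rightarrow> real \<Rightarrow> field \<Rightarrow> bool"
  where "div_free a b u \<longleftrightarrow> (\<forall>\<phi>. test_fun (rect a b) \<phi> \<longrightarrow>
    (LINT x|lebesgue_on (rect a b). (\<Sum>i\<in>Basis. (u x \<bullet> i) * pd UNIV i \<phi> x)) = 0)"

text \<open>The generalised normal trace (in \<open>H\<^sup>-\<^sup>1\<^sup>/\<^sup>2\<close> of the boundary) of an \<open>L\<^sup>2\<close> field with divergence in
  \<open>L\<^sup>2\<close> is the functional sending the trace of \<open>\<phi> \<in> H\<^sup>1\<close> to the integral of
  \<open>u \<cdot> \<nabla>\<phi> + (\<nabla> \<cdot> u) \<phi>\<close>.  For divergence-free fields it vanishes iff the following holds.\<close>

definition normal_trace_zero :: "real \<Rightarrow> real \<Rightarrow> field \<Rightarrow> bool"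
  where "normal_trace_zero a b u \<longleftrightarrow> (\<forall>\<phi>::plane \<Rightarrow> real. \<phi> \<in> sobolev 1 (rect a b) \<longrightarrow>
    (LINT x|lebesgue_on (rect a b). (\<Sum>i\<in>Basis. (u x \<bullet> i) * wd (rect a b) i \<phi> x)) = 0)"

definition weak_curl :: "real \<Rightarrow> real \<Rightarrow> field \<Rightarrow> plane \<Rightarrow> real"
  where "weak_curl a b u x =
    - (wd (rect a b) (0, 1) u x \<bullet> (1, 0)) + wd (rect a b) (1, 0) u x \<bullet> (0, 1)"

definition D1_space :: "real \<Rightarrow> real \<Rightarrow> field set"
  where "D1_space a b = {u. let S = closure (rect a b) in
    smooth_on S u \<and>
    (\<forall>x\<in>rect a b. (\<Sum>i\<in>Basis. pd S i u x \<bullet> i) = 0) \<and>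
    (\<forall>x\<in>frontier (rect a b). u x \<bullet> bdry_normal a b x = 0) \<and>
    (\<forall>x\<in>frontier (rect a b). - (pd S (0, 1) u x \<bullet> (1, 0)) + pd S (1, 0) u x \<bullet> (0, 1) = 0)}"

definition H_space :: "real \<Rightarrow> real \<Rightarrow> field set"
  where "H_space a b = {u \<in> L2_space (rect a b). div_free a b u \<and> normal_trace_zero a b u}"

definition V_space :: "real \<Rightarrow> real \<Rightarrow> field set"
  where "V_space a b = {u \<in> sobolev 1 (rect a b).
    \<forall>\<epsilon>>0. \<exists>\<phi>\<in>D1_space a b. sobolev_norm 1 (rect a b) (\<lambda>x. u x - \<phi> x) < \<epsilon>}"

definition DA_space :: "real \<Rightarrow> real \<Rightarrow> field set"
  where "DA_space a b = {u \<in> sobolev 2 (rect a b). div_free a b u \<and>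
    (\<exists>g. has_trace a b u g \<and> (AE x in bdry_measure a b. g x \<bullet> bdry_normal a b x = 0)) \<and>
    has_trace a b (weak_curl a b u) (\<lambda>x. 0)}"

definition H_inner :: "real \<Rightarrow> real \<Rightarrow> field \<Rightarrow> field \<Rightarrow> real"
  where "H_inner a b u v = (LINT x|lebesgue_on (rect a b). u x \<bullet> v x)"

definition V_inner :: "real \<Rightarrow> real \<Rightarrow> field \<Rightarrow> field \<Rightarrow> real"
  where "V_inner a b u v = (\<Sum>j\<in>Basis. (LINT x|lebesgue_on (rect a b).
    (\<Sum>i\<in>Basis. (wd (rect a b) i u x \<bullet> j) * (wd (rect a b) i v x \<bullet> j))))"

definition H_norm :: "real \<Rightarrow> real \<Rightarrow> field \<Rightarrow> real"
  where "H_norm a b u = sqrt (H_inner a b u u)"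

definition V_norm :: "real \<Rightarrow> real \<Rightarrow> field \<Rightarrow> real"
  where "V_norm a b u = sqrt (V_inner a b u u)"

definition DA_norm :: "real \<Rightarrow> real \<Rightarrow> field \<Rightarrow> real"
  where "DA_norm a b u = sobolev_norm 2 (rect a b) u"

text \<open>Elements of \<open>V'\<close> are given by their values on \<open>V\<close>.\<close>

definition A_op :: "real \<Rightarrow> real \<Rightarrow> field \<Rightarrow> field \<Rightarrow> real"
  where "A_op a b u = (\<lambda>v. V_inner a b u v)"

definition b_form :: "real \<Rightarrow> real \<Rightarrow> field \<Rightarrow> field \<Rightarrow> field \<Rightarrow> real"
  where "b_form a b u v w = (\<Sum>i\<in>Basis. \<Sum>j\<in>Basis. (LINT x|lebesgue_on (rect a b).
    (u x \<bullet> i) * (wd (rect a b) i v x \<bullet> j) * (w x \<bullet> j)))"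

definition B_op :: "real \<Rightarrow> real \<Rightarrow> field \<Rightarrow> field \<Rightarrow> real"
  where "B_op a b u = (\<lambda>w. b_form a b u u w)"

section \<open>Functions of time with values in a function space\<close>

text \<open>In this section \<open>X\<close> is a space of functions and \<open>N\<close> its norm.  The notions are the usual ones of
  Bochner's theory; the library's versions are not applicable since \<open>X\<close> is not a type.\<close>

definition simple_into ::
    "real \<Rightarrow> ('a \<Rightarrow> 'b) set \<Rightarrow> (real \<Rightarrow> 'a \<Rightarrow> 'b) \<Rightarrow> bool"
  where "simple_into T X s \<longleftrightarrow>
    simple_function (lebesgue_on {0<..<T}) s \<and> s ` {0<..<T} \<subseteq> X"

definition strongly_measurable ::
    "real \<Rightarrow> ('a \<Rightarrow> 'b::real_vector) set \<Rightarrow> (('a \<Rightarrow> 'b) \<Rightarrow> real) \<Rightarrow> (real \<Rightarrow> 'a \<Rightarrow> 'b) \<Rightarrow> bool"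
  where "strongly_measurable T X N f \<longleftrightarrow>
    (AE t in lebesgue_on {0<..<T}. f t \<in> X) \<and>
    (\<exists>s. (\<forall>n::nat. simple_into T X (s n)) \<and>
      (AE t in lebesgue_on {0<..<T}. (\<lambda>n. N (\<lambda>x. f t x - s n t x)) \<longlonglongrightarrow> 0))"

definition L2_time ::
    "real \<Rightarrow> ('a \<Rightarrow> 'b::real_vector) set \<Rightarrow> (('a \<Rightarrow> 'b) \<Rightarrow> real) \<Rightarrow> (real \<Rightarrow> 'a \<Rightarrow> 'b) set"
  where "L2_time T X N = {f. strongly_measurable T X N f \<and>
    integrable (lebesgue_on {0<..<T}) (\<lambda>t. (N (f t))\<^sup>2)}"

definition Linf_time ::
    "real \<Rightarrow> ('a \<Rightarrow> 'b::real_vector) set \<Rightarrow> (('a \<Rightarrow> 'b) \<Rightarrow> real) \<Rightarrow> (real \<Rightarrow> 'a \<Rightarrow> 'b) set"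
  where "Linf_time T X N = {f. strongly_measurable T X N f \<and>
    (\<exists>C. AE t in lebesgue_on {0<..<T}. N (f t) \<le> C)}"

definition simple_time_integral ::
    "real \<Rightarrow> (real \<Rightarrow> 'a \<Rightarrow> 'b::real_vector) \<Rightarrow> 'a \<Rightarrow> 'b"
  where "simple_time_integral T s x =
    (\<Sum>h\<in>s ` {0<..<T}. measure lebesgue {t\<in>{0<..<T}. s t = h} *\<^sub>R h x)"

definition has_time_integral ::
    "real \<Rightarrow> ('a \<Rightarrow> 'b::real_vector) set \<Rightarrow> (('a \<Rightarrow> 'b) \<Rightarrow> real) \<Rightarrow> (real \<Rightarrow> 'a \<Rightarrow> 'b) \<Rightarrow>
      ('a \<Rightarrow> 'b) \<Rightarrow> bool"
  where "has_time_integral T X N f h \<longleftrightarrow> strongly_measurable T X N f \<and> h \<in> X \<and>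
    (\<exists>s. (\<forall>n::nat. simple_into T X (s n)) \<and>
      (\<lambda>n. \<integral>\<^sup>+t. ennreal (N (\<lambda>x. f t x - s n t x)) \<partial>lebesgue_on {0<..<T}) \<longlonglongrightarrow> 0 \<and>
      (\<lambda>n. N (\<lambda>x. h x - simple_time_integral T (s n) x)) \<longlonglongrightarrow> 0)"

text \<open>\<open>u'\<close> is the derivative of \<open>u\<close> in the sense of \<open>X\<close>-valued distributions on \<open>]0,T[\<close>.\<close>

definition has_time_derivative ::
    "real \<Rightarrow> ('a \<Rightarrow> 'b::real_vector) set \<Rightarrow> (('a \<Rightarrow> 'b) \<Rightarrow> real) \<Rightarrow>
      (real \<Rightarrow> 'a \<Rightarrow> 'b) \<Rightarrow> (real \<Rightarrow> 'a \<Rightarrow> 'b) \<Rightarrow> bool"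
  where "has_time_derivative T X N u u' \<longleftrightarrow> (\<forall>\<phi>. test_fun {0<..<T} \<phi> \<longrightarrow>
    (\<exists>h. has_time_integral T X N (\<lambda>t x. deriv \<phi> t *\<^sub>R u t x) h \<and>
         has_time_integral T X N (\<lambda>t x. \<phi> t *\<^sub>R u' t x) (\<lambda>x. - h x)))"

definition continuous_into ::
    "real \<Rightarrow> ('a \<Rightarrow> 'b::real_vector) set \<Rightarrow> (('a \<Rightarrow> 'b) \<Rightarrow> real) \<Rightarrow> (real \<Rightarrow> 'a \<Rightarrow> 'b) \<Rightarrow> bool"
  where "continuous_into T X N w \<longleftrightarrow>
    (\<forall>t\<in>{0..T}. w t \<in> X \<and> ((\<lambda>s. N (\<lambda>x. w s x - w t x)) \<longlongrightarrow> 0) (at t within {0..T}))"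

section \<open>The evolution problem\<close>

text \<open>Since \<open>u\<close> and \<open>u'\<close> lie in \<open>L\<^sup>2(0,T;H)\<close>, \<open>u\<close> is a.e. equal to a (unique) continuous function into
  \<open>H\<close>, and \<open>u(0)\<close> denotes the value of the latter.\<close>

definition initial_value :: "real \<Rightarrow> real \<Rightarrow> real \<Rightarrow> (real \<Rightarrow> field) \<Rightarrow> field \<Rightarrow> bool"
  where "initial_value a b T u u0 \<longleftrightarrow>
    (\<exists>w. continuous_into T (H_space a b) (H_norm a b) w \<and>
      (AE t in lebesgue_on {0<..<T}. ae_eq (rect a b) (u t) (w t)) \<and>
      ae_eq (rect a b) (w 0) u0)"

definition NS_solution ::
    "real \<Rightarrow> real \<Rightarrow> real \<Rightarrow> real \<Rightarrow> (real \<Rightarrow> field) \<Rightarrow> field \<Rightarrow> (real \<Rightarrow> field) \<Rightarrow> bool"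
  where "NS_solution a b T \<nu> F u0 u \<longleftrightarrow>
    u \<in> L2_time T (DA_space a b) (DA_norm a b) \<and>
    u \<in> Linf_time T (V_space a b) (V_norm a b) \<and>
    (\<exists>u'. u' \<in> L2_time T (H_space a b) (H_norm a b) \<and>
      has_time_derivative T (H_space a b) (H_norm a b) u u' \<and>
      (AE t in lebesgue_on {0<..<T}. \<forall>v\<in>V_space a b.
        H_inner a b (u' t) v + \<nu> * A_op a b (u t) v + B_op a b (u t) v = H_inner a b (F t) v)) \<and>
    initial_value a b T u u0"

end

(*
  Uniqueness.  For the difference z of two solutions, <z', z> is at most C |z|^2: b(u,u,z) - b(v,v,z)
  = b(z,u,z) is bounded through Ladyzhenskaya's inequality by |z| (|z| + ||z||) ||u||, and u is bounded
  in V.  As z is a primitive of z' with values in H, telescoping |z|^2 over fine partitions turns this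
  into an integral inequality, and Gronwall's lemma applies.

  Continuity in V.  On the rectangle ((u,v)) is the L^2 product of the curls, so for u in D(A) the zero
  trace of curl u gives |((u,v))| <= C ||u||_{D(A)} |v|.  Put ||u(q) - u(p)||^2 into a telescoping sum over
  points r_i of [p,q].  Since ((x,x)) - ((y,y)) = ((x+y, x-y)), each increment costs
  (||u(r_i)||_{D(A)} + ||u(r_{i+1})||_{D(A)}) |u(r_{i+1}) - u(r_i)|, and |u(r_{i+1}) - u(r_i)|^2 is at most
  the length of the gap times the integral of |u'|^2 over it.  Choosing r_i where ||u||_{D(A)}^2 is at
  most its average over the i-th cell bounds the sum by the integral of ||u||_{D(A)}^2 + |u'|^2 over [p,q].
*)
theory Submission
  imports Defs "HOL-Computational_Algebra.Polynomial"
begin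

section \<open>Square integrable functions\<close>

text \<open>The solution lies in V and D(A) only at almost every time, and its derivative is used
  only through scalar products with fixed fields. The estimates therefore concern the continuous
  H-valued representative \<open>w\<close>, and every use of V or D(A) is confined to a set
  \<open>G\<close> of times of full measure. Continuity of t -> ||w(t)|| would not give continuity
  in V. What is telescoped is E(t) = ||w(t) - w(s)||^2 for a time s between the two endpoints. The
  D(A) norm at the endpoints is not controlled by an average; it enters with the mesh as a factor
  and disappears under refinement. The time s is itself chosen by averaging, so its D(A) norm is
  controlled. This makes \<open>w\<close> uniformly continuous on \<open>G\<close>, and closedness
  of V extends the result to all of [0,T]. The rectangle enters through its straight edges: the
  tangential derivative of the normal component vanishes there, so passing from gradients to curls
  leaves no boundary term. A second integration by parts costs only the zero trace of the curl, so
  ((u,z)) is bounded by the L2 norm of z although the Laplacian of u is never formed.\<close>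

definition L2 :: "'a measure \<Rightarrow> ('a \<Rightarrow> 'b::euclidean_space) set"
  where "L2 M = {f \<in> borel_measurable M. integrable M (\<lambda>x. (norm (f x))\<^sup>2)}"

definition l2norm :: "'a measure \<Rightarrow> ('a \<Rightarrow> 'b::euclidean_space) \<Rightarrow> real"
  where "l2norm M f = sqrt (LINT x|M. (norm (f x))\<^sup>2)"

lemma L2_space_eq: "L2_space S = L2 (lebesgue_on S)"
  by (simp add: L2_space_def L2_def)

lemma L2_measurable [measurable_dest]: "f \<in> L2 M \<Longrightarrow> f \<in> borel_measurable M"
  and L2_integrable: "f \<in> L2 M \<Longrightarrow> integrable M (\<lambda>x. (norm (f x))\<^sup>2)"
  by (auto simp: L2_def)

lemma l2norm_nonneg [simp]: "l2norm M f \<ge> 0"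
  by (simp add: l2norm_def)

lemma l2norm_power2: "(l2norm M f)\<^sup>2 = (LINT x|M. (norm (f x))\<^sup>2)"
  by (simp add: l2norm_def)

lemma L2_bound:
  fixes f :: "'a \<Rightarrow> 'b::euclidean_space" and h :: "'a \<Rightarrow> real"
  assumes "f \<in> borel_measurable M" "integrable M h" "\<And>x. x \<in> space M \<Longrightarrow> (norm (f x))\<^sup>2 \<le> h x"
  shows "f \<in> L2 M"
  unfolding L2_def
proof (safe intro!: assms)
  show "integrable M (\<lambda>x. (norm (f x))\<^sup>2)"
    by (rule Bochner_Integration.integrable_bound[OF assms(2)])
      (use assms in \<open>auto intro!: AE_I2 order_trans[OF assms(3)]\<close>)
qed

lemma L2_zero [simp]: "(\<lambda>x. 0) \<in> L2 M"
  by (simp add: L2_def)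

lemma L2_scaleR [intro]: "f \<in> L2 M \<Longrightarrow> (\<lambda>x. c *\<^sub>R f x) \<in> L2 M"
  by (auto simp: L2_def power_mult_distrib)

lemma L2_minus [intro]: "f \<in> L2 M \<Longrightarrow> (\<lambda>x. - f x) \<in> L2 M"
  by (auto simp: L2_def)

lemma L2_add [intro]:
  assumes "f \<in> L2 M" "g \<in> L2 M"
  shows "(\<lambda>x. f x + g x) \<in> L2 M"
proof (rule L2_bound)
  show "(\<lambda>x. f x + g x) \<in> borel_measurable M"
    using assms by (auto dest!: L2_measurable)
  show "integrable M (\<lambda>x. 2 * (norm (f x))\<^sup>2 + 2 * (norm (g x))\<^sup>2)"
    using assms by (auto dest!: L2_integrable)
  fix x
  have "(norm (f x + g x))\<^sup>2 \<le> (norm (f x) + norm (g x))\<^sup>2"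
    by (intro power_mono norm_triangle_ineq) auto
  also have "\<dots> \<le> 2 * (norm (f x))\<^sup>2 + 2 * (norm (g x))\<^sup>2"
    using sum_squares_bound[of "norm (f x)" "norm (g x)"] by (simp add: power2_sum)
  finally show "(norm (f x + g x))\<^sup>2 \<le> 2 * (norm (f x))\<^sup>2 + 2 * (norm (g x))\<^sup>2" .
qed

lemma L2_diff [intro]: "f \<in> L2 M \<Longrightarrow> g \<in> L2 M \<Longrightarrow> (\<lambda>x. f x - g x) \<in> L2 M"
  using L2_add[of f M "\<lambda>x. - g x"] by (simp add: L2_minus)

lemma L2_sum [intro]: "(\<And>i. i \<in> I \<Longrightarrow> f i \<in> L2 M) \<Longrightarrow> (\<lambda>x. \<Sum>i\<in>I. f i x) \<in> L2 M"
  by (induction I rule: infinite_finite_induct) auto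

lemma L2_norm [intro]: "f \<in> L2 M \<Longrightarrow> (\<lambda>x. norm (f x)) \<in> L2 M"
  by (auto simp: L2_def)

lemma L2_inner_const [intro]: 
  assumes "f \<in> L2 M" shows "(\<lambda>x. f x \<bullet> c) \<in> L2 M"
proof (rule L2_bound)
  show "(\<lambda>x. f x \<bullet> c) \<in> borel_measurable M"
    using assms by (auto dest!: L2_measurable)
  show "integrable M (\<lambda>x. (norm c)\<^sup>2 * (norm (f x))\<^sup>2)"
    using assms by (auto dest!: L2_integrable)
  show "(norm (f x \<bullet> c))\<^sup>2 \<le> (norm c)\<^sup>2 * (norm (f x))\<^sup>2" for x
    using power_mono[OF Cauchy_Schwarz_ineq2[of "f x" c], of 2]
    by (simp add: power_mult_distrib mult.commute)
qed

lemma l2norm_cong_AE: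
  assumes "AE x in M. f x = g x" "f \<in> borel_measurable M" "g \<in> borel_measurable M"
  shows "l2norm M f = l2norm M g"
  unfolding l2norm_def
  by (rule arg_cong[where f=sqrt], rule integral_cong_AE) (use assms in auto)

lemma L2_mult_integrable:
  assumes "f \<in> L2 M" "g \<in> L2 M"
  shows "integrable M (\<lambda>x. norm (f x) * norm (g x))"
proof (rule Bochner_Integration.integrable_bound)
  show "integrable M (\<lambda>x. (norm (f x))\<^sup>2 + (norm (g x))\<^sup>2)"
    using assms by (auto dest!: L2_integrable)
  show "(\<lambda>x. norm (f x) * norm (g x)) \<in> borel_measurable M"
    using assms by (auto dest!: L2_measurable)
  have "norm (f x) * norm (g x) \<le> (norm (f x))\<^sup>2 + (norm (g x))\<^sup>2" for x
  proof -
    have "0 \<le> norm (f x) * norm (g x)" by simp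
    then show ?thesis using sum_squares_bound[of "norm (f x)" "norm (g x)"] by linarith
  qed
  then show "AE x in M. norm (norm (f x) * norm (g x)) \<le> norm ((norm (f x))\<^sup>2 + (norm (g x))\<^sup>2)"
    unfolding real_norm_def by (intro AE_I2) (metis abs_ge_self abs_mult abs_norm_cancel order_trans)
qed

lemma L2_inner_integrable:
  assumes "f \<in> L2 M" "g \<in> L2 M"
  shows "integrable M (\<lambda>x. f x \<bullet> g x)"
proof (rule Bochner_Integration.integrable_bound[OF L2_mult_integrable[OF assms]])
  show "(\<lambda>x. f x \<bullet> g x) \<in> borel_measurable M"
    using assms by (auto dest!: L2_measurable)
  show "AE x in M. norm (f x \<bullet> g x) \<le> norm (norm (f x) * norm (g x))"
    by (simp add: Cauchy_Schwarz_ineq2)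
qed

lemma L2_scaleR_integrable:
  fixes f :: "'a \<Rightarrow> real" and g :: "'a \<Rightarrow> 'b::euclidean_space"
  assumes "f \<in> L2 M" "g \<in> L2 M"
  shows "integrable M (\<lambda>x. f x *\<^sub>R g x)"
  by (rule Bochner_Integration.integrable_bound[OF L2_mult_integrable[OF assms]])
    (use assms in \<open>auto dest!: L2_measurable\<close>)

lemma L2_Cauchy_Schwarz_norm:
  assumes "f \<in> L2 M" "g \<in> L2 M"
  shows "(LINT x|M. norm (f x) * norm (g x)) \<le> l2norm M f * l2norm M g"
proof -
  define p q r where "p = (LINT x|M. (norm (f x))\<^sup>2)" "q = (LINT x|M. norm (f x) * norm (g x))"
    "r = (LINT x|M. (norm (g x))\<^sup>2)"
  note I = L2_integrable[OF assms(1)] L2_integrable[OF assms(2)] L2_mult_integrable[OF assms]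
  have quad: "0 \<le> p - 2 * s * q + s\<^sup>2 * r" for s
  proof -
    have "0 \<le> (LINT x|M. (norm (f x) - s * norm (g x))\<^sup>2)" by simp
    also have "\<dots> = (LINT x|M. (norm (f x))\<^sup>2 - 2 * s * (norm (f x) * norm (g x)) + s\<^sup>2 * (norm (g x))\<^sup>2)"
      by (intro Bochner_Integration.integral_cong) (auto simp: power2_diff power_mult_distrib)
    also have "\<dots> = p - 2 * s * q + s\<^sup>2 * r"
      using I by (simp add: p_q_r_def)
    finally show ?thesis .
  qed
  have nn: "p \<ge> 0" "q \<ge> 0" "r \<ge> 0" by (auto simp: p_q_r_def)
  have "q\<^sup>2 \<le> p * r"
  proof (cases "r = 0")
    case True
    have "q = 0"
    proof (rule ccontr)
      assume "q \<noteq> 0"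
      \<comment> \<open>With r = 0 the quadratic is affine in s, and this s gives it the value
        -1.\<close>
      then show False using quad[of "(p + 1) / (2 * q)"] True by (simp add: field_simps)
    qed
    then show ?thesis using nn by simp
  next
    case False
    then have "r > 0" using nn by simp
    then show ?thesis using quad[of "q / r"] by (simp add: field_simps power2_eq_square)
  qed
  then have "q \<le> sqrt (p * r)" using nn real_le_rsqrt by blast
  then show ?thesis by (simp add: l2norm_def p_q_r_def real_sqrt_mult)
qed

lemma L2_Cauchy_Schwarz:
  assumes "f \<in> L2 M" "g \<in> L2 M"
  shows "\<bar>LINT x|M. f x \<bullet> g x\<bar> \<le> l2norm M f * l2norm M g"
proof -
  have "\<bar>LINT x|M. f x \<bullet> g x\<bar> \<le> (LINT x|M. norm (f x) * norm (g x))"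
    by (intro integral_abs_bound[THEN order_trans] integral_mono integrable_abs
          L2_inner_integrable L2_mult_integrable assms Cauchy_Schwarz_ineq2)
  then show ?thesis using L2_Cauchy_Schwarz_norm[OF assms] by linarith
qed

lemma l2norm_inner: "(LINT x|M. f x \<bullet> f x) = (l2norm M f)\<^sup>2"
  by (simp add: l2norm_power2 power2_norm_eq_inner)

lemma l2norm_scaleR: "l2norm M (\<lambda>x. c *\<^sub>R f x) = \<bar>c\<bar> * l2norm M f"
  by (simp add: l2norm_def power_mult_distrib real_sqrt_mult)

lemma l2norm_minus: "l2norm M (\<lambda>x. - f x) = l2norm M f"
  by (simp add: l2norm_def)

lemma l2norm_norm: "l2norm M (\<lambda>x. norm (f x)) = l2norm M f"
  by (simp add: l2norm_def)

lemma l2norm_diff_commute: "l2norm M (\<lambda>x. f x - g x) = l2norm M (\<lambda>x. g x - f x)"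
  by (simp add: l2norm_def norm_minus_commute)

lemma l2norm_triangle:
  assumes "f \<in> L2 M" "g \<in> L2 M"
  shows "l2norm M (\<lambda>x. f x + g x) \<le> l2norm M f + l2norm M g"
proof (rule power2_le_imp_le)
  have "(l2norm M (\<lambda>x. f x + g x))\<^sup>2 = (LINT x|M. f x \<bullet> f x + 2 * (f x \<bullet> g x) + g x \<bullet> g x)"
    unfolding l2norm_inner[symmetric]
    by (intro Bochner_Integration.integral_cong) (auto simp: inner_add inner_commute)
  also have "\<dots> = (l2norm M f)\<^sup>2 + 2 * (LINT x|M. f x \<bullet> g x) + (l2norm M g)\<^sup>2"
    using assms by (simp add: L2_inner_integrable l2norm_inner)
  also have "\<dots> \<le> (l2norm M f + l2norm M g)\<^sup>2"
    using L2_Cauchy_Schwarz[OF assms] by (simp add: power2_sum)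
  finally show "(l2norm M (\<lambda>x. f x + g x))\<^sup>2 \<le> (l2norm M f + l2norm M g)\<^sup>2" .
qed auto

lemma l2norm_triangle_diff:
  assumes "f \<in> L2 M" "g \<in> L2 M"
  shows "l2norm M (\<lambda>x. f x - g x) \<le> l2norm M f + l2norm M g"
  using l2norm_triangle[OF assms(1) L2_minus[OF assms(2)]] by (simp add: l2norm_minus)

lemma l2norm_triangle3:
  assumes "f \<in> L2 M" "g \<in> L2 M" "h \<in> L2 M"
  shows "l2norm M (\<lambda>x. f x - h x) \<le> l2norm M (\<lambda>x. f x - g x) + l2norm M (\<lambda>x. g x - h x)"
  using l2norm_triangle[OF L2_diff[OF assms(1,2)] L2_diff[OF assms(2,3)]] by simp

lemma l2norm_bounded_diff:
  assumes "f \<in> L2 M" "g \<in> L2 M"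
  shows "\<bar>l2norm M f - l2norm M g\<bar> \<le> l2norm M (\<lambda>x. f x - g x)"
  using l2norm_triangle[OF L2_diff[OF assms] assms(2)]
    l2norm_triangle[OF L2_diff[OF assms(2,1)] assms(1)] l2norm_diff_commute[of M f g] by simp

lemma l2norm_mono:
  fixes f :: "'a \<Rightarrow> 'b::euclidean_space" and g :: "'a \<Rightarrow> 'c::euclidean_space"
  assumes "f \<in> L2 M" "g \<in> L2 M" "\<And>x. x \<in> space M \<Longrightarrow> norm (f x) \<le> norm (g x)"
  shows "l2norm M f \<le> l2norm M g"
  unfolding l2norm_def
  by (intro real_sqrt_le_mono integral_mono) (use assms in \<open>auto dest: L2_integrable intro: power_mono\<close>)

lemma L2_tendsto_inner:
  fixes f :: "'i \<Rightarrow> 'a \<Rightarrow> 'b::euclidean_space"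
  assumes "\<And>n. f n \<in> L2 M" "\<And>n. g n \<in> L2 M" "f' \<in> L2 M" "g' \<in> L2 M"
    and "((\<lambda>n. l2norm M (\<lambda>x. f n x - f' x)) \<longlongrightarrow> 0) F" "((\<lambda>n. l2norm M (\<lambda>x. g n x - g' x)) \<longlongrightarrow> 0) F"
  shows "((\<lambda>n. LINT x|M. f n x \<bullet> g n x) \<longlongrightarrow> (LINT x|M. f' x \<bullet> g' x)) F"
proof -
  define E where "E n = l2norm M (\<lambda>x. f n x - f' x) * (l2norm M (\<lambda>x. g n x - g' x) + l2norm M g')
    + l2norm M f' * l2norm M (\<lambda>x. g n x - g' x)" for n
  have "(E \<longlongrightarrow> 0 * (0 + l2norm M g') + l2norm M f' * 0) F"
    unfolding E_def by (intro tendsto_intros assms)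
  then have E0: "(E \<longlongrightarrow> 0) F" by simp
  have "norm ((LINT x|M. f n x \<bullet> g n x) - (LINT x|M. f' x \<bullet> g' x)) \<le> E n" for n
  proof -
    note D = L2_diff[OF assms(1)[of n] assms(3)] L2_diff[OF assms(2)[of n] assms(4)]
    have "(LINT x|M. f n x \<bullet> g n x) - (LINT x|M. f' x \<bullet> g' x)
      = (LINT x|M. (f n x - f' x) \<bullet> g n x) + (LINT x|M. f' x \<bullet> (g n x - g' x))"
      using assms(1-4) by (simp add: inner_diff L2_inner_integrable)
    moreover have "\<bar>LINT x|M. (f n x - f' x) \<bullet> g n x\<bar> \<le>
        l2norm M (\<lambda>x. f n x - f' x) * (l2norm M (\<lambda>x. g n x - g' x) + l2norm M g')"
      using L2_Cauchy_Schwarz[OF D(1) assms(2)[of n]] l2norm_triangle[OF D(2) assms(4)]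
      by (smt (verit, best) Bochner_Integration.integral_cong diff_add_cancel l2norm_def
          l2norm_nonneg mult_left_mono)
    moreover have "\<bar>LINT x|M. f' x \<bullet> (g n x - g' x)\<bar> \<le> l2norm M f' * l2norm M (\<lambda>x. g n x - g' x)"
      by (rule L2_Cauchy_Schwarz[OF assms(3) D(2)])
    ultimately show ?thesis unfolding E_def by auto
  qed
  then have "((\<lambda>n. (LINT x|M. f n x \<bullet> g n x) - (LINT x|M. f' x \<bullet> g' x)) \<longlongrightarrow> 0) F"
    by (intro Lim_null_comparison[OF _ E0]) auto
  then show ?thesis by (simp add: LIM_zero_iff)
qed

lemma L2_tendsto_norm:
  assumes "\<And>n. f n \<in> L2 M" "f' \<in> L2 M" "((\<lambda>n. l2norm M (\<lambda>x. f n x - f' x)) \<longlongrightarrow> 0) F"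
  shows "((\<lambda>n. l2norm M (f n)) \<longlongrightarrow> l2norm M f') F"
proof -
  have "((\<lambda>n. l2norm M (f n) - l2norm M f') \<longlongrightarrow> 0) F"
    by (rule Lim_null_comparison[OF _ assms(3)]) (simp add: l2norm_bounded_diff[OF assms(1,2)])
  then show ?thesis by (simp add: LIM_zero_iff)
qed

lemma L2_AE_subseq:
  assumes "\<And>n. f n \<in> L2 M" "f' \<in> L2 M" "(\<lambda>n. l2norm M (\<lambda>x. f n x - f' x)) \<longlonglongrightarrow> 0"
  shows "\<exists>r::nat\<Rightarrow>nat. strict_mono r \<and> (AE x in M. (\<lambda>n. f (r n) x) \<longlonglongrightarrow> f' x)"
proof -
  have "(\<lambda>n. (l2norm M (\<lambda>x. f n x - f' x))\<^sup>2) \<longlonglongrightarrow> 0\<^sup>2"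
    by (intro tendsto_intros assms)
  then have "(\<lambda>n. (\<integral>x. norm ((norm (f n x - f' x))\<^sup>2) \<partial>M)) \<longlonglongrightarrow> 0"
    by (simp add: l2norm_power2)
  from tendsto_L1_AE_subseq[OF L2_integrable[OF L2_diff[OF assms(1,2)]] this]
  obtain r :: "nat \<Rightarrow> nat" where r: "strict_mono r" "AE x in M. (\<lambda>n. (norm (f (r n) x - f' x))\<^sup>2) \<longlonglongrightarrow> 0"
    by auto
  have "AE x in M. (\<lambda>n. f (r n) x) \<longlonglongrightarrow> f' x"
    using r(2)
  proof eventually_elim
    case (elim x)
    have "(\<lambda>n. sqrt ((norm (f (r n) x - f' x))\<^sup>2)) \<longlonglongrightarrow> sqrt 0"
      by (intro tendsto_intros elim)
    then show ?case by (simp add: LIM_zero_iff tendsto_norm_zero_iff)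
  qed
  with r(1) show ?thesis by auto
qed

text \<open>Passing through \<open>nn_integral\<close> yields integrability of the limit together
  with the bound. It can thus be applied to limits not yet known to be integrable, as in the
  completeness of L2 and in the extension of Ladyzhenskaya's inequality to V.\<close>

lemma L2_Fatou:
  fixes f :: "nat \<Rightarrow> 'a \<Rightarrow> real"
  assumes "\<And>n. integrable M (f n)" "\<And>n x. f n x \<ge> 0" "g \<in> borel_measurable M" "\<And>x. g x \<ge> 0"
    and "AE x in M. (\<lambda>n. f n x) \<longlonglongrightarrow> g x" "eventually (\<lambda>n. (LINT x|M. f n x) \<le> C) sequentially"
  shows "integrable M g \<and> (LINT x|M. g x) \<le> C"
proof -
  have "C \<ge> 0"
  proof -
    obtain n where "(LINT x|M. f n x) \<le> C"
      using assms(6) by (auto simp: eventually_sequentially)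
    moreover have "(LINT x|M. f n x) \<ge> 0" by (simp add: assms(2))
    ultimately show ?thesis by linarith
  qed
  have "(\<integral>\<^sup>+x. ennreal (g x) \<partial>M) = (\<integral>\<^sup>+x. liminf (\<lambda>n. ennreal (f n x)) \<partial>M)"
  proof (rule nn_integral_cong_AE, use assms(5) in eventually_elim)
    case (elim x)
    then have "(\<lambda>n. ennreal (f n x)) \<longlonglongrightarrow> ennreal (g x)" by (rule tendsto_ennrealI)
    then show ?case by (simp add: lim_imp_Liminf)
  qed
  also have "\<dots> \<le> liminf (\<lambda>n. \<integral>\<^sup>+x. ennreal (f n x) \<partial>M)"
    by (rule nn_integral_liminf) (use assms(1) in auto)
  also have "\<dots> \<le> liminf (\<lambda>n::nat. ennreal C)"
    by (rule Liminf_mono)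
      (use assms(6) in \<open>eventually_elim, simp add: nn_integral_eq_integral assms(1,2) ennreal_leI\<close>)
  also have "\<dots> = ennreal C" by (simp add: Liminf_const)
  finally have le: "(\<integral>\<^sup>+x. ennreal (g x) \<partial>M) \<le> ennreal C" .
  then have "integrable M g"
    by (intro integrableI_nonneg) (use assms in \<open>auto simp: le_less_trans[OF le]\<close>)
  moreover have "(LINT x|M. g x) \<le> C"
    using le \<open>C \<ge> 0\<close> assms(4) calculation by (simp add: nn_integral_eq_integral)
  ultimately show ?thesis by simp
qed

lemma Cauchy_fast_subseq:
  fixes d :: "nat \<Rightarrow> nat \<Rightarrow> real"
  assumes "\<And>e. e > 0 \<Longrightarrow> \<exists>N. \<forall>m\<ge>N. \<forall>n\<ge>N. d m n < e"
  shows "\<exists>r::nat\<Rightarrow>nat. strict_mono r \<and> (\<forall>n. d (r (Suc n)) (r n) < (1/2)^n)"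
proof -
  have "\<exists>N. \<forall>m\<ge>N. \<forall>n\<ge>N. d m n < (1/2)^k" for k :: nat by (rule assms) auto
  then obtain N where N: "\<And>k m n. m \<ge> N k \<Longrightarrow> n \<ge> N k \<Longrightarrow> d m n < (1/2)^k" by metis
  \<comment> \<open>\<open>Suc x\<close> forces strict growth, and \<open>N (Suc k)\<close> carries
    the next index past the threshold of its level.\<close>
  define r where "r = rec_nat (N 0) (\<lambda>k x. max (Suc x) (N (Suc k)))"
  have r: "r 0 = N 0" "\<And>k. r (Suc k) = max (Suc (r k)) (N (Suc k))" by (auto simp: r_def)
  have "r k \<ge> N k" for k by (cases k) (auto simp: r)
  moreover have "strict_mono r" by (rule strict_mono_Suc_iff[THEN iffD2]) (auto simp: r)
  ultimately show ?thesis
    using N r(2) by (intro exI[of _ r] conjI allI)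
      (auto intro!: N intro: order_trans[OF \<open>\<And>k. r k \<ge> N k\<close>] simp del: r(2) simp: strict_mono_less_eq)
qed

text \<open>Riesz-Fischer. On a finite measure space the increments of a fast subsequence are
  summable in L1, by Cauchy-Schwarz against the constant 1. Hence the telescoping series converges
  almost everywhere, and Fatou turns the Cauchy bound into a bound for the distance to the
  limit.\<close>

lemma L2_complete:
  fixes f :: "nat \<Rightarrow> 'a \<Rightarrow> 'b::euclidean_space"
  assumes "finite_measure M" "\<And>n. f n \<in> L2 M"
    and cau: "\<And>e. e > 0 \<Longrightarrow> \<exists>N. \<forall>m\<ge>N. \<forall>n\<ge>N. l2norm M (\<lambda>x. f m x - f n x) < e"
  shows "\<exists>g\<in>L2 M. (\<lambda>n. l2norm M (\<lambda>x. f n x - g x)) \<longlonglongrightarrow> 0"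
proof -
  interpret finite_measure M by fact
  note [measurable] = L2_measurable[OF assms(2)]
  obtain r :: "nat \<Rightarrow> nat" where r: "strict_mono r"
    "\<And>n. l2norm M (\<lambda>x. f (r (Suc n)) x - f (r n) x) < (1/2)^n"
    using Cauchy_fast_subseq[OF cau] by blast
  define d where "d n x = norm (f (r (Suc n)) x - f (r n) x)" for n x
  have dL: "d n \<in> L2 M" for n unfolding d_def by (intro L2_norm L2_diff assms)
  have one: "(\<lambda>x. 1::real) \<in> L2 M" by (auto simp: L2_def)
  define c where "c = l2norm M (\<lambda>x. 1::real)"
  have int_d: "integrable M (d n)" "(LINT x|M. d n x) \<le> (1/2)^n * c" for n
  proof -
    have dn: "\<bar>d n x\<bar> = d n x" for x by (simp add: d_def)
    show "integrable M (d n)"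
      using L2_mult_integrable[OF dL[of n] one] by (simp add: dn)
    have "(LINT x|M. d n x) \<le> l2norm M (d n) * c"
      using L2_Cauchy_Schwarz_norm[OF dL[of n] one] by (simp add: dn c_def)
    also have "\<dots> \<le> (1/2)^n * c"
      unfolding d_def l2norm_norm by (intro mult_right_mono less_imp_le[OF r(2)]) (auto simp: c_def)
    finally show "(LINT x|M. d n x) \<le> (1/2)^n * c" .
  qed
  have "(\<integral>\<^sup>+x. (\<Sum>n. ennreal (d n x)) \<partial>M) = (\<Sum>n. \<integral>\<^sup>+x. ennreal (d n x) \<partial>M)"
    by (rule nn_integral_suminf) (simp add: d_def)
  also have "\<dots> = (\<Sum>n. ennreal (LINT x|M. d n x))"
    by (intro suminf_cong nn_integral_eq_integral int_d AE_I2) (simp add: d_def)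
  also have "\<dots> \<le> (\<Sum>n. ennreal ((1/2)^n * c))"
    by (intro suminf_le ennreal_leI int_d) auto
  also have "\<dots> < \<infinity>"
    by (subst suminf_ennreal2) (auto simp: c_def intro!: summable_mult2 summable_geometric)
  finally have fin: "(\<integral>\<^sup>+x. (\<Sum>n. ennreal (d n x)) \<partial>M) \<noteq> \<infinity>" by auto
  have meas: "(\<lambda>x. \<Sum>n. ennreal (d n x)) \<in> borel_measurable M" unfolding d_def by measurable
  have "AE x in M. (\<Sum>n. ennreal (d n x)) \<noteq> \<infinity>"
    by (rule nn_integral_PInf_AE[OF meas fin])
  then have conv: "AE x in M. convergent (\<lambda>n. f (r n) x)"
  proof eventually_elim
    case (elim x)
    have "summable (\<lambda>n. d n x)"
      by (rule summable_suminf_not_top) (use elim in \<open>auto simp: d_def\<close>)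
    then have "summable (\<lambda>n. f (r (Suc n)) x - f (r n) x)"
      unfolding d_def by (rule summable_norm_cancel)
    then have "convergent (\<lambda>n. \<Sum>i<n. f (r (Suc i)) x - f (r i) x)"
      by (simp add: summable_iff_convergent)
    then obtain L where "(\<lambda>n. f (r n) x - f (r 0) x) \<longlonglongrightarrow> L"
      using sum_lessThan_telescope[of "\<lambda>n. f (r n) x"] by (auto simp: convergent_def)
    from tendsto_add[OF this tendsto_const[of "f (r 0) x"]] show ?case
      by (auto simp: convergent_def)
  qed
  define g where "g x = lim (\<lambda>n. f (r n) x)" for x
  have gm [measurable]: "g \<in> borel_measurable M" unfolding g_def by (rule borel_measurable_lim_metric) simp
  have lim: "AE x in M. (\<lambda>n. f (r n) x) \<longlonglongrightarrow> g x"
    using conv by eventually_elim (simp add: g_def convergent_LIMSEQ_iff)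
  have key: "\<exists>N. \<forall>n\<ge>N. (\<lambda>x. f n x - g x) \<in> L2 M \<and> l2norm M (\<lambda>x. f n x - g x) \<le> e" if "e > 0" for e
  proof -
    obtain N where N: "\<And>m n. m \<ge> N \<Longrightarrow> n \<ge> N \<Longrightarrow> l2norm M (\<lambda>x. f m x - f n x) < e"
      using cau[OF \<open>e > 0\<close>] by blast
    have "(\<lambda>x. f n x - g x) \<in> L2 M \<and> l2norm M (\<lambda>x. f n x - g x) \<le> e" if "n \<ge> N" for n
    proof -
      have "integrable M (\<lambda>x. (norm (f n x - g x))\<^sup>2) \<and> (LINT x|M. (norm (f n x - g x))\<^sup>2) \<le> e\<^sup>2"
      proof (rule L2_Fatou[where f="\<lambda>k x. (norm (f n x - f (r k) x))\<^sup>2"])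
        show "integrable M (\<lambda>x. (norm (f n x - f (r k) x))\<^sup>2)" for k
          using L2_diff[OF assms(2,2)] by (rule L2_integrable)
        show "AE x in M. (\<lambda>k. (norm (f n x - f (r k) x))\<^sup>2) \<longlonglongrightarrow> (norm (f n x - g x))\<^sup>2"
          using lim by eventually_elim (intro tendsto_intros)
        have "(LINT x|M. (norm (f n x - f (r k) x))\<^sup>2) \<le> e\<^sup>2" if "k \<ge> N" for k
          unfolding l2norm_power2[symmetric]
          by (rule power_mono[OF less_imp_le[OF N]]) (use \<open>n \<ge> N\<close> that seq_suble[OF r(1), of k] in auto)
        then show "eventually (\<lambda>k. (LINT x|M. (norm (f n x - f (r k) x))\<^sup>2) \<le> e\<^sup>2) sequentially"
          by (auto simp: eventually_sequentially)
      qed auto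
      then show ?thesis
        using \<open>e > 0\<close> by (auto simp: L2_def l2norm_def intro: real_le_lsqrt)
    qed
    then show ?thesis by blast
  qed
  obtain N where "(\<lambda>x. f N x - g x) \<in> L2 M" using key[of 1] by auto
  then have "g \<in> L2 M" using L2_diff[OF assms(2)[of N]] by fastforce
  moreover have "(\<lambda>n. l2norm M (\<lambda>x. f n x - g x)) \<longlonglongrightarrow> 0"
  proof (rule LIMSEQ_I)
    fix e :: real assume "e > 0"
    with key[of "e/2"] obtain N where "\<forall>n\<ge>N. l2norm M (\<lambda>x. f n x - g x) \<le> e/2" by auto
    with \<open>e > 0\<close> show "\<exists>N. \<forall>n\<ge>N. norm (l2norm M (\<lambda>x. f n x - g x) - 0) < e"
      by (intro exI[of _ N]) fastforce
  qed
  ultimately show ?thesis by blast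
qed

section \<open>Smooth functions and weak derivatives\<close>

lemma pd_cong:
  assumes "\<And>x. x \<in> S \<Longrightarrow> f x = g x" "x \<in> S"
  shows "pd S e f x = pd S e g x"
proof -
  have "(f has_derivative F) (at x within S) \<longleftrightarrow> (g has_derivative F) (at x within S)" for F
    using assms by (metis has_derivative_transform)
  then show ?thesis by (simp add: pd_def frechet_derivative_def)
qed

lemma differentiable_on_cong:
  assumes "\<And>x. x \<in> S \<Longrightarrow> f x = g x"
  shows "f differentiable_on S \<longleftrightarrow> g differentiable_on S"
  unfolding differentiable_on_def differentiable_def
  using assms by (metis has_derivative_transform)

lemma Ck_on_cong:
  assumes "\<And>x. x \<in> S \<Longrightarrow> f x = g x"
  shows "Ck_on k S f \<longleftrightarrow> Ck_on k S g"
  using assms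
proof (induction k arbitrary: f g)
  case 0
  then show ?case by (auto intro: continuous_on_cong)
next
  case (Suc k)
  have "Ck_on k S (pd S e f) = Ck_on k S (pd S e g)" for e
    by (rule Suc.IH) (rule pd_cong[OF Suc.prems])
  then show ?case using differentiable_on_cong[of S f g] Suc.prems by simp
qed

lemma Ck_on_Suc_D: "Ck_on (Suc k) S f \<Longrightarrow> Ck_on k S f"
  by (induction k arbitrary: f) (auto intro: differentiable_imp_continuous_on)

lemma pd_UNIV_eq: "(f has_derivative F) (at x) \<Longrightarrow> pd UNIV e f x = F e"
  unfolding pd_def by (metis frechet_derivative_at)

lemma differentiable_on_UNIV_has_derivative:
  assumes "f differentiable_on UNIV"
  shows "(f has_derivative (\<lambda>e. pd UNIV e f x)) (at x)"
  using assms by (simp add: pd_def differentiable_on_def frechet_derivative_works)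

lemma Ck_on_const: "Ck_on k UNIV (\<lambda>x::'a::euclidean_space. c)"
proof (induction k arbitrary: c)
  case (Suc k)
  have "pd UNIV e (\<lambda>x::'a. c) = (\<lambda>x. 0)" for e
    by (rule ext, rule pd_UNIV_eq) (auto intro!: derivative_eq_intros)
  then show ?case using Suc by (auto simp: differentiable_on_const)
qed simp

lemma Ck_on_add:
  assumes "Ck_on k UNIV f" "Ck_on k UNIV g"
  shows "Ck_on k UNIV (\<lambda>x::'a::euclidean_space. f x + g x)"
  using assms
proof (induction k arbitrary: f g)
  case 0
  then show ?case by (auto intro: continuous_intros)
next
  case (Suc k)
  have "pd UNIV e (\<lambda>x. f x + g x) = (\<lambda>x. pd UNIV e f x + pd UNIV e g x)" for e
    using Suc.prems
    by (intro ext pd_UNIV_eq) (auto intro!: derivative_eq_intros differentiable_on_UNIV_has_derivative)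
  then show ?case using Suc by (auto simp: differentiable_on_def)
qed

lemma Ck_on_mult:
  fixes f g :: "'a::euclidean_space \<Rightarrow> real"
  assumes "Ck_on k UNIV f" "Ck_on k UNIV g"
  shows "Ck_on k UNIV (\<lambda>x. f x * g x)"
  using assms
proof (induction k arbitrary: f g)
  case 0
  then show ?case by (auto intro: continuous_intros)
next
  case (Suc k)
  have "pd UNIV e (\<lambda>x. f x * g x) = (\<lambda>x. f x * pd UNIV e g x + pd UNIV e f x * g x)" for e
    using Suc.prems
    by (intro ext pd_UNIV_eq) (auto intro!: derivative_eq_intros differentiable_on_UNIV_has_derivative)
  moreover have "Ck_on k UNIV (\<lambda>x. f x * pd UNIV e g x + pd UNIV e f x * g x)" if "e \<in> Basis" for e
    using Suc that Ck_on_Suc_D[OF Suc.prems(1)] Ck_on_Suc_D[OF Suc.prems(2)]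
    by (intro Ck_on_add Suc.IH) auto
  ultimately show ?case using Suc.prems by (auto simp: differentiable_on_def)
qed

lemma Ck_on_prod:
  fixes f :: "'i \<Rightarrow> 'a::euclidean_space \<Rightarrow> real"
  assumes "\<And>i. i \<in> I \<Longrightarrow> Ck_on k UNIV (f i)"
  shows "Ck_on k UNIV (\<lambda>x. \<Prod>i\<in>I. f i x)"
  using assms by (induction I rule: infinite_finite_induct) (auto intro: Ck_on_const Ck_on_mult)

lemma Ck_on_affine:
  fixes f :: "real \<Rightarrow> real" and L :: "'a::euclidean_space \<Rightarrow> real"
  assumes "Ck_on k UNIV f" "bounded_linear L"
  shows "Ck_on k UNIV (\<lambda>x. f (L x + c))"
  using assms(1)
proof (induction k arbitrary: f)
  case 0
  have "continuous_on UNIV L" by (rule linear_continuous_on[OF assms(2)])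
  with 0 show ?case
    by (auto intro!: continuous_on_compose2[of UNIV f] continuous_intros)
next
  case (Suc k)
  have D: "((\<lambda>x. f (L x + c)) has_derivative (\<lambda>e. L e * pd UNIV 1 f (L x + c))) (at x)" for x
  proof -
    have "((\<lambda>x. L x + c) has_derivative L) (at x)"
      using assms(2) by (auto intro!: derivative_eq_intros bounded_linear_imp_has_derivative)
    moreover have "(f has_derivative (\<lambda>e. pd UNIV e f (L x + c))) (at (L x + c))"
      using Suc.prems by (intro differentiable_on_UNIV_has_derivative) simp
    ultimately have *: "((\<lambda>x. f (L x + c)) has_derivative (\<lambda>e. pd UNIV (L e) f (L x + c))) (at x)"
      using has_derivative_compose[of "\<lambda>x. L x + c" L x UNIV f] by auto
    have "bounded_linear (\<lambda>e. pd UNIV e f (L x + c))"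
      using Suc.prems has_derivative_bounded_linear differentiable_on_UNIV_has_derivative by fastforce
    then have "pd UNIV (L e *\<^sub>R 1) f (L x + c) = L e *\<^sub>R pd UNIV 1 f (L x + c)" for e
      by (rule linear_scale[OF bounded_linear.linear])
    then show ?thesis using * by simp
  qed
  have "pd UNIV e (\<lambda>x. f (L x + c)) = (\<lambda>x. L e * pd UNIV 1 f (L x + c))" for e
    by (rule ext, rule pd_UNIV_eq[OF D])
  moreover have "Ck_on k UNIV (\<lambda>x. L e * pd UNIV 1 f (L x + c))" for e
    by (intro Ck_on_mult Ck_on_const Suc.IH) (use Suc.prems in simp)
  ultimately show ?case
    using D by (auto simp: differentiable_on_def differentiable_def)
qed

section \<open>A smooth cutoff and bump functions on boxes\<close>

definition cutoff :: "real \<Rightarrow> real"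
  where "cutoff x = (if x > 0 then exp (- (1 / x)) else 0)"

lemma poly_exp_tendsto_0: "((\<lambda>z::real. poly r z * exp (- z)) \<longlongrightarrow> 0) at_top"
proof -
  have "(\<lambda>z. poly r z * exp (- z)) = (\<lambda>z. \<Sum>i\<le>degree r. coeff r i * (z ^ i / exp z))"
    by (auto simp: poly_altdef sum_distrib_right exp_minus sum_divide_distrib field_simps)
  moreover have "((\<lambda>z::real. \<Sum>i\<le>degree r. coeff r i * (z ^ i / exp z)) \<longlongrightarrow> (\<Sum>i\<le>degree r. coeff r i * 0)) at_top"
    by (intro tendsto_sum tendsto_mult tendsto_const tendsto_power_div_exp_0)
  ultimately show ?thesis by simp
qed

text \<open>With y = 1/x the chain rule turns p(y) exp(-y) into y^2 (p - p')(y) exp(-y), so this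
  family of functions is closed under differentiation. A single induction over it gives smoothness
  of \<open>cutoff\<close>, the point 0 included.\<close>

lemma cutoff_poly_DERIV:
  fixes p :: "real poly"
  defines "G \<equiv> \<lambda>q x. if x > 0 then poly q (1 / x) * exp (- (1 / x)) else 0"
  shows "(G p has_real_derivative G ([:0, 0, 1:] * (p - pderiv p)) x) (at x)"
proof (cases "x = 0")
  case False
  consider "x > 0" | "x < 0" using False by linarith
  then show ?thesis
  proof cases
    case 1
    have "((\<lambda>x. poly p (1 / x) * exp (- (1 / x))) has_real_derivative
        G ([:0, 0, 1:] * (p - pderiv p)) x) (at x)"
      using 1 by (auto intro!: derivative_eq_intros simp: G_def field_simps power2_eq_square)
    then show ?thesis
      by (rule DERIV_cong_ev[THEN iffD1, rotated -1])
        (use 1 in \<open>auto simp: G_def eventually_nhds intro!: exI[of _ "{0<..}"]\<close>)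
  next
    case 2
    have "((\<lambda>x. 0) has_real_derivative G ([:0, 0, 1:] * (p - pderiv p)) x) (at x)"
      using 2 by (auto simp: G_def)
    then show ?thesis
      by (rule DERIV_cong_ev[THEN iffD1, rotated -1])
        (use 2 in \<open>auto simp: G_def eventually_nhds intro!: exI[of _ "{..<0}"]\<close>)
  qed
next
  case True
  have "((\<lambda>y. (G p y - G p 0) / (y - 0)) \<longlongrightarrow> 0) (at 0)"
  proof (rule filterlim_split_at)
    show "((\<lambda>y. (G p y - G p 0) / (y - 0)) \<longlongrightarrow> 0) (at_left 0)"
      by (rule tendsto_eventually) (auto simp: eventually_at_filter G_def)
    have "((\<lambda>y. poly ([:0, 1:] * p) (inverse y) * exp (- inverse y)) \<longlongrightarrow> 0) (at_right (0::real))"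
      by (rule filterlim_compose[OF poly_exp_tendsto_0 filterlim_inverse_at_top_right])
    then show "((\<lambda>y. (G p y - G p 0) / (y - 0)) \<longlongrightarrow> 0) (at_right 0)"
      by (rule Lim_transform_eventually)
        (auto simp: eventually_at_filter G_def field_simps)
  qed
  then show ?thesis
    using True by (simp add: has_field_derivative_iff G_def)
qed

lemma pd_real_eq:
  assumes "(f has_real_derivative d) (at x)"
  shows "pd UNIV 1 f x = d"
  using pd_UNIV_eq[OF assms[unfolded has_field_derivative_def], of 1] by simp

lemma cutoff_poly_Ck:
  fixes p :: "real poly"
  shows "Ck_on k UNIV (\<lambda>x. if x > 0 then poly p (1 / x) * exp (- (1 / x)) else 0)"
proof (induction k arbitrary: p)
  case 0
  then show ?case
    by (auto intro!: continuous_at_imp_continuous_on DERIV_isCont[OF cutoff_poly_DERIV])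
next
  case (Suc k)
  have "pd UNIV 1 (\<lambda>x. if x > 0 then poly p (1 / x) * exp (- (1 / x)) else 0) =
    (\<lambda>x. if x > 0 then poly ([:0, 0, 1:] * (p - pderiv p)) (1 / x) * exp (- (1 / x)) else 0)"
    by (rule ext, rule pd_real_eq) (rule cutoff_poly_DERIV)
  moreover have "(\<lambda>x. if x > 0 then poly p (1 / x) * exp (- (1 / x)) else 0) differentiable_on UNIV"
    unfolding differentiable_on_def
    using cutoff_poly_DERIV[of p] real_differentiable_def by blast
  ultimately show ?case using Suc by simp
qed

lemma cutoff_Ck: "Ck_on k UNIV cutoff"
  using cutoff_poly_Ck[of k "[:1:]"] by (simp add: cutoff_def [abs_def] cong: if_cong)

lemma cutoff_nonneg: "cutoff x \<ge> 0" and cutoff_le_1: "cutoff x \<le> 1"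
  and cutoff_eq_0: "x \<le> 0 \<Longrightarrow> cutoff x = 0" and cutoff_pos: "x > 0 \<Longrightarrow> cutoff x > 0"
  by (auto simp: cutoff_def)

lemma cutoff_scaled_tendsto:
  assumes "x > 0"
  shows "(\<lambda>n. cutoff (real n * x + c)) \<longlonglongrightarrow> 1"
proof -
  have 1: "filterlim (\<lambda>n. real n * x + c) at_top sequentially"
    using filterlim_tendsto_add_at_top[OF tendsto_const[of c]
        filterlim_tendsto_pos_mult_at_top[OF tendsto_const assms filterlim_real_sequentially]]
    by (simp add: algebra_simps)
  have "((\<lambda>y. exp (- (1 / y))) \<longlongrightarrow> exp (- 0)) (at_top :: real filter)"
    by (intro tendsto_intros tendsto_divide_0[OF tendsto_const] filterlim_at_top_imp_at_infinity filterlim_ident)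
  moreover have "\<forall>\<^sub>F y in at_top. exp (- (1 / y)) = cutoff y"
    using eventually_gt_at_top[of 0] by eventually_elim (simp add: cutoff_def)
  ultimately have "(cutoff \<longlongrightarrow> exp (- 0)) at_top"
    by (rule Lim_transform_eventually)
  then have "(cutoff \<longlongrightarrow> 1) at_top" by simp
  from filterlim_compose[OF this 1] show ?thesis .
qed

text \<open>The shift by 1 keeps the support at distance 1/n from the faces, hence compact inside
  the open box. As n grows the functions tend to the indicator of the box.\<close>

definition bump :: "'a::euclidean_space \<Rightarrow> 'a \<Rightarrow> nat \<Rightarrow> 'a \<Rightarrow> real"
  where "bump c d n x = (\<Prod>i\<in>Basis. cutoff (real n * (x \<bullet> i - c \<bullet> i) - 1) * cutoff (real n * (d \<bullet> i - x \<bullet> i) - 1))"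

lemma bump_Ck: "Ck_on k UNIV (bump c d n)"
proof -
  have "Ck_on k UNIV (\<lambda>x::'a. cutoff (real n * (x \<bullet> i - c \<bullet> i) - 1))" for i
    using Ck_on_affine[OF cutoff_Ck bounded_linear_inner_left[of "real n *\<^sub>R i"], of k "- real n * (c \<bullet> i) - 1"]
    by (simp add: algebra_simps)
  moreover have "Ck_on k UNIV (\<lambda>x::'a. cutoff (real n * (d \<bullet> i - x \<bullet> i) - 1))" for i
    using Ck_on_affine[OF cutoff_Ck bounded_linear_inner_left[of "- real n *\<^sub>R i"], of k "real n * (d \<bullet> i) - 1"]
    by (simp add: algebra_simps)
  ultimately show ?thesis
    unfolding bump_def [abs_def] by (intro Ck_on_prod Ck_on_mult)
qed

lemma bump_nonneg: "bump c d n x \<ge> 0" and bump_le_1: "bump c d n x \<le> 1"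
  unfolding bump_def
  by (intro prod_nonneg mult_nonneg_nonneg cutoff_nonneg)
    (intro prod_le_1 conjI mult_nonneg_nonneg mult_le_one cutoff_nonneg cutoff_le_1)

lemma bump_eq_0:
  assumes "x \<notin> cbox (c + (1 / n) *\<^sub>R One) (d - (1 / n) *\<^sub>R One)" "n > 0"
  shows "bump c d n x = 0"
proof -
  obtain i where i: "i \<in> Basis" "x \<bullet> i < c \<bullet> i + 1 / n \<or> x \<bullet> i > d \<bullet> i - 1 / n"
    using assms by (auto simp: mem_box inner_simps inner_sum_left_Basis not_le)
  then have "cutoff (real n * (x \<bullet> i - c \<bullet> i) - 1) * cutoff (real n * (d \<bullet> i - x \<bullet> i) - 1) = 0"
    using assms(2) by (auto simp: cutoff_eq_0 field_simps)
  with i show ?thesis unfolding bump_def by (intro prod_zero finite_Basis bexI[of _ i])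
qed

lemma bump_test_fun:
  assumes "box c d \<subseteq> S" "n > 0"
  shows "test_fun S (bump c d n)"
  unfolding test_fun_def smooth_on_def
proof (intro conjI allI bump_Ck exI)
  have "cbox (c + (1 / n) *\<^sub>R One) (d - (1 / n) *\<^sub>R One) \<subseteq> box c d"
  proof
    fix x assume x: "x \<in> cbox (c + (1 / n) *\<^sub>R One) (d - (1 / n) *\<^sub>R One)"
    have n: "(0::real) < 1 / n" using assms(2) by simp
    have "c \<bullet> i < x \<bullet> i \<and> x \<bullet> i < d \<bullet> i" if "i \<in> Basis" for i
    proof -
      have "(c + (1 / n) *\<^sub>R One) \<bullet> i \<le> x \<bullet> i" "x \<bullet> i \<le> (d - (1 / n) *\<^sub>R One) \<bullet> i"
        using x that by (auto simp: mem_box)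
      then have "c \<bullet> i + 1 / n \<le> x \<bullet> i" "x \<bullet> i \<le> d \<bullet> i - 1 / n"
        using that by (simp_all add: inner_simps inner_sum_left_Basis)
      with n show ?thesis by linarith
    qed
    then show "x \<in> box c d" by (simp add: mem_box)
  qed
  then show "cbox (c + (1 / n) *\<^sub>R One) (d - (1 / n) *\<^sub>R One) \<subseteq> S" using assms by auto
qed (use bump_eq_0[OF _ assms(2)] in auto)

lemma bump_tendsto: "(\<lambda>n. bump c d n x) \<longlonglongrightarrow> indicator (box c d) x"
proof (cases "x \<in> box c d")
  case True
  have "(\<lambda>n. bump c d n x) \<longlonglongrightarrow> (\<Prod>i\<in>(Basis::'a set). 1 * 1)"
    unfolding bump_def diff_conv_add_uminus[of _ 1]
    by (intro tendsto_prod tendsto_mult cutoff_scaled_tendsto) (use True in \<open>auto simp: mem_box\<close>)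
  then show ?thesis using True by simp
next
  case False
  then obtain i where i: "i \<in> Basis" "x \<bullet> i \<le> c \<bullet> i \<or> x \<bullet> i \<ge> d \<bullet> i" by (auto simp: mem_box not_less)
  have "bump c d n x = 0" for n
  proof -
    have "real n * (x \<bullet> i - c \<bullet> i) - 1 \<le> 0 \<or> real n * (d \<bullet> i - x \<bullet> i) - 1 \<le> 0"
      using i(2) mult_nonneg_nonpos[of "real n" "x \<bullet> i - c \<bullet> i"] mult_nonneg_nonpos[of "real n" "d \<bullet> i - x \<bullet> i"]
      by auto
    then have "cutoff (real n * (x \<bullet> i - c \<bullet> i) - 1) * cutoff (real n * (d \<bullet> i - x \<bullet> i) - 1) = 0"
      using cutoff_eq_0 by auto
    then show ?thesis using i(1) unfolding bump_def by (intro prod_zero finite_Basis bexI[of _ i])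
  qed
  with False show ?thesis by simp
qed

text \<open>The positive and the negative part of g are densities of two measures that agree on
  boxes. Boxes form an intersection-stable generator of the Borel sets, so the measures coincide,
  and so do the densities almost everywhere.\<close>

lemma AE_zero_of_box_integrals:
  fixes g :: "'a::euclidean_space \<Rightarrow> real"
  assumes g: "integrable lebesgue g" and zero: "\<And>c d. (LINT x|lebesgue. indicator (box c d) x * g x) = 0"
  shows "AE x in lebesgue. g x = 0"
proof -
  \<comment> \<open>The comparison of measures takes place on Borel sets, so a Borel representative
    replaces g.\<close>
  obtain h where h [measurable]: "h \<in> borel_measurable lborel" and gh: "AE x in lborel. g x = h x"
    using completion_ex_borel_measurable_real[of g lborel] g by auto
  have gh': "AE x in lebesgue. g x = h x" using gh by (rule AE_completion)
  have "integrable lebesgue h"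
    using g gh' by (subst integrable_cong_AE[symmetric]) (auto simp: measurable_completion)
  then have ih: "integrable lborel h" by (simp add: integrable_completion)
  have zh: "(LINT x|lborel. indicator (box c d) x * h x) = 0" for c d
  proof -
    have "(LINT x|lborel. indicator (box c d) x * h x) = (LINT x|lebesgue. indicator (box c d) x * h x)"
      by (simp add: integral_completion)
    also have "\<dots> = (LINT x|lebesgue. indicator (box c d) x * g x)"
    proof (rule integral_cong_AE)
      show "(\<lambda>x. indicator (box c d) x * h x) \<in> borel_measurable lebesgue"
        by (rule measurable_completion) simp
      show "(\<lambda>x. indicator (box c d) x * g x) \<in> borel_measurable lebesgue"
        using g by (intro borel_measurable_times borel_measurable_indicator) auto
    qed (use gh' in auto)
    finally show ?thesis using zero by simp
  qed
  let ?P = "\<lambda>x. ennreal (h x)" and ?N = "\<lambda>x. ennreal (- h x)"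
  have box: "emeasure (density lborel ?P) (box c d) = emeasure (density lborel ?N) (box c d)
      \<and> emeasure (density lborel ?P) (box c d) \<noteq> \<infinity>" for c d
  proof -
    have i: "integrable lborel (\<lambda>x. indicator (box c d) x * max 0 (h x))"
      "integrable lborel (\<lambda>x. indicator (box c d) x * max 0 (- h x))"
      using integrable_mult_indicator[of "box c d" lborel "\<lambda>x. max 0 (h x)"]
        integrable_mult_indicator[of "box c d" lborel "\<lambda>x. max 0 (- h x)"] ih
      by simp_all
    have e: "(\<integral>\<^sup>+x. ennreal (k x) * indicator (box c d) x \<partial>lborel) = ennreal (LINT x|lborel. indicator (box c d) x * max 0 (k x))"
      if "integrable lborel (\<lambda>x. indicator (box c d) x * max 0 (k x))" for k :: "'a \<Rightarrow> real"
    proof -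
      have "(\<integral>\<^sup>+x. ennreal (k x) * indicator (box c d) x \<partial>lborel)
          = (\<integral>\<^sup>+x. ennreal (indicator (box c d) x * max 0 (k x)) \<partial>lborel)"
        by (intro nn_integral_cong) (auto simp: indicator_def ennreal_neg max_def)
      also have "\<dots> = ennreal (LINT x|lborel. indicator (box c d) x * max 0 (k x))"
        by (rule nn_integral_eq_integral[OF that]) auto
      finally show ?thesis .
    qed
    have "(LINT x|lborel. indicator (box c d) x * max 0 (h x)) - (LINT x|lborel. indicator (box c d) x * max 0 (- h x))
       = (LINT x|lborel. indicator (box c d) x * h x)"
      by (subst Bochner_Integration.integral_diff[symmetric, OF i])
        (intro Bochner_Integration.integral_cong, auto simp: indicator_def max_def)
    then show ?thesis
      by (simp add: emeasure_density e[OF i(1)] e[OF i(2)] zh)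
  qed
  have "density lborel ?P = density lborel ?N"
  proof (rule measure_eqI_generator_eq)
    let ?E = "range (\<lambda>(a, b). box a b::'a set)"
    show "Int_stable ?E"
      by (auto simp: Int_stable_def box_Int_box)
    show "?E \<subseteq> Pow UNIV" "sets (density lborel ?P) = sigma_sets UNIV ?E"
      "sets (density lborel ?N) = sigma_sets UNIV ?E"
      by (simp_all add: borel_eq_box)
    let ?A = "\<lambda>n::nat. box (- (real n *\<^sub>R One)) (real n *\<^sub>R One) :: 'a set"
    show "range ?A \<subseteq> ?E" "(\<Union>i. ?A i) = UNIV"
      unfolding UN_box_eq_UNIV by auto
    show "emeasure (density lborel ?P) (?A i) \<noteq> \<infinity>" for i using box by blast
    show "emeasure (density lborel ?P) X = emeasure (density lborel ?N) X" if "X \<in> ?E" for X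
      using that box by auto
  qed
  then have "AE x in lborel. ?P x = ?N x"
    by (intro sigma_finite_measure.density_unique[OF sigma_finite_lborel]) auto
  then have "AE x in lborel. h x = 0"
  proof eventually_elim
    case (elim x)
    then show ?case
      by (cases "h x" "0::real" rule: linorder_cases) (auto simp: ennreal_neg ennreal_eq_0_iff)
  qed
  then have "AE x in lebesgue. h x = 0" by (rule AE_completion)
  with gh' show ?thesis by eventually_elim simp
qed

lemma AE_zero_of_subbox_integrals:
  fixes f :: "'a::euclidean_space \<Rightarrow> real"
  assumes f: "integrable (lebesgue_on (box A B)) f"
    and zero: "\<And>c d. box c d \<subseteq> box A B \<Longrightarrow> (LINT x|lebesgue_on (box A B). indicator (box c d) x * f x) = 0"
  shows "AE x in lebesgue_on (box A B). f x = 0"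
proof -
  define g where "g x = indicator (box A B) x * f x" for x
  have "AE x in lebesgue. g x = 0"
  proof (rule AE_zero_of_box_integrals)
    show "integrable lebesgue g"
      using f by (simp add: g_def [abs_def] integrable_restrict_space)
    fix c d
    obtain c' d' where cd: "box c d \<inter> box A B = box c' d'" by (rule that[OF box_Int_box])
    have "(LINT x|lebesgue. indicator (box c d) x * g x)
        = (LINT x|lebesgue. indicator (box A B) x *\<^sub>R (indicator (box c' d') x * f x))"
      unfolding cd[symmetric]
      by (intro Bochner_Integration.integral_cong) (auto simp: g_def indicator_def)
    also have "\<dots> = (LINT x|lebesgue_on (box A B). indicator (box c' d') x * f x)"
      by (subst integral_restrict_space) auto
    also have "\<dots> = 0" using cd by (intro zero) auto
    finally show "(LINT x|lebesgue. indicator (box c d) x * g x) = 0" .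
  qed
  then have "AE x in lebesgue. x \<in> box A B \<longrightarrow> f x = 0"
    by eventually_elim (auto simp: g_def)
  then show ?thesis by (simp add: AE_restrict_space_iff)
qed

text \<open>The bumps of a subbox are test functions and tend boundedly to its indicator. By
  dominated convergence the integrals of f over all subboxes vanish.\<close>

lemma fundamental_lemma:
  fixes f :: "'a::euclidean_space \<Rightarrow> real"
  assumes f: "integrable (lebesgue_on (box A B)) f"
    and zero: "\<And>\<phi>. test_fun (box A B) \<phi> \<Longrightarrow> (LINT x|lebesgue_on (box A B). \<phi> x * f x) = 0"
  shows "AE x in lebesgue_on (box A B). f x = 0"
proof (rule AE_zero_of_subbox_integrals[OF f])
  fix c d :: 'a assume sub: "box c d \<subseteq> box A B"
  let ?M = "lebesgue_on (box A B)"
  have [measurable]: "f \<in> borel_measurable ?M" using f by auto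
  have bm [measurable]: "bump c d n \<in> borel_measurable ?M" for n
  proof -
    have "continuous_on UNIV (bump c d n)" using bump_Ck[of 0 c d n] by simp
    then have "continuous_on (box A B) (bump c d n)" using continuous_on_subset by blast
    then show ?thesis by (rule continuous_imp_measurable_on_sets_lebesgue) simp
  qed
  have im: "indicator (box c d) \<in> borel_measurable ?M" 
    by (intro measurable_restrict_space1 borel_measurable_indicator) simp
  have "(\<lambda>n. LINT x|?M. bump c d n x * f x) \<longlonglongrightarrow> (LINT x|?M. indicator (box c d) x * f x)"
  proof (rule integral_dominated_convergence[where w="\<lambda>x. norm (f x)"])
    show "(\<lambda>x. indicator (box c d) x * f x) \<in> borel_measurable ?M"
      using im by measurable
    show "AE x in ?M. (\<lambda>n. bump c d n x * f x) \<longlonglongrightarrow> indicator (box c d) x * f x"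
      by (intro AE_I2 tendsto_mult bump_tendsto tendsto_const)
    show "AE x in ?M. norm (bump c d n x * f x) \<le> norm (f x)" for n
      using bump_nonneg[of c d n] bump_le_1[of c d n]
      by (intro AE_I2) (auto simp: abs_mult intro!: mult_left_le_one_le)
  qed (use f in auto)
  moreover have "(\<lambda>n. LINT x|?M. bump c d n x * f x) \<longlonglongrightarrow> 0"
    by (rule tendsto_eventually)
      (auto intro!: zero bump_test_fun sub exI[of _ 1] simp: eventually_sequentially)
  ultimately show "(LINT x|?M. indicator (box c d) x * f x) = 0"
    using LIMSEQ_unique by blast
qed

section \<open>Calculus on a closed rectangle\<close>

lemma vector_derivative_slice_x:
  assumes "\<And>p. p \<in> cbox (c1, c2) (d1, d2) \<Longrightarrow> (F has_derivative F' p) (at p within cbox (c1, c2) (d1, d2))"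
    and "x \<in> {c1..d1::real}" "y \<in> {c2..d2::real}"
  shows "((\<lambda>x::real. F (x, y)) has_vector_derivative F' (x, y) (1, 0)) (at x within {c1..d1})"
proof -
  have "((\<lambda>x. (x, y)) has_vector_derivative (1, 0)) (at x within {c1..d1})"
    by (auto simp: has_vector_derivative_def intro!: derivative_eq_intros)
  moreover have "(F has_derivative F' (x, y)) (at (x, y) within (\<lambda>x. (x, y)) ` {c1..d1})"
    by (rule has_derivative_subset[OF assms(1)]) (use assms(2,3) in auto)
  ultimately show ?thesis
    using vector_derivative_diff_chain_within[of "\<lambda>x. (x, y)"] by (simp add: o_def)
qed

lemma vector_derivative_slice_y:
  assumes "\<And>p. p \<in> cbox (c1, c2) (d1, d2) \<Longrightarrow> (F has_derivative F' p) (at p within cbox (c1, c2) (d1, d2))"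
    and "x \<in> {c1..d1::real}" "y \<in> {c2..d2::real}"
  shows "((\<lambda>y::real. F (x, y)) has_vector_derivative F' (x, y) (0, 1)) (at y within {c2..d2})"
proof -
  have "((\<lambda>y. (x, y)) has_vector_derivative (0, 1)) (at y within {c2..d2})"
    by (auto simp: has_vector_derivative_def intro!: derivative_eq_intros)
  moreover have "(F has_derivative F' (x, y)) (at (x, y) within (\<lambda>y. (x, y)) ` {c2..d2})"
    by (rule has_derivative_subset[OF assms(1)]) (use assms(2,3) in auto)
  ultimately show ?thesis
    using vector_derivative_diff_chain_within[of "\<lambda>y. (x, y)"] by (simp add: o_def)
qed

lemma integral_partial_x:
  fixes F :: "plane \<Rightarrow> 'b::euclidean_space"
  assumes "c1 \<le> d1" "c2 \<le> d2"
    and "\<And>p. p \<in> cbox (c1, c2) (d1, d2) \<Longrightarrow> (F has_derivative F' p) (at p within cbox (c1, c2) (d1, d2))"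
    and cont: "continuous_on (cbox (c1, c2) (d1, d2)) (\<lambda>p. F' p (1, 0))"
  shows "integral (cbox (c1, c2) (d1, d2)) (\<lambda>p. F' p (1, 0)) = integral {c2..d2} (\<lambda>y. F (d1, y) - F (c1, y))"
proof -
  have "integral (cbox (c1, c2) (d1, d2)) (\<lambda>p. F' p (1, 0)) =
      integral (cbox c1 d1) (\<lambda>x. integral (cbox c2 d2) (\<lambda>y. F' (x, y) (1, 0)))"
    by (rule integral_prod_continuous[OF cont])
  also have "\<dots> = integral (cbox c2 d2) (\<lambda>y. integral (cbox c1 d1) (\<lambda>x. F' (x, y) (1, 0)))"
    by (rule integral_swap_continuous) (use cont in \<open>simp add: case_prod_beta'\<close>)
  also have "\<dots> = integral {c2..d2} (\<lambda>y. F (d1, y) - F (c1, y))"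
    unfolding interval_cbox
  proof (rule integral_cong)
    fix y assume "y \<in> cbox c2 d2"
    then have "((\<lambda>x. F' (x, y) (1, 0)) has_integral F (d1, y) - F (c1, y)) {c1..d1}"
      by (intro fundamental_theorem_of_calculus assms(1) vector_derivative_slice_x[OF assms(3)]) auto
    then show "integral (cbox c1 d1) (\<lambda>x. F' (x, y) (1, 0)) = F (d1, y) - F (c1, y)"
      by (simp add: integral_unique)
  qed
  finally show ?thesis .
qed

lemma integral_partial_y:
  fixes F :: "plane \<Rightarrow> 'b::euclidean_space"
  assumes "c1 \<le> d1" "c2 \<le> d2"
    and "\<And>p. p \<in> cbox (c1, c2) (d1, d2) \<Longrightarrow> (F has_derivative F' p) (at p within cbox (c1, c2) (d1, d2))"
    and cont: "continuous_on (cbox (c1, c2) (d1, d2)) (\<lambda>p. F' p (0, 1))"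
  shows "integral (cbox (c1, c2) (d1, d2)) (\<lambda>p. F' p (0, 1)) = integral {c1..d1} (\<lambda>x. F (x, d2) - F (x, c2))"
proof -
  have "integral (cbox (c1, c2) (d1, d2)) (\<lambda>p. F' p (0, 1)) =
      integral (cbox c1 d1) (\<lambda>x. integral (cbox c2 d2) (\<lambda>y. F' (x, y) (0, 1)))"
    by (rule integral_prod_continuous[OF cont])
  also have "\<dots> = integral {c1..d1} (\<lambda>x. F (x, d2) - F (x, c2))"
    unfolding interval_cbox
  proof (rule integral_cong)
    fix x assume "x \<in> cbox c1 d1"
    then have "((\<lambda>y. F' (x, y) (0, 1)) has_integral F (x, d2) - F (x, c2)) {c2..d2}"
      by (intro fundamental_theorem_of_calculus assms(2) vector_derivative_slice_y[OF assms(3)]) auto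
    then show "integral (cbox c2 d2) (\<lambda>y. F' (x, y) (0, 1)) = F (x, d2) - F (x, c2)"
      by (simp add: integral_unique)
  qed
  finally show ?thesis .
qed

lemma Basis_plane: "(Basis :: plane set) = {(1, 0), (0, 1)}"
  by (auto simp: Basis_prod_def)

lemma sum_Basis_plane: "(\<Sum>i\<in>(Basis :: plane set). f i) = f (1, 0) + f (0, 1)"
  by (simp add: Basis_plane)

locale rectangle =
  fixes a b :: real
  assumes a_pos: "a > 0" and b_pos: "b > 0"
begin

abbreviation R :: "plane set" where "R \<equiv> rect a b"
abbreviation cR :: "plane set" where "cR \<equiv> cbox (0, 0) (a, b)"
abbreviation M :: "plane measure" where "M \<equiv> lebesgue_on (rect a b)"
abbreviation D :: "plane \<Rightarrow> (plane \<Rightarrow> 'b::euclidean_space) \<Rightarrow> plane \<Rightarrow> 'b" where "D \<equiv> wd (rect a b)"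

lemma R_box: "R = box (0, 0) (a, b)"
  unfolding rect_def by (auto simp: box_def Basis_plane)

lemma closure_R: "closure R = cR"
  unfolding R_box by (rule closure_box) (use a_pos b_pos in \<open>auto simp: box_ne_empty Basis_plane\<close>)

lemma R_subset_cR: "R \<subseteq> cR"
  unfolding R_box by (rule box_subset_cbox)

lemma open_R: "open R"
  unfolding R_box by (rule open_box)

lemma R_lebesgue [measurable]: "R \<in> sets lebesgue"
  unfolding R_box by simp

lemma frontier_R: "frontier R = cR - R"
  by (simp add: frontier_def closure_R interior_open open_R)

lemma space_M [simp]: "space M = R"
  by simp

lemma finite_measure_M: "finite_measure M"
  using emeasure_lborel_box_finite[of "(0, 0)" "(a, b)"]
  by (intro finite_measureI) (simp add: R_box emeasure_restrict_space)

lemma rect_integrable_continuous: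
  fixes f :: "plane \<Rightarrow> 'b::euclidean_space"
  assumes "continuous_on cR f"
  shows "integrable M f"
proof -
  have "integrable (lebesgue_on cR) f" by (rule continuous_imp_integrable[OF assms])
  then have "set_integrable lebesgue cR f" by (simp add: integrable_restrict_space set_integrable_def)
  then have "set_integrable lebesgue R f" by (rule set_integrable_subset) (use R_subset_cR in auto)
  then show ?thesis by (simp add: integrable_restrict_space set_integrable_def)
qed

lemma rect_integral_continuous:
  fixes f :: "plane \<Rightarrow> 'b::euclidean_space"
  assumes "continuous_on cR f"
  shows "(LINT x|M. f x) = integral cR f"
  using lebesgue_integral_eq_integral[OF rect_integrable_continuous[OF assms]]
  by (simp add: R_box integral_open_interval)

lemma continuous_L2:
  fixes f :: "plane \<Rightarrow> 'b::euclidean_space"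
  assumes "continuous_on cR f"
  shows "f \<in> L2 M"
proof (rule L2_bound)
  show "f \<in> borel_measurable M"
    by (rule borel_measurable_integrable[OF rect_integrable_continuous[OF assms]])
  show "integrable M (\<lambda>x. (norm (f x))\<^sup>2)"
    by (intro rect_integrable_continuous continuous_intros assms)
qed simp

lemma rect_integral_partial:
  fixes F :: "plane \<Rightarrow> 'b::euclidean_space"
  assumes "\<And>p. p \<in> cR \<Longrightarrow> (F has_derivative F' p) (at p within cR)"
    and "\<And>i. i \<in> Basis \<Longrightarrow> continuous_on cR (\<lambda>p. F' p i)"
  shows "(LINT p|M. F' p (1, 0)) = integral {0..b} (\<lambda>y. F (a, y) - F (0, y))"
    and "(LINT p|M. F' p (0, 1)) = integral {0..a} (\<lambda>x. F (x, b) - F (x, 0))"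
  using a_pos b_pos assms
  by (auto simp: rect_integral_continuous Basis_plane intro!: integral_partial_x integral_partial_y)

subsection \<open>Functions that are smooth up to the boundary\<close>

lemma smooth_has_derivative:
  assumes "smooth_on cR f" "p \<in> cR"
  shows "(f has_derivative (\<lambda>e. pd cR e f p)) (at p within cR)"
  using assms(1)[unfolded smooth_on_def, rule_format, of 1] assms(2)
  by (simp add: pd_def differentiable_on_def frechet_derivative_works)

lemma smooth_continuous: "smooth_on cR f \<Longrightarrow> continuous_on cR f"
  by (auto simp: smooth_on_def dest: spec[of _ 0])

lemma smooth_pd: "smooth_on cR f \<Longrightarrow> e \<in> Basis \<Longrightarrow> smooth_on cR (pd cR e f)"
  unfolding smooth_on_def by (meson Ck_on.simps(2))

lemma smooth_pd_continuous: "smooth_on cR f \<Longrightarrow> e \<in> Basis \<Longrightarrow> continuous_on cR (pd cR e f)"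
  by (intro smooth_continuous smooth_pd)

lemma pd_cR_eq:
  assumes "(f has_derivative F) (at p within cR)" "p \<in> cR"
  shows "pd cR e f p = F e"
  unfolding pd_def
  by (subst frechet_derivative_within_cbox[OF _ assms(2,1)]) (use a_pos b_pos in \<open>auto simp: Basis_plane\<close>)

lemma smooth_diff:
  assumes "smooth_on cR f" "smooth_on cR g"
  shows "smooth_on cR (\<lambda>x. f x - g x)"
  unfolding smooth_on_def
proof
  fix k
  show "Ck_on k cR (\<lambda>x. f x - g x)"
    using assms
  proof (induction k arbitrary: f g)
    case 0
    then show ?case by (auto intro: continuous_intros smooth_continuous)
  next
    case (Suc k)
    have d: "((\<lambda>x. f x - g x) has_derivative (\<lambda>e. pd cR e f p - pd cR e g p)) (at p within cR)" if "p \<in> cR" for p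
      using Suc.prems that by (auto intro!: derivative_intros smooth_has_derivative)
    have "Ck_on k cR (pd cR e (\<lambda>x. f x - g x)) = Ck_on k cR (\<lambda>p. pd cR e f p - pd cR e g p)" for e
      by (rule Ck_on_cong) (rule pd_cR_eq[OF d])
    moreover have "Ck_on k cR (\<lambda>p. pd cR e f p - pd cR e g p)" if "e \<in> Basis" for e
      using Suc that smooth_pd by blast
    ultimately show ?case unfolding Ck_on.simps differentiable_on_def differentiable_def using d by blast
  qed
qed

lemma pd_cR_diff:
  assumes "smooth_on cR f" "smooth_on cR g" "p \<in> cR"
  shows "pd cR e (\<lambda>x. f x - g x) p = pd cR e f p - pd cR e g p"
  using assms by (intro pd_cR_eq) (auto intro!: derivative_intros smooth_has_derivative)

text \<open>The order of differentiation is exchanged by applying Fubini's theorem on every subrectangle.\<close>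

lemma smooth_pd_commute:
  fixes f :: "plane \<Rightarrow> real"
  assumes f: "smooth_on cR f"
  shows "AE p in M. pd cR (1, 0) (pd cR (0, 1) f) p = pd cR (0, 1) (pd cR (1, 0) f) p"
proof -
  let ?g = "\<lambda>p. pd cR (1, 0) (pd cR (0, 1) f) p - pd cR (0, 1) (pd cR (1, 0) f) p"
  have B: "(1, 0) \<in> (Basis :: plane set)" "(0, 1) \<in> (Basis :: plane set)" by (auto simp: Basis_plane)
  note s = smooth_pd[OF f B(1)] smooth_pd[OF f B(2)]
  note c = smooth_pd_continuous[OF s(1) B(2)] smooth_pd_continuous[OF s(2) B(1)]
  have cont: "continuous_on cR ?g" by (intro continuous_intros c)
  have "AE p in lebesgue_on (box (0, 0) (a, b)). ?g p = 0"
  proof (rule AE_zero_of_subbox_integrals)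
    show "integrable (lebesgue_on (box (0, 0) (a, b))) ?g"
      using rect_integrable_continuous[OF cont] by (simp add: R_box)
    fix c d :: plane assume sub: "box c d \<subseteq> box (0, 0) (a, b)"
    obtain c1 c2 d1 d2 where cd: "c = (c1, c2)" "d = (d1, d2)" by (cases c, cases d)
    show "(LINT x|lebesgue_on (box (0, 0) (a, b)). indicator (box c d) x * ?g x) = 0"
    proof (cases "box c d = {}")
      case False
      then have lt: "c1 < d1" "c2 < d2" by (auto simp: cd box_eq_empty Basis_plane not_le)
      let ?C = "cbox (c1, c2) (d1, d2)"
      have csub: "?C \<subseteq> cR"
        using closure_mono[OF sub] False closure_R R_box by (simp add: closure_box cd)
      note der = has_derivative_subset[OF smooth_has_derivative csub]
      note conts = continuous_on_subset[OF smooth_continuous csub] continuous_on_subset[OF smooth_pd_continuous csub]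
      have "integral ?C (pd cR (1, 0) (pd cR (0, 1) f)) = integral ?C (pd cR (0, 1) (pd cR (1, 0) f))"
      proof -
        have "integral ?C (pd cR (1, 0) (pd cR (0, 1) f))
            = integral {c2..d2} (\<lambda>y. pd cR (0, 1) f (d1, y) - pd cR (0, 1) f (c1, y))"
          by (intro integral_partial_x der conts s B) (use lt csub in auto)
        also have "\<dots> = (f (d1, d2) - f (c1, d2)) - (f (d1, c2) - f (c1, c2))"
        proof (rule integral_unique, rule fundamental_theorem_of_calculus)
          fix y assume y: "y \<in> {c2..d2}"
          show "((\<lambda>y. f (d1, y) - f (c1, y)) has_vector_derivative
              pd cR (0, 1) f (d1, y) - pd cR (0, 1) f (c1, y)) (at y within {c2..d2})"
            by (intro has_vector_derivative_diff vector_derivative_slice_y[of c1 c2 d1 d2] der f)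
              (use y lt csub in auto)
        qed (use lt in simp)
        \<comment> \<open>Both iterated integrals reduce to the same alternating sum of the four
          corner values; only its grouping differs.\<close>
        also have "\<dots> = (f (d1, d2) - f (d1, c2)) - (f (c1, d2) - f (c1, c2))" by simp
        also have "\<dots> = integral {c1..d1} (\<lambda>x. pd cR (1, 0) f (x, d2) - pd cR (1, 0) f (x, c2))"
        proof (rule integral_unique[symmetric], rule fundamental_theorem_of_calculus)
          fix x assume x: "x \<in> {c1..d1}"
          show "((\<lambda>x. f (x, d2) - f (x, c2)) has_vector_derivative
              pd cR (1, 0) f (x, d2) - pd cR (1, 0) f (x, c2)) (at x within {c1..d1})"
            by (intro has_vector_derivative_diff vector_derivative_slice_x[of c1 c2 d1 d2] der f)
              (use x lt csub in auto)
        qed (use lt in simp)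
        also have "\<dots> = integral ?C (pd cR (0, 1) (pd cR (1, 0) f))"
          by (intro integral_partial_y[symmetric] der conts s B) (use lt csub in auto)
        finally show ?thesis .
      qed
      then have z: "integral ?C ?g = 0"
        by (subst integral_diff) (auto intro!: integrable_continuous continuous_on_subset[OF _ csub] c)
      have ig: "integrable (lebesgue_on ?C) ?g"
        by (intro continuous_imp_integrable continuous_on_subset[OF cont csub])
      then have ig': "integrable (lebesgue_on (box c d)) ?g"
        using set_integrable_subset[of lebesgue ?C ?g "box c d"] box_subset_cbox[of c d]
        by (simp add: integrable_restrict_space set_integrable_def cd)
      have "(LINT x|lebesgue_on (box (0, 0) (a, b)). indicator (box c d) x * ?g x)
          = (LINT x|lebesgue. indicator (box c d) x *\<^sub>R ?g x)"
        by (subst integral_restrict_space)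
          (use sub in \<open>auto intro!: Bochner_Integration.integral_cong simp: indicator_def\<close>)
      also have "\<dots> = (LINT x|lebesgue_on (box c d). ?g x)"
        by (subst integral_restrict_space) auto
      also have "\<dots> = integral (box c d) ?g"
        by (rule lebesgue_integral_eq_integral[OF ig']) simp
      also have "\<dots> = 0" using z by (simp add: integral_open_interval cd)
      finally show ?thesis .
    qed simp
  qed
  then show ?thesis unfolding R_box by simp
qed

subsection \<open>Weak derivatives\<close>

lemma test_fun_facts:
  assumes "test_fun R \<phi>" "e \<in> Basis"
  shows "(\<phi> has_derivative (\<lambda>e. pd UNIV e \<phi> x)) (at x)" "continuous_on UNIV \<phi>"
    "continuous_on UNIV (pd UNIV e \<phi>)" "x \<notin> R \<Longrightarrow> \<phi> x = 0"
    "\<phi> \<in> L2 M" "pd UNIV e \<phi> \<in> L2 M"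
proof -
  have s: "smooth_on UNIV \<phi>" using assms by (simp add: test_fun_def)
  have 1: "Ck_on 1 UNIV \<phi>" and 0: "Ck_on 0 UNIV \<phi>" using s by (simp_all only: smooth_on_def)
  show "(\<phi> has_derivative (\<lambda>e. pd UNIV e \<phi> x)) (at x)"
    using 1 by (intro differentiable_on_UNIV_has_derivative) simp
  show c: "continuous_on UNIV \<phi>" "continuous_on UNIV (pd UNIV e \<phi>)" using 0 1 assms(2) by auto
  show "x \<notin> R \<Longrightarrow> \<phi> x = 0" using assms(1) unfolding test_fun_def by blast
  show "\<phi> \<in> L2 M" "pd UNIV e \<phi> \<in> L2 M"
    by (auto intro!: continuous_L2 continuous_on_subset[OF c(1)] continuous_on_subset[OF c(2)])
qed

lemma weak_pd_smooth:
  fixes f :: "plane \<Rightarrow> 'b::euclidean_space"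
  assumes f: "smooth_on cR f" and e: "e \<in> Basis"
  shows "weak_pd R e f (pd cR e f)"
  unfolding weak_pd_def
proof (intro allI impI)
  fix \<phi> assume \<phi>: "test_fun R \<phi>"
  note t = test_fun_facts[OF \<phi>]
  define F' where "F' p h = \<phi> p *\<^sub>R pd cR h f p + pd UNIV h \<phi> p *\<^sub>R f p" for p h
  have der: "((\<lambda>p. \<phi> p *\<^sub>R f p) has_derivative F' p) (at p within cR)" if "p \<in> cR" for p
    unfolding F'_def
    using has_derivative_scaleR[OF has_derivative_at_withinI[OF t(1)[OF e]] smooth_has_derivative[OF f that]]
    by simp
  have c1: "continuous_on cR \<phi>" "continuous_on cR (pd UNIV h \<phi>)" if "h \<in> Basis" for h
    using t(2,3)[OF that] continuous_on_subset by blast+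
  have c: "continuous_on cR (\<lambda>p. \<phi> p *\<^sub>R pd cR h f p)" "continuous_on cR (\<lambda>p. pd UNIV h \<phi> p *\<^sub>R f p)"
    if "h \<in> Basis" for h
    by (intro continuous_intros c1[OF that] smooth_pd_continuous[OF f that] smooth_continuous[OF f])+
  have c': "continuous_on cR (\<lambda>p. F' p h)" if "h \<in> Basis" for h
    unfolding F'_def by (intro continuous_intros c that)
  have z: "\<phi> (a, y) = 0" "\<phi> (0, y) = 0" "\<phi> (x, 0) = 0" "\<phi> (x, b) = 0" for x y
    by (auto intro!: t(4)[OF e] simp: rect_def)
  have "(LINT p|M. F' p e) = 0"
    using e rect_integral_partial[OF der c'] by (auto simp: Basis_plane z)
  moreover have "(LINT p|M. F' p e) = (LINT p|M. \<phi> p *\<^sub>R pd cR e f p) + (LINT p|M. pd UNIV e \<phi> p *\<^sub>R f p)"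
    unfolding F'_def by (intro Bochner_Integration.integral_add rect_integrable_continuous c e)
  ultimately show "(LINT x|M. pd UNIV e \<phi> x *\<^sub>R f x) = - (LINT x|M. \<phi> x *\<^sub>R pd cR e f x)"
    by (simp add: eq_neg_iff_add_eq_0 add.commute)
qed

text \<open>\<open>wd\<close> picks a weak derivative by Hilbert choice. Uniqueness almost
  everywhere makes this choice harmless, and it is the reason why all later identities for
  \<open>D\<close> hold only almost everywhere.\<close>

lemma weak_pd_unique:
  assumes "weak_pd R e f g1" "weak_pd R e f g2" "g1 \<in> L2 M" "g2 \<in> L2 M"
  shows "AE x in M. g1 x = g2 x"
proof -
  have "AE x in M. (g1 x - g2 x) \<bullet> j = 0" if j: "j \<in> Basis" for j
  proof -
    have L: "(\<lambda>x. g1 x - g2 x) \<in> L2 M" using assms by auto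
    have "AE x in lebesgue_on (box (0, 0) (a, b)). (g1 x - g2 x) \<bullet> j = 0"
    proof (rule fundamental_lemma)
      have "(\<lambda>x. (1::real)) \<in> L2 M" by (rule continuous_L2) auto
      from L2_scaleR_integrable[OF this L2_inner_const[OF L, of j]]
      show "integrable (lebesgue_on (box (0, 0) (a, b))) (\<lambda>x. (g1 x - g2 x) \<bullet> j)"
        by (simp add: R_box)
      fix \<phi> :: "plane \<Rightarrow> real" assume "test_fun (box (0, 0) (a, b)) \<phi>"
      then have \<phi>: "test_fun R \<phi>" by (simp add: R_box)
      then have \<phi>L: "\<phi> \<in> L2 M" using test_fun_facts(5)[OF \<phi>, of "(1, 0)"] by (simp add: Basis_plane)
      have "(LINT x|M. \<phi> x *\<^sub>R g1 x) = (LINT x|M. \<phi> x *\<^sub>R g2 x)"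
      proof -
        have "- (LINT x|M. \<phi> x *\<^sub>R g1 x) = - (LINT x|M. \<phi> x *\<^sub>R g2 x)"
          using assms(1,2) \<phi> unfolding weak_pd_def by metis
        then show ?thesis by simp
      qed
      then have "(LINT x|M. \<phi> x *\<^sub>R (g1 x - g2 x)) = 0"
        using L2_scaleR_integrable[OF \<phi>L assms(3)] L2_scaleR_integrable[OF \<phi>L assms(4)]
        by (simp add: scaleR_diff_right)
      then have "(LINT x|M. (\<phi> x *\<^sub>R (g1 x - g2 x)) \<bullet> j) = 0"
        using L2_scaleR_integrable[OF \<phi>L L] by (subst integral_inner_left) auto
      then show "(LINT x|lebesgue_on (box (0, 0) (a, b)). \<phi> x * ((g1 x - g2 x) \<bullet> j)) = 0"
        by (simp add: R_box)
    qed
    then show ?thesis unfolding R_box .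
  qed
  then have "AE x in M. \<forall>j\<in>Basis. (g1 x - g2 x) \<bullet> j = 0"
    by (simp add: AE_finite_all)
  then show ?thesis
    by eventually_elim (auto intro: euclidean_eqI simp: inner_diff_left)
qed

definition H1 :: "(plane \<Rightarrow> 'b::euclidean_space) set" where "H1 = sobolev 1 R"
definition h1norm :: "(plane \<Rightarrow> 'b::euclidean_space) \<Rightarrow> real" where "h1norm f = sobolev_norm 1 R f"

lemma H1_iff: "f \<in> H1 \<longleftrightarrow> f \<in> L2 M \<and> (\<forall>e\<in>Basis. \<exists>g\<in>L2 M. weak_pd R e f g)"
  unfolding H1_def by (auto simp: L2_space_eq)

lemma H1_wd:
  assumes "f \<in> H1" "e \<in> Basis"
  shows "D e f \<in> L2 M" "weak_pd R e f (D e f)"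
proof -
  obtain g where "g \<in> L2_space R \<and> weak_pd R e f g"
    using assms by (auto simp: H1_iff L2_space_eq)
  from someI[of "\<lambda>g. g \<in> L2_space R \<and> weak_pd R e f g", OF this]
  show "D e f \<in> L2 M" "weak_pd R e f (D e f)" by (auto simp: wd_def L2_space_eq)
qed

lemma H1_L2: "f \<in> H1 \<Longrightarrow> f \<in> L2 M"
  by (simp add: H1_iff)

lemma wd_eq:
  assumes "weak_pd R e f g" "g \<in> L2 M"
  shows "AE x in M. D e f x = g x" "D e f \<in> L2 M" "weak_pd R e f (D e f)"
proof -
  from someI[of "\<lambda>g. g \<in> L2_space R \<and> weak_pd R e f g" g] assms
  show *: "D e f \<in> L2 M" "weak_pd R e f (D e f)" by (auto simp: wd_def L2_space_eq)
  show "AE x in M. D e f x = g x" using weak_pd_unique * assms by blast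
qed

lemma weak_pd_cong_AE:
  assumes "AE x in M. f x = f' x" "AE x in M. g x = g' x"
    "f \<in> L2 M" "f' \<in> L2 M" "g \<in> L2 M" "g' \<in> L2 M" "weak_pd R e f g" "e \<in> Basis"
  shows "weak_pd R e f' g'"
  unfolding weak_pd_def
proof (intro allI impI)
  fix \<phi> assume \<phi>: "test_fun R \<phi>"
  note t = test_fun_facts(5,6)[OF \<phi> assms(8)]
  note I = L2_scaleR_integrable[OF t(2) assms(3)] L2_scaleR_integrable[OF t(2) assms(4)]
    L2_scaleR_integrable[OF t(1) assms(5)] L2_scaleR_integrable[OF t(1) assms(6)]
  have "(LINT x|M. pd UNIV e \<phi> x *\<^sub>R f' x) = (LINT x|M. pd UNIV e \<phi> x *\<^sub>R f x)"
    by (rule integral_cong_AE) (use I assms(1) in auto)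
  also have "\<dots> = - (LINT x|M. \<phi> x *\<^sub>R g x)" using assms(7) \<phi> by (simp add: weak_pd_def)
  also have "(LINT x|M. \<phi> x *\<^sub>R g x) = (LINT x|M. \<phi> x *\<^sub>R g' x)"
    by (rule integral_cong_AE) (use I assms(2) in auto)
  finally show "(LINT x|M. pd UNIV e \<phi> x *\<^sub>R f' x) = - (LINT x|M. \<phi> x *\<^sub>R g' x)" .
qed

lemma weak_pd_diff:
  assumes "f \<in> L2 M" "f' \<in> L2 M" "g \<in> L2 M" "g' \<in> L2 M" "weak_pd R e f g" "weak_pd R e f' g'" "e \<in> Basis"
  shows "weak_pd R e (\<lambda>x. f x - f' x) (\<lambda>x. g x - g' x)"
  unfolding weak_pd_def
proof (intro allI impI)
  fix \<phi> assume \<phi>: "test_fun R \<phi>"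
  note t = test_fun_facts(5,6)[OF \<phi> assms(7)]
  note I = L2_scaleR_integrable[OF t(2) assms(1)] L2_scaleR_integrable[OF t(2) assms(2)]
    L2_scaleR_integrable[OF t(1) assms(3)] L2_scaleR_integrable[OF t(1) assms(4)]
  show "(LINT x|M. pd UNIV e \<phi> x *\<^sub>R (f x - f' x)) = - (LINT x|M. \<phi> x *\<^sub>R (g x - g' x))"
    using assms(5,6) \<phi> I by (simp add: weak_pd_def scaleR_diff_right)
qed

lemma weak_pd_inner:
  assumes "f \<in> L2 M" "g \<in> L2 M" "weak_pd R e f g" "e \<in> Basis"
  shows "weak_pd R e (\<lambda>x. f x \<bullet> j) (\<lambda>x. g x \<bullet> j)"
  unfolding weak_pd_def
proof (intro allI impI)
  fix \<phi> assume \<phi>: "test_fun R \<phi>"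
  note t = test_fun_facts(5,6)[OF \<phi> assms(4)]
  note I = L2_scaleR_integrable[OF t(2) assms(1)] L2_scaleR_integrable[OF t(1) assms(2)]
  have "(LINT x|M. (pd UNIV e \<phi> x *\<^sub>R f x) \<bullet> j) = (LINT x|M. pd UNIV e \<phi> x *\<^sub>R f x) \<bullet> j"
    "(LINT x|M. (\<phi> x *\<^sub>R g x) \<bullet> j) = (LINT x|M. \<phi> x *\<^sub>R g x) \<bullet> j"
    by (rule integral_inner_left, rule I)+
  moreover have "(LINT x|M. pd UNIV e \<phi> x *\<^sub>R f x) = - (LINT x|M. \<phi> x *\<^sub>R g x)"
    using assms(3) \<phi> by (simp add: weak_pd_def)
  ultimately have "(LINT x|M. (pd UNIV e \<phi> x *\<^sub>R f x) \<bullet> j) = - (LINT x|M. (\<phi> x *\<^sub>R g x) \<bullet> j)"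
    by simp
  then show "(LINT x|M. pd UNIV e \<phi> x *\<^sub>R (f x \<bullet> j)) = - (LINT x|M. \<phi> x *\<^sub>R (g x \<bullet> j))" by simp
qed

text \<open>The weak derivative is a closed operator: for a fixed test function both sides of the
  defining identity are continuous in L2. Vector values are treated one coordinate at a time, which
  turns the integrals into scalar products.\<close>

lemma weak_pd_limit:
  fixes f :: "nat \<Rightarrow> plane \<Rightarrow> 'b::euclidean_space"
  assumes "\<And>n. f n \<in> L2 M" "f' \<in> L2 M" "\<And>n. g n \<in> L2 M" "g' \<in> L2 M" "\<And>n. weak_pd R e (f n) (g n)" "e \<in> Basis"
    "(\<lambda>n. l2norm M (\<lambda>x. f n x - f' x)) \<longlonglongrightarrow> 0" "(\<lambda>n. l2norm M (\<lambda>x. g n x - g' x)) \<longlonglongrightarrow> 0"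
  shows "weak_pd R e f' g'"
  unfolding weak_pd_def
proof (intro allI impI)
  fix \<phi> assume \<phi>: "test_fun R \<phi>"
  note t = test_fun_facts(5,6)[OF \<phi> assms(6)]
  have lim: "(\<lambda>n. LINT x|M. \<psi> x *\<^sub>R k n x) \<longlonglongrightarrow> (LINT x|M. \<psi> x *\<^sub>R k' x)"
    if "\<psi> \<in> L2 M" "\<And>n. k n \<in> L2 M" "k' \<in> L2 M" "(\<lambda>n. l2norm M (\<lambda>x. k n x - k' x)) \<longlonglongrightarrow> 0"
    for \<psi> :: "plane \<Rightarrow> real" and k :: "nat \<Rightarrow> plane \<Rightarrow> 'b" and k'
  proof (rule tendsto_componentwise_iff[THEN iffD2], intro ballI)
    fix j :: 'b assume "j \<in> Basis"
    have \<psi>j: "(\<lambda>x. \<psi> x *\<^sub>R j) \<in> L2 M"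
      using that(1) by (intro L2_bound[where h="\<lambda>x. (norm j)\<^sup>2 * (norm (\<psi> x))\<^sup>2"])
        (auto dest: L2_integrable L2_measurable simp: power_mult_distrib mult.commute)
    have "(\<lambda>n. LINT x|M. k n x \<bullet> (\<psi> x *\<^sub>R j)) \<longlonglongrightarrow> (LINT x|M. k' x \<bullet> (\<psi> x *\<^sub>R j))"
      by (rule L2_tendsto_inner[OF that(2) \<psi>j that(3) \<psi>j that(4)]) (simp add: l2norm_def)
    then have "(\<lambda>n. LINT x|M. (\<psi> x *\<^sub>R k n x) \<bullet> j) \<longlonglongrightarrow> (LINT x|M. (\<psi> x *\<^sub>R k' x) \<bullet> j)"
      by simp
    then show "(\<lambda>n. (LINT x|M. \<psi> x *\<^sub>R k n x) \<bullet> j) \<longlonglongrightarrow> (LINT x|M. \<psi> x *\<^sub>R k' x) \<bullet> j"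
      using L2_scaleR_integrable[OF that(1) that(2)] L2_scaleR_integrable[OF that(1) that(3)]
      by (simp only: integral_inner_left)
  qed
  have "(\<lambda>n. - (LINT x|M. \<phi> x *\<^sub>R g n x)) \<longlonglongrightarrow> - (LINT x|M. \<phi> x *\<^sub>R g' x)"
    by (intro tendsto_minus lim assms t)
  moreover have "(\<lambda>n. - (LINT x|M. \<phi> x *\<^sub>R g n x)) \<longlonglongrightarrow> (LINT x|M. pd UNIV e \<phi> x *\<^sub>R f' x)"
    using lim[OF t(2) assms(1,2,7)] assms(5) \<phi> by (simp add: weak_pd_def)
  ultimately show "(LINT x|M. pd UNIV e \<phi> x *\<^sub>R f' x) = - (LINT x|M. \<phi> x *\<^sub>R g' x)"
    using LIMSEQ_unique by blast
qed

lemma H1_diff: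
  assumes "f \<in> H1" "g \<in> H1"
  shows "(\<lambda>x. f x - g x) \<in> H1"
    and "e \<in> Basis \<Longrightarrow> AE x in M. D e (\<lambda>x. f x - g x) x = D e f x - D e g x"
proof -
  have w: "weak_pd R e (\<lambda>x. f x - g x) (\<lambda>x. D e f x - D e g x)" "(\<lambda>x. D e f x - D e g x) \<in> L2 M"
    if "e \<in> Basis" for e
    using weak_pd_diff[OF H1_L2 H1_L2 H1_wd(1) H1_wd(1) H1_wd(2) H1_wd(2)]
      assms that L2_diff[OF H1_wd(1) H1_wd(1)] by blast+
  show "(\<lambda>x. f x - g x) \<in> H1"
    unfolding H1_iff using assms H1_L2 w by blast
  show "AE x in M. D e (\<lambda>x. f x - g x) x = D e f x - D e g x" if "e \<in> Basis"
    using wd_eq(1)[OF w[OF that]] .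
qed

lemma l2norm_wd_diff:
  assumes "f \<in> H1" "g \<in> H1" "e \<in> Basis"
  shows "l2norm M (D e (\<lambda>x. f x - g x)) = l2norm M (\<lambda>x. D e f x - D e g x)"
  by (rule l2norm_cong_AE[OF H1_diff(2)[OF assms]])
    (intro L2_measurable L2_diff H1_wd(1) H1_diff(1) assms)+

lemma smooth_H1:
  assumes "smooth_on cR f"
  shows "f \<in> H1" and "e \<in> Basis \<Longrightarrow> AE x in M. D e f x = pd cR e f x"
proof -
  have L: "pd cR e f \<in> L2 M" if "e \<in> Basis" for e
    by (intro continuous_L2 smooth_pd_continuous assms that)
  then show "f \<in> H1"
    unfolding H1_iff using weak_pd_smooth[OF assms] continuous_L2[OF smooth_continuous[OF assms]] by blast
  show "AE x in M. D e f x = pd cR e f x" if "e \<in> Basis"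
    using wd_eq(1)[OF weak_pd_smooth[OF assms that] L[OF that]] .
qed

lemma sobolev_sq_eq:
  "sobolev_sq 1 R f = (l2norm M f)\<^sup>2 + (\<Sum>e\<in>Basis. (l2norm M (D e f))\<^sup>2)"
  by (simp add: l2norm_power2)

lemma h1norm_bounds:
  "l2norm M f \<le> h1norm f"
  "e \<in> Basis \<Longrightarrow> l2norm M (D e f) \<le> h1norm f"
  unfolding h1norm_def sobolev_norm_def sobolev_sq_eq
  by (auto intro!: real_le_rsqrt simp: sum_Basis_plane Basis_plane)

lemma h1norm_tendsto_iff:
  assumes "\<And>n::nat. f n \<in> H1" "f' \<in> H1"
  shows "(\<lambda>n. h1norm (\<lambda>x. f n x - f' x)) \<longlonglongrightarrow> 0 \<longleftrightarrow>
    (\<lambda>n. l2norm M (\<lambda>x. f n x - f' x)) \<longlonglongrightarrow> 0 \<and>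
    (\<forall>e\<in>Basis. (\<lambda>n. l2norm M (\<lambda>x. D e (f n) x - D e f' x)) \<longlonglongrightarrow> 0)" (is "?l \<longleftrightarrow> ?r")
proof
  assume l: ?l
  have "(\<lambda>n. l2norm M (\<lambda>x. f n x - f' x)) \<longlonglongrightarrow> 0"
    by (rule Lim_null_comparison[OF _ l]) (simp add: h1norm_bounds(1))
  moreover have "(\<lambda>n. l2norm M (\<lambda>x. D e (f n) x - D e f' x)) \<longlonglongrightarrow> 0" if "e \<in> Basis" for e
    unfolding l2norm_wd_diff[OF assms that, symmetric]
    by (rule Lim_null_comparison[OF _ l]) (simp add: h1norm_bounds(2)[OF that])
  ultimately show ?r by blast
next
  assume r: ?r
  have "(\<lambda>n. sqrt ((l2norm M (\<lambda>x. f n x - f' x))\<^sup>2 +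
      (\<Sum>e\<in>Basis. (l2norm M (\<lambda>x. D e (f n) x - D e f' x))\<^sup>2))) \<longlonglongrightarrow> sqrt (0\<^sup>2 + (\<Sum>e\<in>(Basis::plane set). 0\<^sup>2))"
    by (intro tendsto_intros) (use r in auto)
  then show ?l
    unfolding h1norm_def sobolev_norm_def sobolev_sq_eq by (simp add: l2norm_wd_diff assms cong: sum.cong)
qed

end

lemma inner_plane [simp]: "p \<bullet> (1, 0) = fst p" "p \<bullet> (0, 1) = snd p" for p :: plane
  by (cases p; simp)+

context rectangle
begin

section \<open>The spaces of the problem\<close>

abbreviation D1 :: "field set" where "D1 \<equiv> D1_space a b"
abbreviation V :: "field set" where "V \<equiv> V_space a b"
abbreviation Vn :: "field \<Rightarrow> real" where "Vn \<equiv> V_norm a b"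

lemma e_Basis [simp]: "(1, 0) \<in> (Basis :: plane set)" "(0, 1) \<in> (Basis :: plane set)"
  by (auto simp: Basis_plane)

lemma smooth_inner_has_derivative:
  assumes "smooth_on cR f" "p \<in> cR"
  shows "((\<lambda>p. f p \<bullet> j) has_derivative (\<lambda>e. pd cR e f p \<bullet> j)) (at p within cR)"
  by (rule has_derivative_inner_left[OF smooth_has_derivative[OF assms]])

lemma pd_cR_inner:
  assumes "smooth_on cR f" "p \<in> cR"
  shows "pd cR e (\<lambda>p. f p \<bullet> j) p = pd cR e f p \<bullet> j"
  by (rule pd_cR_eq[OF smooth_inner_has_derivative[OF assms] assms(2)])

lemma smooth_inner:
  assumes "smooth_on cR f"
  shows "smooth_on cR (\<lambda>p. f p \<bullet> j)"
  unfolding smooth_on_def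
proof
  fix k
  show "Ck_on k cR (\<lambda>p. f p \<bullet> j)"
    using assms
  proof (induction k arbitrary: f)
    case 0
    from smooth_continuous[OF 0] show ?case by (simp add: continuous_on_inner)
  next
    case (Suc k)
    have "Ck_on k cR (pd cR e (\<lambda>p. f p \<bullet> j)) = Ck_on k cR (\<lambda>p. pd cR e f p \<bullet> j)" for e
      by (rule Ck_on_cong) (rule pd_cR_inner[OF Suc.prems])
    moreover have "Ck_on k cR (\<lambda>p. pd cR e f p \<bullet> j)" if "e \<in> Basis" for e
      by (rule Suc.IH[OF smooth_pd[OF Suc.prems that]])
    ultimately show ?case
      unfolding Ck_on.simps differentiable_on_def differentiable_def
      using smooth_inner_has_derivative[OF Suc.prems] by blast
  qed
qed

lemma D1_smooth: "u \<in> D1 \<Longrightarrow> smooth_on cR u"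
  by (simp add: D1_space_def Let_def closure_R)

lemma D1_div: "u \<in> D1 \<Longrightarrow> p \<in> R \<Longrightarrow> fst (pd cR (1, 0) u p) + snd (pd cR (0, 1) u p) = 0"
  by (simp add: D1_space_def Let_def closure_R sum_Basis_plane)

text \<open>The edges are taken open because \<open>bdry_normal\<close> selects only one of the two
  normals at a corner. The edge integrals below do not see the endpoints.\<close>

lemma D1_bdry:
  assumes "u \<in> D1"
  shows "y \<in> {0<..<b} \<Longrightarrow> fst (u (0, y)) = 0" "y \<in> {0<..<b} \<Longrightarrow> fst (u (a, y)) = 0"
    "x \<in> {0<..<a} \<Longrightarrow> snd (u (x, 0)) = 0" "x \<in> {0<..<a} \<Longrightarrow> snd (u (x, b)) = 0"
proof -
  have n: "u p \<bullet> bdry_normal a b p = 0" if "p \<in> cR" "p \<notin> R" for p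
    using assms that by (simp add: D1_space_def Let_def frontier_R)
  have [simp]: "p \<bullet> (- 1, 0) = - fst p" "p \<bullet> (0, - 1) = - snd p" for p :: plane
    by (cases p; simp)+
  show "fst (u (0, y)) = 0" if "y \<in> {0<..<b}"
  proof -
    have "(0, y) \<in> cR" "(0, y) \<notin> R" "bdry_normal a b (0, y) = (- 1, 0)"
      using that a_pos by (simp_all add: rect_def bdry_normal_def)
    then show ?thesis using n[of "(0, y)"] by simp
  qed
  show "fst (u (a, y)) = 0" if "y \<in> {0<..<b}"
  proof -
    have "(a, y) \<in> cR" "(a, y) \<notin> R" "bdry_normal a b (a, y) = (1, 0)"
      using that a_pos by (simp_all add: rect_def bdry_normal_def)
    then show ?thesis using n[of "(a, y)"] by simp
  qed
  show "snd (u (x, 0)) = 0" if "x \<in> {0<..<a}"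
  proof -
    have "(x, 0) \<in> cR" "(x, 0) \<notin> R" "bdry_normal a b (x, 0) = (0, - 1)"
      using that b_pos by (simp_all add: rect_def bdry_normal_def)
    then show ?thesis using n[of "(x, 0)"] by simp
  qed
  show "snd (u (x, b)) = 0" if "x \<in> {0<..<a}"
  proof -
    have "(x, b) \<in> cR" "(x, b) \<notin> R" "bdry_normal a b (x, b) = (0, 1)"
      using that b_pos by (simp_all add: rect_def bdry_normal_def)
    then show ?thesis using n[of "(x, b)"] by simp
  qed
qed

lemma vector_derivative_zero_interior:
  fixes f :: "real \<Rightarrow> real"
  assumes "(f has_vector_derivative f') (at x within {c..d})" "\<And>t. t \<in> {c<..<d} \<Longrightarrow> f t = 0" "x \<in> {c<..<d}"
  shows "f' = 0"
proof -
  have "(f has_vector_derivative f') (at x within {c<..<d})"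
    by (rule has_vector_derivative_within_subset[OF assms(1)]) auto
  then have 1: "(f has_vector_derivative f') (at x)"
    using at_within_open[OF assms(3)] by simp
  have "(f has_vector_derivative 0) (at x)"
    by (rule has_vector_derivative_transform_within_open[of "\<lambda>x. 0" _ _ "{c<..<d}"]) (use assms in auto)
  then show ?thesis using 1 vector_derivative_unique_at by blast
qed

text \<open>The normal component vanishes along a whole straight edge, so its derivative along that
  edge vanishes too. On a curved boundary a curvature term would appear here.\<close>

lemma D1_bdry_tangential:
  assumes u: "u \<in> D1"
  shows "y \<in> {0<..<b} \<Longrightarrow> fst (pd cR (0, 1) u (0, y)) = 0" "y \<in> {0<..<b} \<Longrightarrow> fst (pd cR (0, 1) u (a, y)) = 0"
    "x \<in> {0<..<a} \<Longrightarrow> snd (pd cR (1, 0) u (x, 0)) = 0" "x \<in> {0<..<a} \<Longrightarrow> snd (pd cR (1, 0) u (x, b)) = 0"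
proof -
  note s = D1_smooth[OF u]
  have y: "fst (pd cR (0, 1) u (x, y)) = 0" if y: "y \<in> {0<..<b}" and x: "x = 0 \<or> x = a" for x y
  proof (rule vector_derivative_zero_interior[OF _ _ y])
    have "((\<lambda>y. u (x, y) \<bullet> (1, 0)) has_vector_derivative pd cR (0, 1) u (x, y) \<bullet> (1, 0)) (at y within {0..b})"
      by (rule vector_derivative_slice_y[OF smooth_inner_has_derivative[OF s]]) (use x y a_pos in auto)
    then show "((\<lambda>y. fst (u (x, y))) has_vector_derivative fst (pd cR (0, 1) u (x, y))) (at y within {0..b})"
      by simp
    show "fst (u (x, t)) = 0" if "t \<in> {0<..<b}" for t
      using x D1_bdry(1,2)[OF u that] by auto
  qed
  have x: "snd (pd cR (1, 0) u (x, y)) = 0" if x: "x \<in> {0<..<a}" and y: "y = 0 \<or> y = b" for x y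
  proof (rule vector_derivative_zero_interior[OF _ _ x])
    have "((\<lambda>x. u (x, y) \<bullet> (0, 1)) has_vector_derivative pd cR (1, 0) u (x, y) \<bullet> (0, 1)) (at x within {0..a})"
      by (rule vector_derivative_slice_x[OF smooth_inner_has_derivative[OF s]]) (use x y b_pos in auto)
    then show "((\<lambda>x. snd (u (x, y))) has_vector_derivative snd (pd cR (1, 0) u (x, y))) (at x within {0..a})"
      by simp
    show "snd (u (t, y)) = 0" if "t \<in> {0<..<a}" for t
      using y D1_bdry(3,4)[OF u that] by auto
  qed
  show "y \<in> {0<..<b} \<Longrightarrow> fst (pd cR (0, 1) u (0, y)) = 0" "y \<in> {0<..<b} \<Longrightarrow> fst (pd cR (0, 1) u (a, y)) = 0"
    "x \<in> {0<..<a} \<Longrightarrow> snd (pd cR (1, 0) u (x, 0)) = 0" "x \<in> {0<..<a} \<Longrightarrow> snd (pd cR (1, 0) u (x, b)) = 0"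
    using x y by auto
qed

lemma integral_vanish_interior:
  fixes f :: "real \<Rightarrow> 'b::banach"
  assumes "\<And>t. t \<in> {c<..<d} \<Longrightarrow> f t = 0"
  shows "integral {c..d} f = 0"
proof -
  have "integral {c<..<d} f = integral {c<..<d} (\<lambda>t. 0)"
    by (rule integral_cong) (rule assms)
  then show ?thesis by (simp add: integral_open_interval_real)
qed

section \<open>Integration by parts for smooth solenoidal fields\<close>

lemma rect_product_rule:
  fixes f g :: "plane \<Rightarrow> real"
  assumes "smooth_on cR f" "\<And>p. p \<in> cR \<Longrightarrow> (g has_derivative g' p) (at p within cR)"
    "\<And>i. i \<in> Basis \<Longrightarrow> continuous_on cR (\<lambda>p. g' p i)"
  shows "(\<And>y. y \<in> {0<..<b} \<Longrightarrow> f (0, y) * g (0, y) = 0 \<and> f (a, y) * g (a, y) = 0) \<Longrightarrow>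
      (LINT p|M. f p * g' p (1, 0)) = - (LINT p|M. pd cR (1, 0) f p * g p)"
    and "(\<And>x. x \<in> {0<..<a} \<Longrightarrow> f (x, 0) * g (x, 0) = 0 \<and> f (x, b) * g (x, b) = 0) \<Longrightarrow>
      (LINT p|M. f p * g' p (0, 1)) = - (LINT p|M. pd cR (0, 1) f p * g p)"
proof -
  define F' where "F' p h = f p * g' p h + pd cR h f p * g p" for p h
  have der: "((\<lambda>p. f p * g p) has_derivative F' p) (at p within cR)" if "p \<in> cR" for p
    unfolding F'_def
    using has_derivative_mult[OF smooth_has_derivative[OF assms(1) that] assms(2)[OF that]] by simp
  have gc: "continuous_on cR g"
    unfolding continuous_on_eq_continuous_within using assms(2) has_derivative_continuous by blast
  have c: "continuous_on cR (\<lambda>p. f p * g' p h)" "continuous_on cR (\<lambda>p. pd cR h f p * g p)" if "h \<in> Basis" for h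
    by (intro continuous_intros assms(3)[OF that] smooth_continuous[OF assms(1)] smooth_pd_continuous[OF assms(1) that] gc)+
  have c': "continuous_on cR (\<lambda>p. F' p h)" if "h \<in> Basis" for h
    unfolding F'_def by (intro continuous_intros c that)
  have s: "(LINT p|M. F' p h) = (LINT p|M. f p * g' p h) + (LINT p|M. pd cR h f p * g p)" if "h \<in> Basis" for h
    unfolding F'_def by (intro Bochner_Integration.integral_add rect_integrable_continuous c that)
  note P = rect_integral_partial[OF der c']
  show "(LINT p|M. f p * g' p (1, 0)) = - (LINT p|M. pd cR (1, 0) f p * g p)"
    if z: "\<And>y. y \<in> {0<..<b} \<Longrightarrow> f (0, y) * g (0, y) = 0 \<and> f (a, y) * g (a, y) = 0"
  proof -
    have "integral {0..b} (\<lambda>y. f (a, y) * g (a, y) - f (0, y) * g (0, y)) = 0"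
      by (rule integral_vanish_interior) (simp only: z diff_0_right)
    then show ?thesis using P(1) s[of "(1, 0)"] by simp
  qed
  show "(LINT p|M. f p * g' p (0, 1)) = - (LINT p|M. pd cR (0, 1) f p * g p)"
    if z: "\<And>x. x \<in> {0<..<a} \<Longrightarrow> f (x, 0) * g (x, 0) = 0 \<and> f (x, b) * g (x, b) = 0"
  proof -
    have "integral {0..a} (\<lambda>x. f (x, b) * g (x, b) - f (x, 0) * g (x, 0)) = 0"
      by (rule integral_vanish_interior) (simp only: z diff_0_right)
    then show ?thesis using P(2) s[of "(0, 1)"] by simp
  qed
qed

text \<open>The integrand is u . grad g, and u is divergence free and tangential to the boundary. It
  is applied with g equal to half of |psi|^2, which gives the cancellation in the trilinear
  form.\<close>

lemma D1_transport_zero: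
  fixes g :: "plane \<Rightarrow> real"
  assumes u: "u \<in> D1" and g: "\<And>p. p \<in> cR \<Longrightarrow> (g has_derivative g' p) (at p within cR)"
    and gc': "\<And>i. i \<in> Basis \<Longrightarrow> continuous_on cR (\<lambda>p. g' p i)"
  shows "(LINT p|M. fst (u p) * g' p (1, 0)) + (LINT p|M. snd (u p) * g' p (0, 1)) = 0"
proof -
  note s = D1_smooth[OF u]
  have gc: "continuous_on cR g"
    unfolding continuous_on_eq_continuous_within using g has_derivative_continuous by blast
  have 1: "(LINT p|M. u p \<bullet> (1, 0) * g' p (1, 0)) = - (LINT p|M. pd cR (1, 0) (\<lambda>p. u p \<bullet> (1, 0)) p * g p)"
    by (rule rect_product_rule(1)[OF smooth_inner[OF s] g gc']) (use D1_bdry[OF u] in auto)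
  have 2: "(LINT p|M. u p \<bullet> (0, 1) * g' p (0, 1)) = - (LINT p|M. pd cR (0, 1) (\<lambda>p. u p \<bullet> (0, 1)) p * g p)"
    by (rule rect_product_rule(2)[OF smooth_inner[OF s] g gc']) (use D1_bdry[OF u] in auto)
  have "(LINT p|M. pd cR (1, 0) (\<lambda>p. u p \<bullet> (1, 0)) p * g p) + (LINT p|M. pd cR (0, 1) (\<lambda>p. u p \<bullet> (0, 1)) p * g p)
    = (LINT p|M. pd cR (1, 0) (\<lambda>p. u p \<bullet> (1, 0)) p * g p + pd cR (0, 1) (\<lambda>p. u p \<bullet> (0, 1)) p * g p)"
    by (intro Bochner_Integration.integral_add[symmetric] rect_integrable_continuous continuous_intros
        smooth_pd_continuous smooth_inner s gc) auto
  also have "\<dots> = (LINT p|M. 0)"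
  proof (intro Bochner_Integration.integral_cong refl)
    fix p assume "p \<in> space M"
    then have p: "p \<in> R" "p \<in> cR" using R_subset_cR by auto
    show "pd cR (1, 0) (\<lambda>p. u p \<bullet> (1, 0)) p * g p + pd cR (0, 1) (\<lambda>p. u p \<bullet> (0, 1)) p * g p = 0"
      unfolding pd_cR_inner[OF s p(2)] using D1_div[OF u p(1)] by (simp flip: distrib_right)
  qed
  finally show ?thesis using 1 2 by simp
qed

definition scurl :: "field \<Rightarrow> plane \<Rightarrow> real"
  where "scurl u p = - fst (pd cR (0, 1) u p) + snd (pd cR (1, 0) u p)"

text \<open>For divergence-free fields the product of the gradients equals the product of the curls
  plus two Jacobian terms, one in (u2, v1) and one in (u1, v2). Each Jacobian integrates to zero
  after its derivatives are moved off u and the mixed derivatives of v are exchanged. Every boundary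
  term contains either a normal component of u or a tangential derivative of a normal component of
  v, and both vanish.\<close>

lemma D1_dirichlet_eq_curl:
  assumes u: "u \<in> D1" and v: "v \<in> D1"
  shows "(\<Sum>i\<in>Basis. LINT p|M. pd cR i u p \<bullet> pd cR i v p) = (LINT p|M. scurl u p * scurl v p)"
proof -
  note su = D1_smooth[OF u] and sv = D1_smooth[OF v]
  define u1 u2 v1 v2 where uv: "u1 = (\<lambda>p. u p \<bullet> (1, 0))" "u2 = (\<lambda>p. u p \<bullet> (0, 1))"
    "v1 = (\<lambda>p. v p \<bullet> (1, 0))" "v2 = (\<lambda>p. v p \<bullet> (0, 1))"
  have s: "smooth_on cR u1" "smooth_on cR u2" "smooth_on cR v1" "smooth_on cR v2"
    unfolding uv by (intro smooth_inner su sv)+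
  have eq: "fst (pd cR e u p) = pd cR e u1 p" "snd (pd cR e u p) = pd cR e u2 p"
    "fst (pd cR e v p) = pd cR e v1 p" "snd (pd cR e v p) = pd cR e v2 p" if "p \<in> cR" for e p
    unfolding uv pd_cR_inner[OF su that] pd_cR_inner[OF sv that] by simp_all
  let ?x = "pd cR (1, 0)" and ?y = "pd cR (0, 1)"
  note s1 = smooth_pd[OF _ e_Basis(1)] and s2 = smooth_pd[OF _ e_Basis(2)]
  note cs = continuous_intros smooth_continuous s s1 s2
  have edge: "p \<in> cR" if "p = (0, y) \<and> y \<in> {0<..<b} \<or> p = (a, y) \<and> y \<in> {0<..<b} \<or>
      p = (x, 0) \<and> x \<in> {0<..<a} \<or> p = (x, b) \<and> x \<in> {0<..<a}" for p x y
    using that a_pos b_pos by auto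
  have A: "(LINT p|M. u2 p * ?x (?y v1) p) = - (LINT p|M. ?x u2 p * ?y v1 p)"
    by (intro rect_product_rule(1) s smooth_has_derivative s1 s2 smooth_pd_continuous)
      (use D1_bdry_tangential(1,2)[OF v] eq(3)[OF edge, of _ _ _ "(0, 1)"] a_pos in \<open>auto simp: less_imp_le\<close>)
  have B: "(LINT p|M. u2 p * ?y (?x v1) p) = - (LINT p|M. ?y u2 p * ?x v1 p)"
    by (intro rect_product_rule(2) s smooth_has_derivative s1 s2 smooth_pd_continuous)
      (use D1_bdry(3,4)[OF u] in \<open>auto simp: uv\<close>)
  have C: "(LINT p|M. u1 p * ?y (?x v2) p) = - (LINT p|M. ?y u1 p * ?x v2 p)"
    by (intro rect_product_rule(2) s smooth_has_derivative s1 s2 smooth_pd_continuous)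
      (use D1_bdry_tangential(3,4)[OF v] eq(4)[OF edge, of _ _ _ "(1, 0)"] b_pos in \<open>auto simp: less_imp_le\<close>)
  have E: "(LINT p|M. u1 p * ?x (?y v2) p) = - (LINT p|M. ?x u1 p * ?y v2 p)"
    by (intro rect_product_rule(1) s smooth_has_derivative s1 s2 smooth_pd_continuous)
      (use D1_bdry(1,2)[OF u] in \<open>auto simp: uv\<close>)
  have AB: "(LINT p|M. u2 p * ?x (?y v1) p) = (LINT p|M. u2 p * ?y (?x v1) p)"
    by (rule integral_cong_AE, (rule borel_measurable_integrable, rule rect_integrable_continuous,
          rule continuous_on_mult; intro smooth_continuous s s1 s2)+)
      (use smooth_pd_commute[OF s(3)] in eventually_elim, simp)
  have CE: "(LINT p|M. u1 p * ?y (?x v2) p) = (LINT p|M. u1 p * ?x (?y v2) p)"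
    by (rule integral_cong_AE, (rule borel_measurable_integrable, rule rect_integrable_continuous,
          rule continuous_on_mult; intro smooth_continuous s s1 s2)+)
      (use smooth_pd_commute[OF s(4)] in eventually_elim, simp)
  note ii = rect_integrable_continuous
  have I: "integrable M (\<lambda>p. ?x u2 p * ?y v1 p)" "integrable M (\<lambda>p. ?y u2 p * ?x v1 p)"
    "integrable M (\<lambda>p. ?y u1 p * ?x v2 p)" "integrable M (\<lambda>p. ?x u1 p * ?y v2 p)"
    "integrable M (\<lambda>p. ?x u p \<bullet> ?x v p)" "integrable M (\<lambda>p. ?y u p \<bullet> ?y v p)"
    by (intro ii cs su sv)+
  have "(\<Sum>i\<in>Basis. LINT p|M. pd cR i u p \<bullet> pd cR i v p) = (LINT p|M. ?x u p \<bullet> ?x v p + ?y u p \<bullet> ?y v p)"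
    using I by (simp add: sum_Basis_plane)
  also have "\<dots> = (LINT p|M. scurl u p * scurl v p + (?x u2 p * ?y v1 p - ?y u2 p * ?x v1 p + ?y u1 p * ?x v2 p - ?x u1 p * ?y v2 p))"
  proof (intro Bochner_Integration.integral_cong refl)
    fix p assume "p \<in> space M"
    then have p: "p \<in> R" "p \<in> cR" using R_subset_cR by auto
    have "?x u1 p = - ?y u2 p" "?x v1 p = - ?y v2 p"
      using D1_div[OF u p(1)] D1_div[OF v p(1)] by (simp_all add: eq[OF p(2)])
    then show "?x u p \<bullet> ?x v p + ?y u p \<bullet> ?y v p = scurl u p * scurl v p +
        (?x u2 p * ?y v1 p - ?y u2 p * ?x v1 p + ?y u1 p * ?x v2 p - ?x u1 p * ?y v2 p)"
      unfolding scurl_def inner_prod_def eq[OF p(2)] by (simp add: algebra_simps)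
  qed
  also have "\<dots> = (LINT p|M. scurl u p * scurl v p) + ((LINT p|M. ?x u2 p * ?y v1 p) - (LINT p|M. ?y u2 p * ?x v1 p)
      + (LINT p|M. ?y u1 p * ?x v2 p) - (LINT p|M. ?x u1 p * ?y v2 p))"
  proof -
    have "integrable M (\<lambda>p. scurl u p * scurl v p)"
      unfolding scurl_def by (intro ii cs su sv)
    then show ?thesis using I by simp
  qed
  also have "\<dots> = (LINT p|M. scurl u p * scurl v p)"
    using A B C E AB CE by linarith
  finally show ?thesis .
qed

subsection \<open>Approximation by smooth fields\<close>

lemma V_H1: "u \<in> V \<Longrightarrow> u \<in> H1"
  by (simp add: V_space_def H1_def)

lemma V_L2: "u \<in> V \<Longrightarrow> u \<in> L2 M"
  by (intro H1_L2 V_H1)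

lemma V_wd_L2: "u \<in> V \<Longrightarrow> e \<in> Basis \<Longrightarrow> D e u \<in> L2 M"
  by (intro H1_wd V_H1)

lemma D1_H1: "u \<in> D1 \<Longrightarrow> u \<in> H1"
  by (intro smooth_H1 D1_smooth)

lemma V_approx:
  assumes "u \<in> V"
  shows "\<exists>\<phi>::nat \<Rightarrow> field. (\<forall>n. \<phi> n \<in> D1) \<and> (\<lambda>n. l2norm M (\<lambda>x. \<phi> n x - u x)) \<longlonglongrightarrow> 0 \<and>
    (\<forall>e\<in>Basis. (\<lambda>n. l2norm M (\<lambda>x. D e (\<phi> n) x - D e u x)) \<longlonglongrightarrow> 0)"
proof -
  have "\<exists>\<phi>\<in>D1. h1norm (\<lambda>x. u x - \<phi> x) < inverse (real (Suc n))" for n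
    using assms unfolding V_space_def h1norm_def by auto
  then have "\<exists>\<phi>. \<forall>n. \<phi> n \<in> D1 \<and> h1norm (\<lambda>x. u x - \<phi> n x) < inverse (real (Suc n))"
    by (intro choice allI) blast
  then obtain \<phi> where \<phi>: "\<And>n. \<phi> n \<in> D1" "\<And>n. h1norm (\<lambda>x. u x - \<phi> n x) < inverse (real (Suc n))"
    by blast
  note H = D1_H1[OF \<phi>(1)] V_H1[OF assms]
  have lim: "(\<lambda>n. h1norm (\<lambda>x. u x - \<phi> n x)) \<longlonglongrightarrow> 0"
    by (rule Lim_null_comparison[OF _ LIMSEQ_inverse_real_of_nat])
      (use \<phi>(2) in \<open>auto intro!: always_eventually less_imp_le simp: h1norm_def sobolev_norm_def sobolev_sq_eq sum_nonneg\<close>)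
  have "(\<lambda>n. l2norm M (\<lambda>x. \<phi> n x - u x)) \<longlonglongrightarrow> 0"
    by (rule Lim_null_comparison[OF _ lim]) (simp add: l2norm_diff_commute[of M _ u] h1norm_bounds(1))
  moreover have "(\<lambda>n. l2norm M (\<lambda>x. D e (\<phi> n) x - D e u x)) \<longlonglongrightarrow> 0" if "e \<in> Basis" for e
    by (rule Lim_null_comparison[OF _ lim])
      (simp add: l2norm_diff_commute[of M _ "D e u"] l2norm_wd_diff[OF H(2) H(1) that, symmetric] h1norm_bounds(2)[OF that])
  ultimately show ?thesis using \<phi>(1) by blast
qed

lemma h1norm_tendsto_neg:
  assumes "\<And>n. f n \<in> H1" "f' \<in> H1" "(\<lambda>n. l2norm M (\<lambda>x. f n x - f' x)) \<longlonglongrightarrow> 0"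
    "\<And>e. e \<in> Basis \<Longrightarrow> (\<lambda>n. l2norm M (\<lambda>x. D e (f n) x - D e f' x)) \<longlonglongrightarrow> 0"
  shows "(\<lambda>n. h1norm (\<lambda>x. f' x - f n x)) \<longlonglongrightarrow> 0"
proof -
  have "(\<lambda>n. sqrt ((l2norm M (\<lambda>x. f n x - f' x))\<^sup>2 +
      (\<Sum>e\<in>Basis. (l2norm M (\<lambda>x. D e (f n) x - D e f' x))\<^sup>2))) \<longlonglongrightarrow> sqrt (0\<^sup>2 + (\<Sum>e\<in>(Basis::plane set). 0\<^sup>2))"
    by (intro tendsto_intros) (use assms in auto)
  moreover have "h1norm (\<lambda>x. f' x - f n x) = sqrt ((l2norm M (\<lambda>x. f n x - f' x))\<^sup>2 +
      (\<Sum>e\<in>Basis. (l2norm M (\<lambda>x. D e (f n) x - D e f' x))\<^sup>2))" for n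
    unfolding h1norm_def sobolev_norm_def sobolev_sq_eq
    by (simp add: l2norm_wd_diff assms(1,2) l2norm_diff_commute[of M f'] l2norm_diff_commute[of M "D _ f'"] cong: sum.cong)
  ultimately show ?thesis by simp
qed

lemma V_intro:
  assumes "u \<in> H1" "\<And>n. \<phi> n \<in> D1" "(\<lambda>n::nat. l2norm M (\<lambda>x. \<phi> n x - u x)) \<longlonglongrightarrow> 0"
    "\<And>e. e \<in> Basis \<Longrightarrow> (\<lambda>n. l2norm M (\<lambda>x. D e (\<phi> n) x - D e u x)) \<longlonglongrightarrow> 0"
  shows "u \<in> V"
proof -
  have lim: "(\<lambda>n. h1norm (\<lambda>x. u x - \<phi> n x)) \<longlonglongrightarrow> 0"
    by (rule h1norm_tendsto_neg[OF D1_H1[OF assms(2)] assms(1,3,4)])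
  have "\<exists>\<phi>\<in>D1. h1norm (\<lambda>x. u x - \<phi> x) < \<epsilon>" if "\<epsilon> > 0" for \<epsilon>
    using order_tendstoD(2)[OF lim that] assms(2) by (auto simp: eventually_sequentially)
  then show ?thesis using assms(1) by (simp add: V_space_def H1_def h1norm_def)
qed

lemma D1_V: "u \<in> D1 \<Longrightarrow> u \<in> V"
  by (rule V_intro[OF D1_H1, of _ "\<lambda>n. u"]) (auto simp: l2norm_def)

lemma D1_diff:
  assumes "u \<in> D1" "v \<in> D1"
  shows "(\<lambda>x. u x - v x) \<in> D1"
proof -
  note s = D1_smooth[OF assms(1)] D1_smooth[OF assms(2)]
  have p: "pd cR e (\<lambda>x. u x - v x) p = pd cR e u p - pd cR e v p" if "p \<in> cR" for p e
    by (rule pd_cR_diff[OF s that])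
  show ?thesis
    unfolding D1_space_def Let_def closure_R
  proof (intro CollectI conjI ballI)
    show "smooth_on cR (\<lambda>x. u x - v x)" by (rule smooth_diff[OF s])
  next
    fix x assume "x \<in> R"
    then show "(\<Sum>i\<in>Basis. pd cR i (\<lambda>x. u x - v x) x \<bullet> i) = 0"
      using D1_div[OF assms(1), of x] D1_div[OF assms(2), of x] R_subset_cR
      by (simp add: p subset_eq sum_Basis_plane)
  next
    fix x assume x: "x \<in> frontier R"
    then have "x \<in> cR" by (simp add: frontier_R)
    then show "(u x - v x) \<bullet> bdry_normal a b x = 0"
      "- (pd cR (0, 1) (\<lambda>x. u x - v x) x \<bullet> (1, 0)) + pd cR (1, 0) (\<lambda>x. u x - v x) x \<bullet> (0, 1) = 0"
      using assms x by (simp_all add: p inner_diff_left D1_space_def Let_def closure_R)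
  qed
qed

lemma L2_lim_diff:
  assumes "\<And>n. f n \<in> L2 M" "\<And>n. g n \<in> L2 M" "f' \<in> L2 M" "g' \<in> L2 M"
    "(\<lambda>n. l2norm M (\<lambda>x. f n x - f' x)) \<longlonglongrightarrow> 0" "(\<lambda>n. l2norm M (\<lambda>x. g n x - g' x)) \<longlonglongrightarrow> 0"
  shows "(\<lambda>n::nat. l2norm M (\<lambda>x. (f n x - g n x) - (f' x - g' x))) \<longlonglongrightarrow> 0"
proof (rule Lim_null_comparison)
  show "(\<lambda>n. l2norm M (\<lambda>x. f n x - f' x) + l2norm M (\<lambda>x. g n x - g' x)) \<longlonglongrightarrow> 0"
    using tendsto_add[OF assms(5,6)] by simp
  have "l2norm M (\<lambda>x. (f n x - g n x) - (f' x - g' x)) \<le> l2norm M (\<lambda>x. f n x - f' x) + l2norm M (\<lambda>x. g n x - g' x)" for n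
    using l2norm_triangle_diff[OF L2_diff[OF assms(1,3)] L2_diff[OF assms(2,4)], of n n]
    by (simp add: algebra_simps)
  then show "\<forall>\<^sub>F n in sequentially. norm (l2norm M (\<lambda>x. (f n x - g n x) - (f' x - g' x)))
      \<le> l2norm M (\<lambda>x. f n x - f' x) + l2norm M (\<lambda>x. g n x - g' x)"
    by simp
qed

lemma V_diff:
  assumes u: "u \<in> V" and v: "v \<in> V"
  shows "(\<lambda>x. u x - v x) \<in> V"
proof -
  obtain \<phi> where \<phi>: "\<And>n::nat. \<phi> n \<in> D1" "(\<lambda>n. l2norm M (\<lambda>x. \<phi> n x - u x)) \<longlonglongrightarrow> 0"
    "\<And>e. e \<in> Basis \<Longrightarrow> (\<lambda>n. l2norm M (\<lambda>x. D e (\<phi> n) x - D e u x)) \<longlonglongrightarrow> 0" using V_approx[OF u] by blast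
  obtain \<psi> where \<psi>: "\<And>n::nat. \<psi> n \<in> D1" "(\<lambda>n. l2norm M (\<lambda>x. \<psi> n x - v x)) \<longlonglongrightarrow> 0"
    "\<And>e. e \<in> Basis \<Longrightarrow> (\<lambda>n. l2norm M (\<lambda>x. D e (\<psi> n) x - D e v x)) \<longlonglongrightarrow> 0" using V_approx[OF v] by blast
  note H = D1_H1[OF \<phi>(1)] D1_H1[OF \<psi>(1)] V_H1[OF u] V_H1[OF v]
  show ?thesis
  proof (rule V_intro)
    show "(\<lambda>x. u x - v x) \<in> H1" by (intro H1_diff H)
    show "(\<lambda>x. \<phi> n x - \<psi> n x) \<in> D1" for n by (intro D1_diff \<phi> \<psi>)
    show "(\<lambda>n. l2norm M (\<lambda>x. \<phi> n x - \<psi> n x - (u x - v x))) \<longlonglongrightarrow> 0"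
      by (intro L2_lim_diff \<phi> \<psi> H1_L2 H)
    fix e :: plane assume e: "e \<in> Basis"
    have "l2norm M (\<lambda>x. D e (\<lambda>x. \<phi> n x - \<psi> n x) x - D e (\<lambda>x. u x - v x) x)
        = l2norm M (\<lambda>x. (D e (\<phi> n) x - D e (\<psi> n) x) - (D e u x - D e v x))" for n
      by (rule l2norm_cong_AE, use H1_diff(2)[OF H(1)[of n] H(2)[of n] e] H1_diff(2)[OF H(3,4) e] in eventually_elim, simp)
        (intro L2_measurable L2_diff H1_wd H1_diff H e)+
    moreover have "(\<lambda>n. l2norm M (\<lambda>x. (D e (\<phi> n) x - D e (\<psi> n) x) - (D e u x - D e v x))) \<longlonglongrightarrow> 0"
      by (intro L2_lim_diff \<phi> \<psi> e H1_wd H)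
    ultimately show "(\<lambda>n. l2norm M (\<lambda>x. D e (\<lambda>x. \<phi> n x - \<psi> n x) x - D e (\<lambda>x. u x - v x) x)) \<longlonglongrightarrow> 0"
      by simp
  qed
qed

lemma H1_cong_AE:
  assumes "u \<in> H1" "AE x in M. u x = u' x" "u' \<in> L2 M"
  shows "u' \<in> H1" and "e \<in> Basis \<Longrightarrow> AE x in M. D e u' x = D e u x"
proof -
  have w: "weak_pd R e u' (D e u)" if "e \<in> Basis" for e
    by (rule weak_pd_cong_AE[OF assms(2) _ H1_L2[OF assms(1)] assms(3)])
      (use H1_wd[OF assms(1) that] that in auto)
  then show "u' \<in> H1" unfolding H1_iff using assms(3) H1_wd(1)[OF assms(1)] by blast
  show "e \<in> Basis \<Longrightarrow> AE x in M. D e u' x = D e u x"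
    using wd_eq(1)[OF w] H1_wd(1)[OF assms(1)] by blast
qed

text \<open>Needed because the H-continuous representative of a solution agrees with the solution
  only almost everywhere in space, while the solution is what is known to lie in V.\<close>

lemma V_cong_AE:
  assumes "u \<in> V" "AE x in M. u x = u' x" "u' \<in> L2 M"
  shows "u' \<in> V"
proof -
  note H = V_H1[OF assms(1)]
  note c = H1_cong_AE[OF H assms(2,3)]
  obtain \<phi> where \<phi>: "\<And>n::nat. \<phi> n \<in> D1" "(\<lambda>n. l2norm M (\<lambda>x. \<phi> n x - u x)) \<longlonglongrightarrow> 0"
    "\<And>e. e \<in> Basis \<Longrightarrow> (\<lambda>n. l2norm M (\<lambda>x. D e (\<phi> n) x - D e u x)) \<longlonglongrightarrow> 0" using V_approx[OF assms(1)] by blast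
  note L = H1_L2[OF D1_H1[OF \<phi>(1)]] H1_wd(1)[OF D1_H1[OF \<phi>(1)]]
  show ?thesis
  proof (rule V_intro[OF c(1) \<phi>(1)])
    have "l2norm M (\<lambda>x. \<phi> n x - u' x) = l2norm M (\<lambda>x. \<phi> n x - u x)" for n
      by (rule l2norm_cong_AE, use assms(2) in eventually_elim, simp)
        (intro L2_measurable L2_diff L assms(3) H1_L2 H)+
    then show "(\<lambda>n. l2norm M (\<lambda>x. \<phi> n x - u' x)) \<longlonglongrightarrow> 0" using \<phi>(2) by simp
    fix e :: plane assume e: "e \<in> Basis"
    have "l2norm M (\<lambda>x. D e (\<phi> n) x - D e u' x) = l2norm M (\<lambda>x. D e (\<phi> n) x - D e u x)" for n
      by (rule l2norm_cong_AE, use c(2)[OF e] in eventually_elim, simp)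
        (intro L2_measurable L2_diff L e H1_wd(1) c(1) H)+
    then show "(\<lambda>n. l2norm M (\<lambda>x. D e (\<phi> n) x - D e u' x)) \<longlonglongrightarrow> 0" using \<phi>(3)[OF e] by simp
  qed
qed

section \<open>The scalar product and the norm of V\<close>

lemma V_inner_eq:
  assumes "u \<in> H1" "v \<in> H1"
  shows "V_inner a b u v = (\<Sum>i\<in>Basis. LINT x|M. D i u x \<bullet> D i v x)"
proof -
  note L = H1_wd(1)[OF assms(1)] H1_wd(1)[OF assms(2)]
  have I: "integrable M (\<lambda>x. (D i u x \<bullet> j) * (D i v x \<bullet> j))" if "i \<in> Basis" for i j
    using L2_inner_integrable[OF L2_inner_const[OF L(1)[OF that], of j] L2_inner_const[OF L(2)[OF that], of j]] by simp
  have "V_inner a b u v = (\<Sum>j\<in>Basis. \<Sum>i\<in>Basis. LINT x|M. (D i u x \<bullet> j) * (D i v x \<bullet> j))"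
    unfolding V_inner_def by (intro sum.cong refl Bochner_Integration.integral_sum I)
  also have "\<dots> = (\<Sum>i\<in>Basis. \<Sum>j\<in>Basis. LINT x|M. (D i u x \<bullet> j) * (D i v x \<bullet> j))"
    by (rule sum.swap)
  also have "\<dots> = (\<Sum>i\<in>Basis. LINT x|M. (\<Sum>j\<in>Basis. (D i u x \<bullet> j) * (D i v x \<bullet> j)))"
    by (intro sum.cong refl Bochner_Integration.integral_sum[symmetric] I)
  also have "\<dots> = (\<Sum>i\<in>Basis. LINT x|M. D i u x \<bullet> D i v x)"
    by (simp add: euclidean_inner[symmetric])
  finally show ?thesis .
qed

lemma Vn_power2:
  assumes "u \<in> H1"
  shows "(Vn u)\<^sup>2 = (\<Sum>i\<in>Basis. (l2norm M (D i u))\<^sup>2)" "V_inner a b u u = (Vn u)\<^sup>2"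
proof -
  have "V_inner a b u u = (\<Sum>i\<in>Basis. (l2norm M (D i u))\<^sup>2)"
    by (simp add: V_inner_eq[OF assms assms] l2norm_inner)
  then show "(Vn u)\<^sup>2 = (\<Sum>i\<in>Basis. (l2norm M (D i u))\<^sup>2)" "V_inner a b u u = (Vn u)\<^sup>2"
    by (simp_all add: V_norm_def sum_nonneg)
qed

lemma Vn_nonneg: "u \<in> H1 \<Longrightarrow> Vn u \<ge> 0"
  using Vn_power2(2)[of u] zero_le_power2[of "Vn u"] unfolding V_norm_def by (simp only: real_sqrt_ge_zero)

lemma l2norm_wd_le_Vn:
  assumes "u \<in> H1" "e \<in> Basis"
  shows "l2norm M (D e u) \<le> Vn u"
proof (rule power2_le_imp_le[OF _ Vn_nonneg[OF assms(1)]])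
  show "(l2norm M (D e u))\<^sup>2 \<le> (Vn u)\<^sup>2"
    unfolding Vn_power2(1)[OF assms(1)] using assms(2) by (intro member_le_sum) auto
qed

lemma Vn_le_sum:
  assumes "u \<in> H1"
  shows "Vn u \<le> (\<Sum>i\<in>Basis. l2norm M (D i u))"
proof -
  have "Vn u = sqrt (\<Sum>i\<in>Basis. (l2norm M (D i u))\<^sup>2)"
    using Vn_power2(1)[OF assms] Vn_nonneg[OF assms] by (metis real_sqrt_unique)
  also have "\<dots> \<le> (\<Sum>i\<in>Basis. l2norm M (D i u))"
    using L2_set_le_sum_abs[of "\<lambda>i. l2norm M (D i u)"] by (simp add: L2_set_def)
  finally show ?thesis .
qed

lemma V_inner_commute: "V_inner a b u v = V_inner a b v u"
  by (simp add: V_inner_def mult.commute)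

lemma V_inner_diff_left:
  assumes "u \<in> H1" "v \<in> H1" "w \<in> H1"
  shows "V_inner a b (\<lambda>x. u x - v x) w = V_inner a b u w - V_inner a b v w"
proof -
  have "(LINT x|M. D i (\<lambda>x. u x - v x) x \<bullet> D i w x) = (LINT x|M. D i u x \<bullet> D i w x) - (LINT x|M. D i v x \<bullet> D i w x)"
    if i: "i \<in> Basis" for i
  proof -
    note L = H1_wd(1)[OF assms(1) i] H1_wd(1)[OF assms(2) i] H1_wd(1)[OF assms(3) i] H1_wd(1)[OF H1_diff(1)[OF assms(1,2)] i]
    have "(LINT x|M. D i (\<lambda>x. u x - v x) x \<bullet> D i w x) = (LINT x|M. (D i u x - D i v x) \<bullet> D i w x)"
      by (rule integral_cong_AE, rule borel_measurable_integrable[OF L2_inner_integrable[OF L(4,3)]],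
          rule borel_measurable_integrable[OF L2_inner_integrable[OF L2_diff[OF L(1,2)] L(3)]],
          use H1_diff(2)[OF assms(1,2) i] in eventually_elim, simp)
    then show ?thesis using L by (simp add: inner_diff_left L2_inner_integrable)
  qed
  then show ?thesis
    unfolding V_inner_eq[OF assms(1,3)] V_inner_eq[OF assms(2,3)] V_inner_eq[OF H1_diff(1)[OF assms(1,2)] assms(3)]
    by (simp add: sum_subtractf)
qed

lemma V_inner_diff_right:
  assumes "u \<in> H1" "v \<in> H1" "w \<in> H1"
  shows "V_inner a b w (\<lambda>x. u x - v x) = V_inner a b w u - V_inner a b w v"
  using V_inner_diff_left[OF assms] by (simp add: V_inner_commute)

lemma V_inner_Cauchy_Schwarz:
  assumes "u \<in> H1" "v \<in> H1"
  shows "\<bar>V_inner a b u v\<bar> \<le> Vn u * Vn v"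
proof -
  have "\<bar>V_inner a b u v\<bar> \<le> (\<Sum>i\<in>Basis. \<bar>LINT x|M. D i u x \<bullet> D i v x\<bar>)"
    unfolding V_inner_eq[OF assms] by (rule sum_abs)
  also have "\<dots> \<le> (\<Sum>i\<in>Basis. \<bar>l2norm M (D i u)\<bar> * \<bar>l2norm M (D i v)\<bar>)"
    by (intro sum_mono) (simp add: L2_Cauchy_Schwarz H1_wd(1) assms)
  also have "\<dots> \<le> L2_set (\<lambda>i. l2norm M (D i u)) Basis * L2_set (\<lambda>i. l2norm M (D i v)) Basis"
    by (rule L2_set_mult_ineq)
  also have "\<dots> = Vn u * Vn v"
    unfolding L2_set_def Vn_power2(1)[OF assms(1), symmetric] Vn_power2(1)[OF assms(2), symmetric]
    by (simp add: Vn_nonneg assms)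
  finally show ?thesis .
qed

lemma Vn_triangle:
  assumes "u \<in> H1" "v \<in> H1" "w \<in> H1"
  shows "Vn (\<lambda>x. u x - w x) \<le> Vn (\<lambda>x. u x - v x) + Vn (\<lambda>x. v x - w x)"
proof -
  let ?p = "\<lambda>x. u x - v x" and ?q = "\<lambda>x. v x - w x" and ?r = "\<lambda>x. u x - w x"
  have H: "?p \<in> H1" "?q \<in> H1" "?r \<in> H1" by (intro H1_diff(1) assms)+
  have n: "(Vn ?r)\<^sup>2 = V_inner a b ?r ?r" using Vn_power2(2)[OF H(3)] by simp
  also have "\<dots> = V_inner a b ?r ?p + V_inner a b ?r ?q"
    by (simp add: V_inner_diff_right assms H)
  also have "\<dots> \<le> Vn ?r * (Vn ?p + Vn ?q)"
    using V_inner_Cauchy_Schwarz[OF H(3,1)] V_inner_Cauchy_Schwarz[OF H(3,2)] by (simp add: distrib_left)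
  finally have "Vn ?r * Vn ?r \<le> Vn ?r * (Vn ?p + Vn ?q)" by (simp add: power2_eq_square)
  then show ?thesis
    using Vn_nonneg[OF H(1)] Vn_nonneg[OF H(2)] Vn_nonneg[OF H(3)]
    by (cases "Vn ?r = 0") auto
qed

lemma Vn_diff_commute:
  assumes "u \<in> H1" "v \<in> H1"
  shows "Vn (\<lambda>x. u x - v x) = Vn (\<lambda>x. v x - u x)"
  unfolding V_norm_def by (simp add: V_inner_diff_left V_inner_diff_right assms H1_diff(1))

text \<open>\<open>Vn\<close> sees only the derivatives, so convergence of the values in L2 is a
  separate hypothesis. Completeness of L2 gives limits of the derivatives, closedness of the weak
  derivative identifies them, and a diagonal choice of fields in \<open>D1\<close> approximates the
  limit. This later carries continuity from a set of full measure to every time.\<close>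

lemma V_closed:
  assumes z: "\<And>n::nat. z n \<in> V" "z' \<in> L2 M" "(\<lambda>n. l2norm M (\<lambda>x. z n x - z' x)) \<longlonglongrightarrow> 0"
    and cau: "\<And>\<epsilon>. \<epsilon> > 0 \<Longrightarrow> \<exists>N. \<forall>m\<ge>N. \<forall>n\<ge>N. Vn (\<lambda>x. z m x - z n x) < \<epsilon>"
  shows "z' \<in> V" "(\<lambda>n. Vn (\<lambda>x. z n x - z' x)) \<longlonglongrightarrow> 0"
proof -
  note H = V_H1[OF z(1)]
  have "\<exists>g\<in>L2 M. (\<lambda>n. l2norm M (\<lambda>x. D e (z n) x - g x)) \<longlonglongrightarrow> 0" if e: "e \<in> Basis" for e
  proof (rule L2_complete[OF finite_measure_M])
    show "D e (z n) \<in> L2 M" for n by (rule H1_wd(1)[OF H e])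
    fix \<epsilon> :: real assume "\<epsilon> > 0"
    from cau[OF this] obtain N where N: "\<And>m n. m \<ge> N \<Longrightarrow> n \<ge> N \<Longrightarrow> Vn (\<lambda>x. z m x - z n x) < \<epsilon>" by blast
    have "l2norm M (\<lambda>x. D e (z m) x - D e (z n) x) \<le> Vn (\<lambda>x. z m x - z n x)" for m n
      using l2norm_wd_le_Vn[OF H1_diff(1)[OF H H] e, of m n] by (simp add: l2norm_wd_diff[OF H H e])
    then show "\<exists>N. \<forall>m\<ge>N. \<forall>n\<ge>N. l2norm M (\<lambda>x. D e (z m) x - D e (z n) x) < \<epsilon>"
      using N le_less_trans by blast
  qed
  then have "\<exists>g. \<forall>e\<in>Basis. g e \<in> L2 M \<and> (\<lambda>n. l2norm M (\<lambda>x. D e (z n) x - g e x)) \<longlonglongrightarrow> 0"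
    by (intro bchoice) blast
  then obtain g where g: "\<And>e. e \<in> Basis \<Longrightarrow> g e \<in> L2 M"
    "\<And>e. e \<in> Basis \<Longrightarrow> (\<lambda>n. l2norm M (\<lambda>x. D e (z n) x - g e x)) \<longlonglongrightarrow> 0" by blast
  have w: "weak_pd R e z' (g e)" if e: "e \<in> Basis" for e
    by (rule weak_pd_limit[OF H1_L2[OF H] z(2) H1_wd(1)[OF H e] g(1)[OF e] H1_wd(2)[OF H e] e z(3) g(2)[OF e]])
  have zH: "z' \<in> H1" unfolding H1_iff using z(2) g(1) w by blast
  have lim: "(\<lambda>n. l2norm M (\<lambda>x. D e (z n) x - D e z' x)) \<longlonglongrightarrow> 0" if e: "e \<in> Basis" for e
  proof -
    have "l2norm M (\<lambda>x. D e (z n) x - D e z' x) = l2norm M (\<lambda>x. D e (z n) x - g e x)" for n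
      by (rule l2norm_cong_AE, use wd_eq(1)[OF w[OF e] g(1)[OF e]] in eventually_elim, simp)
        (intro L2_measurable L2_diff H1_wd(1) H e zH g(1))+
    then show ?thesis using g(2)[OF e] by simp
  qed
  have lim': "(\<lambda>n. \<Sum>e\<in>Basis. l2norm M (\<lambda>x. D e (z n) x - D e z' x)) \<longlonglongrightarrow> (\<Sum>e\<in>(Basis::plane set). 0)"
    by (intro tendsto_sum lim)
  show "(\<lambda>n. Vn (\<lambda>x. z n x - z' x)) \<longlonglongrightarrow> 0"
  proof (rule Lim_null_comparison)
    show "(\<lambda>n. \<Sum>e\<in>Basis. l2norm M (\<lambda>x. D e (z n) x - D e z' x)) \<longlonglongrightarrow> 0" using lim' by simp
    have "norm (Vn (\<lambda>x. z n x - z' x)) \<le> (\<Sum>e\<in>Basis. l2norm M (\<lambda>x. D e (z n) x - D e z' x))" for n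
      using Vn_le_sum[OF H1_diff(1)[OF H zH], of n] Vn_nonneg[OF H1_diff(1)[OF H zH], of n]
      by (simp add: l2norm_wd_diff[OF H zH] cong: sum.cong)
    then show "\<forall>\<^sub>F n in sequentially. norm (Vn (\<lambda>x. z n x - z' x)) \<le> (\<Sum>e\<in>Basis. l2norm M (\<lambda>x. D e (z n) x - D e z' x))"
      by simp
  qed
  have "\<exists>\<phi>. \<phi> \<in> D1 \<and> l2norm M (\<lambda>x. \<phi> x - z n x) < inverse (real (Suc n)) \<and>
      (\<forall>e\<in>Basis. l2norm M (\<lambda>x. D e \<phi> x - D e (z n) x) < inverse (real (Suc n)))" for n
  proof -
    obtain \<phi> where \<phi>: "\<And>k::nat. \<phi> k \<in> D1" "(\<lambda>k. l2norm M (\<lambda>x. \<phi> k x - z n x)) \<longlonglongrightarrow> 0"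
      "\<And>e. e \<in> Basis \<Longrightarrow> (\<lambda>k. l2norm M (\<lambda>x. D e (\<phi> k) x - D e (z n) x)) \<longlonglongrightarrow> 0" using V_approx[OF z(1)] by blast
    have "\<forall>\<^sub>F k in sequentially. l2norm M (\<lambda>x. \<phi> k x - z n x) < inverse (real (Suc n)) \<and>
      (\<forall>e\<in>Basis. l2norm M (\<lambda>x. D e (\<phi> k) x - D e (z n) x) < inverse (real (Suc n)))"
      by (intro eventually_conj eventually_ball_finite ballI order_tendstoD(2)[OF \<phi>(2)] order_tendstoD(2)[OF \<phi>(3)]) auto
    then show ?thesis using \<phi>(1) by (auto simp: eventually_sequentially)
  qed
  then have "\<exists>\<phi>. \<forall>n. \<phi> n \<in> D1 \<and> l2norm M (\<lambda>x. \<phi> n x - z n x) < inverse (real (Suc n)) \<and>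
      (\<forall>e\<in>Basis. l2norm M (\<lambda>x. D e (\<phi> n) x - D e (z n) x) < inverse (real (Suc n)))"
    by (intro choice allI)
  then obtain \<phi> where \<phi>: "\<And>n. \<phi> n \<in> D1" "\<And>n. l2norm M (\<lambda>x. \<phi> n x - z n x) < inverse (real (Suc n))"
    "\<And>n e. e \<in> Basis \<Longrightarrow> l2norm M (\<lambda>x. D e (\<phi> n) x - D e (z n) x) < inverse (real (Suc n))" by blast
  note P = D1_H1[OF \<phi>(1)]
  have inv: "(\<lambda>n. inverse (real (Suc n))) \<longlonglongrightarrow> 0" by (rule LIMSEQ_inverse_real_of_nat)
  show "z' \<in> V"
  proof (rule V_intro[OF zH \<phi>(1)])
    have "norm (l2norm M (\<lambda>x. \<phi> n x - z' x)) \<le> inverse (real (Suc n)) + l2norm M (\<lambda>x. z n x - z' x)" for n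
      using l2norm_triangle3[OF H1_L2[OF P] H1_L2[OF H] z(2), of n n] \<phi>(2)[of n] by simp
    moreover have "(\<lambda>n. inverse (real (Suc n)) + l2norm M (\<lambda>x. z n x - z' x)) \<longlonglongrightarrow> 0"
      using tendsto_add[OF inv z(3)] by simp
    ultimately show "(\<lambda>n. l2norm M (\<lambda>x. \<phi> n x - z' x)) \<longlonglongrightarrow> 0"
      by (rule Lim_null_comparison[OF always_eventually[OF allI]])
    fix e :: plane assume e: "e \<in> Basis"
    have "norm (l2norm M (\<lambda>x. D e (\<phi> n) x - D e z' x)) \<le> inverse (real (Suc n)) + l2norm M (\<lambda>x. D e (z n) x - D e z' x)" for n
      using l2norm_triangle3[OF H1_wd(1)[OF P e] H1_wd(1)[OF H e] H1_wd(1)[OF zH e], of n n] \<phi>(3)[OF e, of n] by simp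
    moreover have "(\<lambda>n. inverse (real (Suc n)) + l2norm M (\<lambda>x. D e (z n) x - D e z' x)) \<longlonglongrightarrow> 0"
      using tendsto_add[OF inv lim[OF e]] by simp
    ultimately show "(\<lambda>n. l2norm M (\<lambda>x. D e (\<phi> n) x - D e z' x)) \<longlonglongrightarrow> 0"
      by (rule Lim_null_comparison[OF always_eventually[OF allI]])
  qed
qed

end

section \<open>The trilinear form\<close>

text \<open>The inequality f(x) <= f(s) + (integral of g) is averaged over s. The mean of f replaces
  a boundary value, since none is prescribed for the functions to which this is applied.\<close>

lemma sup_bound_interval:
  fixes f :: "real \<Rightarrow> real"
  assumes c: "c > 0" and x: "x \<in> {0..c}"
    and der: "\<And>t. t \<in> {0..c} \<Longrightarrow> (f has_vector_derivative f' t) (at t within {0..c})"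
    and g: "continuous_on {0..c} g" "\<And>t. t \<in> {0..c} \<Longrightarrow> \<bar>f' t\<bar> \<le> g t"
  shows "c * f x \<le> integral {0..c} f + c * integral {0..c} g"
proof -
  have gi: "g integrable_on {s..t}" if "{s..t} \<subseteq> {0..c}" for s t
    by (rule integrable_continuous_real[OF continuous_on_subset[OF g(1) that]])
  have fi: "f integrable_on {0..c}"
    by (intro integrable_continuous_real continuous_on_vector_derivative[OF der])
  have incr: "\<bar>f t - f s\<bar> \<le> integral {0..c} g" if "0 \<le> s" "s \<le> t" "t \<le> c" for s t
  proof -
    have sub: "{s..t} \<subseteq> {0..c}" using that by auto
    have hi: "(f' has_integral f t - f s) {s..t}"
      using that by (intro fundamental_theorem_of_calculus has_vector_derivative_within_subset[OF der sub]) auto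
    have "norm (integral {s..t} f') \<le> integral {s..t} g"
      by (rule integral_norm_bound_integral) (use hi gi[OF sub] g(2) sub in \<open>auto simp: has_integral_integrable\<close>)
    also have "\<dots> \<le> integral {0..c} g"
      by (rule integral_subset_le[OF sub gi[OF sub] gi[OF order_refl]]) (use g(2) in force)
    finally show ?thesis using integral_unique[OF hi] by simp
  qed
  have "f x \<le> f s + integral {0..c} g" if "s \<in> {0..c}" for s
    using incr[of s x] incr[of x s] x that by (cases "s \<le> x") auto
  then have "integral {0..c} (\<lambda>s. f x) \<le> integral {0..c} (\<lambda>s. f s + integral {0..c} g)"
    by (intro integral_le) (auto intro: integrable_add fi)
  also have "\<dots> = integral {0..c} f + c * integral {0..c} g"
    using c by (subst integral_add[OF fi]) (auto simp: mult.commute)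
  finally show ?thesis using c by (simp add: mult.commute)
qed

context rectangle
begin

text \<open>The two bounds give n(x,y)^2 <= G(y) H(x). Each factor depends on one variable only, so
  the double integral factorises; this is the point where dimension two is used.\<close>

lemma integral_square_le_product:
  fixes n h1 h2 :: "plane \<Rightarrow> real"
  assumes c: "continuous_on cR n" "continuous_on cR h1" "continuous_on cR h2"
    and n0: "\<And>p. p \<in> cR \<Longrightarrow> 0 \<le> n p"
    and le1: "\<And>x y. (x, y) \<in> cR \<Longrightarrow> n (x, y) \<le> integral {0..a} (\<lambda>t. h1 (t, y))"
    and le2: "\<And>x y. (x, y) \<in> cR \<Longrightarrow> n (x, y) \<le> integral {0..b} (\<lambda>s. h2 (x, s))"
  shows "integral cR (\<lambda>p. (n p)\<^sup>2) \<le> integral cR h1 * integral cR h2"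
proof -
  define G where "G y = integral {0..a} (\<lambda>t. h1 (t, y))" for y
  define H where "H x = integral {0..b} (\<lambda>s. h2 (x, s))" for x
  have Gc: "continuous_on {0..b} G"
    unfolding G_def interval_cbox
    by (rule integral_continuous_on_param)
      (auto intro!: continuous_on_compose2[OF c(2)] continuous_intros simp: case_prod_beta')
  have Hc: "continuous_on {0..a} H"
    unfolding H_def interval_cbox
    by (rule integral_continuous_on_param)
      (auto intro!: continuous_on_compose2[OF c(3)] continuous_intros simp: case_prod_beta')
  have n2: "continuous_on cR (\<lambda>p. (n p)\<^sup>2)" by (intro continuous_intros c)
  have "integral cR (\<lambda>p. (n p)\<^sup>2) = integral {0..a} (\<lambda>x. integral {0..b} (\<lambda>y. (n (x, y))\<^sup>2))"
    using integral_prod_continuous[OF n2] by simp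
  also have "\<dots> \<le> integral {0..a} (\<lambda>x. integral {0..b} G * H x)"
  proof (rule integral_le)
    have "continuous_on {0..a} (\<lambda>x. integral {0..b} (\<lambda>y. (n (x, y))\<^sup>2))"
      unfolding interval_cbox
      by (rule integral_continuous_on_param)
        (use n2 in \<open>simp add: case_prod_beta' cbox_Pair_eq\<close>)
    then show "(\<lambda>x. integral {0..b} (\<lambda>y. (n (x, y))\<^sup>2)) integrable_on {0..a}"
      by (rule integrable_continuous_real)
    show "(\<lambda>x. integral {0..b} G * H x) integrable_on {0..a}"
      by (intro integrable_continuous_real continuous_intros Hc)
    fix x assume x: "x \<in> {0..a}"
    have "integral {0..b} (\<lambda>y. (n (x, y))\<^sup>2) \<le> integral {0..b} (\<lambda>y. G y * H x)"
    proof (rule integral_le)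
      show "(\<lambda>y. (n (x, y))\<^sup>2) integrable_on {0..b}"
        using x by (intro integrable_continuous_real continuous_on_compose2[OF n2]) (auto intro!: continuous_intros)
      show "(\<lambda>y. G y * H x) integrable_on {0..b}"
        by (intro integrable_continuous_real continuous_intros Gc)
      fix y assume y: "y \<in> {0..b}"
      have p: "(x, y) \<in> cR" using x y by simp
      show "(n (x, y))\<^sup>2 \<le> G y * H x"
        unfolding power2_eq_square using n0[OF p] le1[OF p] le2[OF p]
        by (intro mult_mono) (auto simp: G_def H_def)
    qed
    then show "integral {0..b} (\<lambda>y. (n (x, y))\<^sup>2) \<le> integral {0..b} G * H x" by simp
  qed
  also have "\<dots> = integral {0..b} G * integral {0..a} H" by simp
  also have "integral {0..a} H = integral cR h2"
    using integral_prod_continuous[OF c(3)] by (simp add: H_def [abs_def])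
  also have "integral {0..b} G = integral cR h1"
  proof -
    have "integral cR h1 = integral (cbox 0 a) (\<lambda>x. integral (cbox 0 b) (\<lambda>y. h1 (x, y)))"
      by (rule integral_prod_continuous[OF c(2)])
    also have "\<dots> = integral (cbox 0 b) (\<lambda>y. integral (cbox 0 a) (\<lambda>x. h1 (x, y)))"
      by (rule integral_swap_continuous) (use c(2) in \<open>simp add: case_prod_beta'\<close>)
    finally show ?thesis by (simp add: G_def [abs_def])
  qed
  finally show ?thesis .
qed

text \<open>The terms 1/a and 1/b are the weights of the means in \<open>sup_bound_interval\<close>
  in the two directions, and 2 comes from the derivative of |u|^2. The sum dominates what is needed
  in either direction.\<close>

definition KL :: real where "KL = 1 / a + 1 / b + 2"

lemma KL_pos: "KL > 0"
  using a_pos b_pos by (simp add: KL_def add_pos_pos)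

text \<open>The one-dimensional bound is applied to n = |u|^2 along horizontal and vertical
  segments, with |d_i n| <= 2 |u| |d_i u|; Cauchy-Schwarz bounds the integral of each right-hand
  side. The summand \<open>l2norm M u\<close> next to \<open>Vn u\<close> comes from the means, as u
  need not vanish on the boundary.\<close>

lemma Ladyzhenskaya_smooth:
  fixes u :: field
  assumes u: "smooth_on cR u"
  shows "(LINT p|M. ((norm (u p))\<^sup>2)\<^sup>2) \<le> (KL * l2norm M u * (l2norm M u + Vn u))\<^sup>2"
proof -
  define n where "n p = (norm (u p))\<^sup>2" for p
  define g where "g i p = 2 * (norm (u p) * norm (pd cR i u p))" for i p
  define h where "h i L p = n p / L + g i p" for i L p
  have uH: "u \<in> H1" by (rule smooth_H1(1)[OF u])
  note cu = smooth_continuous[OF u]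
  have nc: "continuous_on cR n" unfolding n_def by (intro continuous_intros cu)
  have gc: "continuous_on cR (g i)" if "i \<in> Basis" for i
    unfolding g_def by (intro continuous_intros cu smooth_pd_continuous[OF u that])
  have hc: "continuous_on cR (h i L)" if "i \<in> Basis" "L > 0" for i L
    unfolding h_def using that by (intro continuous_intros nc gc) auto
  have nder: "(n has_derivative (\<lambda>e. 2 * (u p \<bullet> pd cR e u p))) (at p within cR)" if "p \<in> cR" for p
    unfolding n_def power2_norm_eq_inner
    using has_derivative_inner[OF smooth_has_derivative[OF u that] smooth_has_derivative[OF u that]]
    by (simp add: inner_commute)
  have gle: "\<bar>2 * (u p \<bullet> pd cR i u p)\<bar> \<le> g i p" for i p
    unfolding g_def using Cauchy_Schwarz_ineq2[of "u p" "pd cR i u p"] by simp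
  have le1: "n (x, y) \<le> integral {0..a} (\<lambda>t. h (1, 0) a (t, y))" if p: "(x, y) \<in> cR" for x y
  proof -
    have cy: "continuous_on {0..a} (\<lambda>t. n (t, y))" "continuous_on {0..a} (\<lambda>t. g (1, 0) (t, y))"
      using p by (auto intro!: continuous_on_compose2[OF nc] continuous_on_compose2[OF gc] continuous_intros)
    have "a * n (x, y) \<le> integral {0..a} (\<lambda>t. n (t, y)) + a * integral {0..a} (\<lambda>t. g (1, 0) (t, y))"
      by (rule sup_bound_interval[OF a_pos _ vector_derivative_slice_x[OF nder] cy(2) gle])
        (use p in auto)
    then have "n (x, y) \<le> integral {0..a} (\<lambda>t. n (t, y)) / a + integral {0..a} (\<lambda>t. g (1, 0) (t, y))"
      using a_pos by (simp add: field_simps)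
    also have "\<dots> = integral {0..a} (\<lambda>t. h (1, 0) a (t, y))"
      unfolding h_def using cy a_pos
      by (subst integral_add) (auto intro!: integrable_continuous_real continuous_intros)
    finally show ?thesis .
  qed
  have le2: "n (x, y) \<le> integral {0..b} (\<lambda>s. h (0, 1) b (x, s))" if p: "(x, y) \<in> cR" for x y
  proof -
    have cx: "continuous_on {0..b} (\<lambda>t. n (x, t))" "continuous_on {0..b} (\<lambda>t. g (0, 1) (x, t))"
      using p by (auto intro!: continuous_on_compose2[OF nc] continuous_on_compose2[OF gc] continuous_intros)
    have "b * n (x, y) \<le> integral {0..b} (\<lambda>t. n (x, t)) + b * integral {0..b} (\<lambda>t. g (0, 1) (x, t))"
      by (rule sup_bound_interval[OF b_pos _ vector_derivative_slice_y[OF nder] cx(2) gle])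
        (use p in auto)
    then have "n (x, y) \<le> integral {0..b} (\<lambda>t. n (x, t)) / b + integral {0..b} (\<lambda>t. g (0, 1) (x, t))"
      using b_pos by (simp add: field_simps)
    also have "\<dots> = integral {0..b} (\<lambda>t. h (0, 1) b (x, t))"
      unfolding h_def using cx b_pos
      by (subst integral_add) (auto intro!: integrable_continuous_real continuous_intros)
    finally show ?thesis .
  qed
  define P where "P = KL * l2norm M u * (l2norm M u + Vn u)"
  have hle: "integral cR (h i L) \<le> P \<and> 0 \<le> integral cR (h i L)" if i: "i \<in> Basis" and L: "L > 0" "1 / L + 2 \<le> KL" for i L
  proof -
    have uL: "u \<in> L2 M" "pd cR i u \<in> L2 M" by (intro continuous_L2 cu smooth_pd_continuous[OF u i])+
    have "integral cR (h i L) = (LINT p|M. h i L p)"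
      by (rule rect_integral_continuous[OF hc[OF i L(1)], symmetric])
    also have "\<dots> = (LINT p|M. (norm (u p))\<^sup>2) / L + 2 * (LINT p|M. norm (u p) * norm (pd cR i u p))"
      unfolding h_def g_def n_def using L2_integrable[OF uL(1)] L2_mult_integrable[OF uL] by simp
    also have "\<dots> \<le> (l2norm M u)\<^sup>2 / L + 2 * (l2norm M u * l2norm M (pd cR i u))"
      using L2_Cauchy_Schwarz_norm[OF uL] by (simp add: l2norm_power2)
    also have "l2norm M (pd cR i u) = l2norm M (D i u)"
      by (rule l2norm_cong_AE, use smooth_H1(2)[OF u i] in eventually_elim, simp)
        (intro L2_measurable uL H1_wd(1) uH i)+
    also have "(l2norm M u)\<^sup>2 / L + 2 * (l2norm M u * l2norm M (D i u)) \<le> (1 / L + 2) * l2norm M u * (l2norm M u + Vn u)"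
    proof -
      have "l2norm M u * l2norm M (D i u) \<le> l2norm M u * Vn u"
        by (intro mult_left_mono l2norm_wd_le_Vn uH i) simp
      moreover have "0 \<le> l2norm M u * Vn u / L" using L Vn_nonneg[OF uH] by simp
      moreover have "0 \<le> l2norm M u * l2norm M u" by simp
      moreover have "(1 / L + 2) * l2norm M u * (l2norm M u + Vn u) = (l2norm M u)\<^sup>2 / L + l2norm M u * Vn u / L
          + 2 * (l2norm M u * l2norm M u) + 2 * (l2norm M u * Vn u)"
        by (simp add: algebra_simps power2_eq_square)
      ultimately show ?thesis by linarith
    qed
    also have "\<dots> \<le> P"
      unfolding P_def using L(2) Vn_nonneg[OF uH] by (intro mult_right_mono) auto
    finally have 1: "integral cR (h i L) \<le> P" .
    have "0 \<le> integral cR (h i L)"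
      by (rule integral_nonneg[OF integrable_continuous[OF hc[OF i L(1)]]]) (use L in \<open>auto simp: h_def n_def g_def\<close>)
    with 1 show ?thesis ..
  qed
  have "(LINT p|M. ((norm (u p))\<^sup>2)\<^sup>2) = integral cR (\<lambda>p. (n p)\<^sup>2)"
    unfolding n_def by (intro rect_integral_continuous continuous_intros cu)
  also have "\<dots> \<le> integral cR (h (1, 0) a) * integral cR (h (0, 1) b)"
    by (rule integral_square_le_product[OF nc hc hc _ le1 le2]) (use a_pos b_pos in \<open>auto simp: n_def\<close>)
  also have "\<dots> \<le> P * P"
    using hle[of "(1, 0)" a] hle[of "(0, 1)" b] a_pos b_pos by (intro mult_mono) (auto simp: KL_def)
  finally show ?thesis unfolding P_def power2_eq_square .
qed

lemma zero_H1: "(\<lambda>x. 0::plane) \<in> H1"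
  unfolding H1_iff by (auto intro!: bexI[of _ "\<lambda>x. 0"] simp: weak_pd_def)

lemma Vn_bounded_diff:
  assumes "u \<in> H1" "v \<in> H1"
  shows "\<bar>Vn u - Vn v\<bar> \<le> Vn (\<lambda>x. u x - v x)"
  using Vn_triangle[OF assms zero_H1] Vn_triangle[OF assms(2,1) zero_H1] Vn_diff_commute[OF assms]
  by simp

lemma V_approx_norm:
  assumes "u \<in> V"
  shows "\<exists>\<phi>::nat \<Rightarrow> field. (\<forall>n. \<phi> n \<in> D1) \<and> (\<lambda>n. l2norm M (\<lambda>x. \<phi> n x - u x)) \<longlonglongrightarrow> 0 \<and>
    (\<lambda>n. Vn (\<lambda>x. \<phi> n x - u x)) \<longlonglongrightarrow> 0"
proof -
  obtain \<phi> where \<phi>: "\<And>n::nat. \<phi> n \<in> D1" "(\<lambda>n. l2norm M (\<lambda>x. \<phi> n x - u x)) \<longlonglongrightarrow> 0"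
    "\<And>e. e \<in> Basis \<Longrightarrow> (\<lambda>n. l2norm M (\<lambda>x. D e (\<phi> n) x - D e u x)) \<longlonglongrightarrow> 0" using V_approx[OF assms] by blast
  note P = D1_H1[OF \<phi>(1)] and H = V_H1[OF assms]
  have "(\<lambda>n. \<Sum>e\<in>Basis. l2norm M (\<lambda>x. D e (\<phi> n) x - D e u x)) \<longlonglongrightarrow> (\<Sum>e\<in>(Basis::plane set). 0)"
    by (intro tendsto_sum \<phi>)
  then have 0: "(\<lambda>n. \<Sum>e\<in>Basis. l2norm M (\<lambda>x. D e (\<phi> n) x - D e u x)) \<longlonglongrightarrow> 0" by simp
  have "norm (Vn (\<lambda>x. \<phi> n x - u x)) \<le> (\<Sum>e\<in>Basis. l2norm M (\<lambda>x. D e (\<phi> n) x - D e u x))" for n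
    using Vn_le_sum[OF H1_diff(1)[OF P H], of n] Vn_nonneg[OF H1_diff(1)[OF P H], of n]
    by (simp add: l2norm_wd_diff[OF P H] cong: sum.cong)
  then have "(\<lambda>n. Vn (\<lambda>x. \<phi> n x - u x)) \<longlonglongrightarrow> 0"
    by (intro Lim_null_comparison[OF always_eventually 0] allI)
  with \<phi> show ?thesis by blast
qed

text \<open>This is the square of the L4 norm.\<close>

definition l4sq :: "field \<Rightarrow> real" where "l4sq u = l2norm M (\<lambda>x. (norm (u x))\<^sup>2)"

lemma l4sq_nonneg [simp]: "l4sq u \<ge> 0"
  by (simp add: l4sq_def)

text \<open>Smooth approximations converge almost everywhere along a subsequence, and both norms on
  the right converge, so Fatou carries the inequality over. Membership of u in L4 comes out at the
  same time.\<close>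

lemma Ladyzhenskaya:
  assumes u: "u \<in> V"
  shows "(\<lambda>x. (norm (u x))\<^sup>2) \<in> L2 M" "l4sq u \<le> KL * l2norm M u * (l2norm M u + Vn u)"
proof -
  obtain \<psi> where \<psi>: "\<And>n::nat. \<psi> n \<in> D1" "(\<lambda>n. l2norm M (\<lambda>x. \<psi> n x - u x)) \<longlonglongrightarrow> 0"
    "(\<lambda>n. Vn (\<lambda>x. \<psi> n x - u x)) \<longlonglongrightarrow> 0" using V_approx_norm[OF u] by blast
  obtain r :: "nat \<Rightarrow> nat" where r: "strict_mono r" "AE x in M. (\<lambda>n. \<psi> (r n) x) \<longlonglongrightarrow> u x"
    using L2_AE_subseq[OF H1_L2[OF D1_H1[OF \<psi>(1)]] V_L2[OF u] \<psi>(2)] by blast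
  define \<phi> where "\<phi> n = \<psi> (r n)" for n
  have \<phi>: "\<phi> n \<in> D1" "(\<lambda>n. l2norm M (\<lambda>x. \<phi> n x - u x)) \<longlonglongrightarrow> 0"
    "(\<lambda>n. Vn (\<lambda>x. \<phi> n x - u x)) \<longlonglongrightarrow> 0" "AE x in M. (\<lambda>n. \<phi> n x) \<longlonglongrightarrow> u x" for n
    using \<psi> r LIMSEQ_subseq_LIMSEQ[OF \<psi>(2) r(1)] LIMSEQ_subseq_LIMSEQ[OF \<psi>(3) r(1)]
    by (auto simp: \<phi>_def o_def)
  note P = D1_H1[OF \<phi>(1)] and H = V_H1[OF u]
  have p: "(\<lambda>n. l2norm M (\<phi> n)) \<longlonglongrightarrow> l2norm M u"
    by (rule L2_tendsto_norm[OF H1_L2[OF P] V_L2[OF u] \<phi>(2)])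
  have q: "(\<lambda>n. Vn (\<phi> n)) \<longlonglongrightarrow> Vn u"
  proof -
    have "(\<lambda>n. Vn (\<phi> n) - Vn u) \<longlonglongrightarrow> 0"
      by (rule Lim_null_comparison[OF _ \<phi>(3)]) (simp add: Vn_bounded_diff[OF P H])
    then show ?thesis by (simp add: LIM_zero_iff)
  qed
  define B where "B = KL * l2norm M u * (l2norm M u + Vn u)"
  have lim: "(\<lambda>n. (KL * l2norm M (\<phi> n) * (l2norm M (\<phi> n) + Vn (\<phi> n)))\<^sup>2) \<longlonglongrightarrow> B\<^sup>2"
    unfolding B_def by (intro tendsto_intros p q)
  \<comment> \<open>The slack \<open>\<epsilon>\<close> turns convergence of the right-hand sides
    into the eventual bound that \<open>L2_Fatou\<close> asks for.\<close>
  have main: "integrable M (\<lambda>x. ((norm (u x))\<^sup>2)\<^sup>2) \<and> (LINT x|M. ((norm (u x))\<^sup>2)\<^sup>2) \<le> B\<^sup>2 + \<epsilon>" if "\<epsilon> > 0" for \<epsilon>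
  proof (rule L2_Fatou[where f="\<lambda>n x. ((norm (\<phi> n x))\<^sup>2)\<^sup>2"])
    show "integrable M (\<lambda>x. ((norm (\<phi> n x))\<^sup>2)\<^sup>2)" for n
      by (intro rect_integrable_continuous continuous_intros smooth_continuous D1_smooth \<phi>(1))
    show "AE x in M. (\<lambda>n. ((norm (\<phi> n x))\<^sup>2)\<^sup>2) \<longlonglongrightarrow> ((norm (u x))\<^sup>2)\<^sup>2"
      using \<phi>(4) by eventually_elim (intro tendsto_intros)
    have "\<forall>\<^sub>F n in sequentially. (KL * l2norm M (\<phi> n) * (l2norm M (\<phi> n) + Vn (\<phi> n)))\<^sup>2 < B\<^sup>2 + \<epsilon>"
      by (rule order_tendstoD(2)[OF lim]) (use that in simp)
    then show "\<forall>\<^sub>F n in sequentially. (LINT x|M. ((norm (\<phi> n x))\<^sup>2)\<^sup>2) \<le> B\<^sup>2 + \<epsilon>"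
      by eventually_elim (rule order_trans[OF Ladyzhenskaya_smooth[OF D1_smooth[OF \<phi>(1)]] less_imp_le])
    show "(\<lambda>x. ((norm (u x))\<^sup>2)\<^sup>2) \<in> borel_measurable M"
      using L2_measurable[OF V_L2[OF u]] by measurable
  qed auto
  show "(\<lambda>x. (norm (u x))\<^sup>2) \<in> L2 M"
  proof (rule L2_bound)
    show "(\<lambda>x. (norm (u x))\<^sup>2) \<in> borel_measurable M" using L2_measurable[OF V_L2[OF u]] by measurable
    show "integrable M (\<lambda>x. ((norm (u x))\<^sup>2)\<^sup>2)" using main[of 1] by simp
  qed simp
  have "(LINT x|M. ((norm (u x))\<^sup>2)\<^sup>2) \<le> B\<^sup>2"
    by (rule field_le_epsilon) (use main in blast)
  moreover have "B \<ge> 0" unfolding B_def using KL_pos Vn_nonneg[OF H] by simp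
  ultimately show "l4sq u \<le> KL * l2norm M u * (l2norm M u + Vn u)"
    unfolding l4sq_def l2norm_def[of M "\<lambda>x. (norm (u x))\<^sup>2"] B_def[symmetric] by (simp add: real_le_lsqrt)
qed

text \<open>Hoelder's inequality with exponents 4, 2, 4, obtained from Cauchy-Schwarz applied twice.
  The field \<open>g\<close> stands for a weak derivative or for a single component of one.\<close>

lemma tri_bound:
  fixes g :: field
  assumes u: "u \<in> V" and w: "w \<in> V" and g: "g \<in> L2 M" and i: "i \<in> Basis"
  shows "integrable M (\<lambda>x. (u x \<bullet> i) * (g x \<bullet> w x))"
    "\<bar>LINT x|M. (u x \<bullet> i) * (g x \<bullet> w x)\<bar> \<le> sqrt (l4sq u * l4sq w) * l2norm M g"
proof -
  note [measurable] = L2_measurable[OF V_L2[OF u]] L2_measurable[OF V_L2[OF w]] L2_measurable[OF g]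
  let ?k = "\<lambda>x. norm (u x) * norm (w x)"
  note S = Ladyzhenskaya(1)[OF u] Ladyzhenskaya(1)[OF w]
  have sq: "(norm (?k x))\<^sup>2 = norm ((norm (u x))\<^sup>2) * norm ((norm (w x))\<^sup>2)" for x
    by (simp add: power_mult_distrib)
  have kL: "?k \<in> L2 M"
    by (rule L2_bound[OF _ L2_mult_integrable[OF S]]) (simp_all add: power_mult_distrib)
  have kn: "l2norm M ?k \<le> sqrt (l4sq u * l4sq w)"
    unfolding l2norm_def[of M ?k] sq l4sq_def by (rule real_sqrt_le_mono[OF L2_Cauchy_Schwarz_norm[OF S]])
  have le: "\<bar>(u x \<bullet> i) * (g x \<bullet> w x)\<bar> \<le> norm (?k x) * norm (g x)" for x
  proof -
    have "\<bar>(u x \<bullet> i) * (g x \<bullet> w x)\<bar> \<le> norm (u x) * (norm (g x) * norm (w x))"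
      unfolding abs_mult using Basis_le_norm[OF i, of "u x"] Cauchy_Schwarz_ineq2[of "g x" "w x"]
      by (intro mult_mono) auto
    then show ?thesis by (simp add: mult_ac)
  qed
  note I = L2_mult_integrable[OF kL g]
  show int: "integrable M (\<lambda>x. (u x \<bullet> i) * (g x \<bullet> w x))"
    by (rule Bochner_Integration.integrable_bound[OF I]) (use le in auto)
  have "\<bar>LINT x|M. (u x \<bullet> i) * (g x \<bullet> w x)\<bar> \<le> (LINT x|M. \<bar>(u x \<bullet> i) * (g x \<bullet> w x)\<bar>)"
    by (rule integral_abs_bound)
  also have "\<dots> \<le> (LINT x|M. norm (?k x) * norm (g x))"
    by (intro integral_mono integrable_abs int I le)
  also have "\<dots> \<le> l2norm M ?k * l2norm M g" by (rule L2_Cauchy_Schwarz_norm[OF kL g])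
  also have "\<dots> \<le> sqrt (l4sq u * l4sq w) * l2norm M g" by (intro mult_right_mono kn) simp
  finally show "\<bar>LINT x|M. (u x \<bullet> i) * (g x \<bullet> w x)\<bar> \<le> sqrt (l4sq u * l4sq w) * l2norm M g" .
qed

lemma b_form_eq:
  assumes "u \<in> V" "v \<in> V" "w \<in> V"
  shows "b_form a b u v w = (\<Sum>i\<in>Basis. LINT x|M. (u x \<bullet> i) * (D i v x \<bullet> w x))"
  unfolding b_form_def
proof (intro sum.cong refl)
  fix i :: plane assume i: "i \<in> Basis"
  have I: "integrable M (\<lambda>x. (u x \<bullet> i) * (D i v x \<bullet> j) * (w x \<bullet> j))" if "j \<in> Basis" for j
  proof -
    \<comment> \<open>Keeping only the component along j makes each coordinate term an instance of
      \<open>tri_bound\<close>, which justifies exchanging sum and integral.\<close>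
    have "(\<lambda>x. (D i v x \<bullet> j) *\<^sub>R j) \<in> L2 M"
    proof (rule L2_bound)
      show "(\<lambda>x. (D i v x \<bullet> j) *\<^sub>R j) \<in> borel_measurable M"
        using L2_measurable[OF V_wd_L2[OF assms(2) i]] by measurable
      show "integrable M (\<lambda>x. (norm (D i v x \<bullet> j))\<^sup>2)"
        by (rule L2_integrable[OF L2_inner_const[OF V_wd_L2[OF assms(2) i]]])
    qed (use that in simp)
    from tri_bound(1)[OF assms(1,3) this i] show ?thesis
      by (simp add: inner_commute mult.assoc)
  qed
  have "(\<Sum>j\<in>Basis. LINT x|M. (u x \<bullet> i) * (D i v x \<bullet> j) * (w x \<bullet> j)) =
      (LINT x|M. (\<Sum>j\<in>Basis. (u x \<bullet> i) * (D i v x \<bullet> j) * (w x \<bullet> j)))"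
    by (rule Bochner_Integration.integral_sum[symmetric, OF I])
  also have "\<dots> = (LINT x|M. (u x \<bullet> i) * (D i v x \<bullet> w x))"
    by (intro Bochner_Integration.integral_cong refl)
      (simp add: euclidean_inner[of "D i v _" "w _"] sum_distrib_left mult.assoc)
  finally show "(\<Sum>j\<in>Basis. LINT x|M. (u x \<bullet> i) * (D i v x \<bullet> j) * (w x \<bullet> j)) =
    (LINT x|M. (u x \<bullet> i) * (D i v x \<bullet> w x))" .
qed

lemma b_form_bound:
  assumes "u \<in> V" "v \<in> V" "w \<in> V"
  shows "\<bar>b_form a b u v w\<bar> \<le> 2 * sqrt (l4sq u * l4sq w) * Vn v"
proof -
  have "\<bar>LINT x|M. (u x \<bullet> i) * (D i v x \<bullet> w x)\<bar> \<le> sqrt (l4sq u * l4sq w) * Vn v" if i: "i \<in> Basis" for i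
    by (rule order_trans[OF tri_bound(2)[OF assms(1,3) V_wd_L2[OF assms(2) i] i]])
      (intro mult_left_mono l2norm_wd_le_Vn V_H1 assms i, simp)
  from this[of "(1, 0)"] this[of "(0, 1)"] show ?thesis
    unfolding b_form_eq[OF assms] sum_Basis_plane by simp
qed

lemma b_form_diff:
  assumes "u \<in> V" "u' \<in> V" "v \<in> V" "w \<in> V"
  shows "b_form a b (\<lambda>x. u x - u' x) v w = b_form a b u v w - b_form a b u' v w" (is ?th1)
    "b_form a b v (\<lambda>x. u x - u' x) w = b_form a b v u w - b_form a b v u' w" (is ?th2)
    "b_form a b v w (\<lambda>x. u x - u' x) = b_form a b v w u - b_form a b v w u'" (is ?th3)
proof -
  note d = V_diff[OF assms(1,2)]
  note L = V_wd_L2[OF assms(1)] V_wd_L2[OF assms(2)] V_wd_L2[OF assms(3)] V_wd_L2[OF assms(4)] V_wd_L2[OF d]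
  show ?th1
    unfolding b_form_eq[OF d assms(3,4)] b_form_eq[OF assms(1,3,4)] b_form_eq[OF assms(2,3,4)]
    by (simp add: inner_diff_left left_diff_distrib tri_bound(1)[OF assms(1,4) L(3)]
        tri_bound(1)[OF assms(2,4) L(3)] sum_Basis_plane)
  show ?th3
    unfolding b_form_eq[OF assms(3,4) d] b_form_eq[OF assms(3,4,1)] b_form_eq[OF assms(3,4,2)]
    by (simp add: inner_diff_right right_diff_distrib tri_bound(1)[OF assms(3,1) L(4)]
        tri_bound(1)[OF assms(3,2) L(4)] sum_Basis_plane)
  have "(LINT x|M. (v x \<bullet> i) * (D i (\<lambda>x. u x - u' x) x \<bullet> w x)) =
      (LINT x|M. (v x \<bullet> i) * (D i u x \<bullet> w x)) - (LINT x|M. (v x \<bullet> i) * (D i u' x \<bullet> w x))" if i: "i \<in> Basis" for i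
  proof -
    note T = tri_bound(1)[OF assms(3,4) L(1)[OF i] i] tri_bound(1)[OF assms(3,4) L(2)[OF i] i]
      tri_bound(1)[OF assms(3,4) L(5)[OF i] i]
    have "(LINT x|M. (v x \<bullet> i) * (D i (\<lambda>x. u x - u' x) x \<bullet> w x)) =
        (LINT x|M. (v x \<bullet> i) * (D i u x \<bullet> w x) - (v x \<bullet> i) * (D i u' x \<bullet> w x))"
      by (rule integral_cong_AE, rule borel_measurable_integrable[OF T(3)],
          rule borel_measurable_integrable[OF Bochner_Integration.integrable_diff[OF T(1,2)]],
          use H1_diff(2)[OF V_H1[OF assms(1)] V_H1[OF assms(2)] i] in eventually_elim,
          simp add: inner_diff_left right_diff_distrib)
    then show ?thesis using T by simp
  qed
  then show ?th2
    unfolding b_form_eq[OF assms(3) d assms(4)] b_form_eq[OF assms(3,1,4)] b_form_eq[OF assms(3,2,4)]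
    by (simp add: sum_subtractf)
qed

lemma b_form_D1_zero:
  assumes \<phi>: "\<phi> \<in> D1" and \<psi>: "\<psi> \<in> D1"
  shows "b_form a b \<phi> \<psi> \<psi> = 0"
proof -
  note s = D1_smooth[OF \<psi>] and t = D1_smooth[OF \<phi>]
  let ?g = "\<lambda>p. 1 / 2 * (\<psi> p \<bullet> \<psi> p)" and ?g' = "\<lambda>p e. pd cR e \<psi> p \<bullet> \<psi> p"
  have der: "(?g has_derivative ?g' p) (at p within cR)" if "p \<in> cR" for p
    using has_derivative_mult_right[OF has_derivative_inner[OF smooth_has_derivative[OF s that] smooth_has_derivative[OF s that]], of "1 / 2"]
    by (simp add: inner_commute)
  have c: "continuous_on cR (\<lambda>p. ?g' p i)" if "i \<in> Basis" for i
    by (intro continuous_intros smooth_continuous[OF s] smooth_pd_continuous[OF s that])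
  have eq: "(LINT x|M. (\<phi> x \<bullet> i) * (D i \<psi> x \<bullet> \<psi> x)) = (LINT x|M. (\<phi> x \<bullet> i) * ?g' x i)" if i: "i \<in> Basis" for i
  proof (rule integral_cong_AE)
    show "(\<lambda>x. (\<phi> x \<bullet> i) * (D i \<psi> x \<bullet> \<psi> x)) \<in> borel_measurable M"
      by (rule borel_measurable_integrable[OF tri_bound(1)[OF D1_V[OF \<phi>] D1_V[OF \<psi>] V_wd_L2[OF D1_V[OF \<psi>] i] i]])
    show "(\<lambda>x. (\<phi> x \<bullet> i) * ?g' x i) \<in> borel_measurable M"
      by (intro borel_measurable_integrable[OF rect_integrable_continuous] continuous_on_mult c[OF i]
          continuous_on_inner continuous_on_const smooth_continuous[OF t])
    show "AE x in M. (\<phi> x \<bullet> i) * (D i \<psi> x \<bullet> \<psi> x) = (\<phi> x \<bullet> i) * ?g' x i"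
      using smooth_H1(2)[OF s i] by eventually_elim simp
  qed
  show ?thesis
    unfolding b_form_eq[OF D1_V[OF \<phi>] D1_V[OF \<psi>] D1_V[OF \<psi>]] sum_Basis_plane eq[OF e_Basis(1)] eq[OF e_Basis(2)]
    using D1_transport_zero[OF \<phi> der c] by simp
qed

text \<open>A norm equivalent to that of H1, for which b is bounded in all three arguments at once.
  It serves the density argument of \<open>b_form_V_zero\<close>.\<close>

definition vsum :: "field \<Rightarrow> real" where "vsum u = l2norm M u + Vn u"

lemma vsum_nonneg: "u \<in> V \<Longrightarrow> vsum u \<ge> 0"
  by (simp add: vsum_def Vn_nonneg V_H1)

lemma b_form_vsum:
  assumes "u \<in> V" "v \<in> V" "w \<in> V"
  shows "\<bar>b_form a b u v w\<bar> \<le> 2 * KL * (vsum u * vsum v * vsum w)"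
proof -
  have l4: "l4sq z \<le> KL * (vsum z)\<^sup>2" if "z \<in> V" for z
  proof -
    have "l4sq z \<le> KL * (l2norm M z * vsum z)" using Ladyzhenskaya(2)[OF that] by (simp add: vsum_def mult.assoc)
    also have "\<dots> \<le> KL * (vsum z * vsum z)"
      using KL_pos vsum_nonneg[OF that] Vn_nonneg[OF V_H1[OF that]]
      by (intro mult_left_mono mult_right_mono) (auto simp: vsum_def)
    finally show ?thesis by (simp add: power2_eq_square)
  qed
  have "sqrt (l4sq u * l4sq w) \<le> sqrt ((KL * (vsum u * vsum w))\<^sup>2)"
  proof (rule real_sqrt_le_mono)
    have "l4sq u * l4sq w \<le> (KL * (vsum u)\<^sup>2) * (KL * (vsum w)\<^sup>2)"
      by (intro mult_mono l4 assms) (auto intro: order_trans[OF l4sq_nonneg l4[OF assms(1)]])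
    then show "l4sq u * l4sq w \<le> (KL * (vsum u * vsum w))\<^sup>2"
      by (simp add: power2_eq_square mult_ac)
  qed
  also have "\<dots> = KL * (vsum u * vsum w)"
    using KL_pos vsum_nonneg[OF assms(1)] vsum_nonneg[OF assms(3)] by simp
  finally have "2 * sqrt (l4sq u * l4sq w) * Vn v \<le> 2 * (KL * (vsum u * vsum w)) * vsum v"
    using vsum_nonneg[OF assms(1)] vsum_nonneg[OF assms(3)] KL_pos Vn_nonneg[OF V_H1[OF assms(2)]]
    by (intro mult_mono) (auto simp: vsum_def)
  then show ?thesis using b_form_bound[OF assms] by (simp add: mult_ac)
qed

text \<open>The cancellation known for fields in \<open>D1\<close> passes to V by density. The three
  summands of \<open>E n\<close> are the costs of replacing v, then the first w, then the second w
  by their approximations.\<close>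

lemma b_form_V_zero:
  assumes v: "v \<in> V" and w: "w \<in> V"
  shows "b_form a b v w w = 0"
proof -
  have ap: "\<exists>\<phi>::nat \<Rightarrow> field. (\<forall>n. \<phi> n \<in> D1) \<and> (\<lambda>n. vsum (\<lambda>x. \<phi> n x - z x)) \<longlonglongrightarrow> 0 \<and> (\<lambda>n. vsum (\<phi> n)) \<longlonglongrightarrow> vsum z"
    if z: "z \<in> V" for z
  proof -
    obtain \<phi> where \<phi>: "\<And>n::nat. \<phi> n \<in> D1" "(\<lambda>n. l2norm M (\<lambda>x. \<phi> n x - z x)) \<longlonglongrightarrow> 0"
      "(\<lambda>n. Vn (\<lambda>x. \<phi> n x - z x)) \<longlonglongrightarrow> 0" using V_approx_norm[OF z] by blast
    have s: "(\<lambda>n. vsum (\<lambda>x. \<phi> n x - z x)) \<longlonglongrightarrow> 0"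
      using tendsto_add[OF \<phi>(2,3)] by (simp add: vsum_def)
    have "(\<lambda>n. vsum (\<phi> n) - vsum z) \<longlonglongrightarrow> 0"
    proof (rule Lim_null_comparison[OF always_eventually s], rule allI)
      fix n
      show "norm (vsum (\<phi> n) - vsum z) \<le> vsum (\<lambda>x. \<phi> n x - z x)"
        using Vn_bounded_diff[OF D1_H1[OF \<phi>(1)] V_H1[OF z], of n]
          l2norm_bounded_diff[OF H1_L2[OF D1_H1[OF \<phi>(1)]] V_L2[OF z], of n]
        unfolding vsum_def by simp
    qed
    then have "(\<lambda>n. vsum (\<phi> n)) \<longlonglongrightarrow> vsum z" by (simp add: LIM_zero_iff)
    with \<phi>(1) s show ?thesis by blast
  qed
  obtain \<phi> where \<phi>: "\<And>n::nat. \<phi> n \<in> D1" "(\<lambda>n. vsum (\<lambda>x. \<phi> n x - v x)) \<longlonglongrightarrow> 0" "(\<lambda>n. vsum (\<phi> n)) \<longlonglongrightarrow> vsum v"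
    using ap[OF v] by blast
  obtain \<psi> where \<psi>: "\<And>n::nat. \<psi> n \<in> D1" "(\<lambda>n. vsum (\<lambda>x. \<psi> n x - w x)) \<longlonglongrightarrow> 0" "(\<lambda>n. vsum (\<psi> n)) \<longlonglongrightarrow> vsum w"
    using ap[OF w] by blast
  define E where "E n = 2 * KL * (vsum (\<lambda>x. \<phi> n x - v x) * vsum w * vsum w) +
    2 * KL * (vsum (\<phi> n) * vsum (\<lambda>x. \<psi> n x - w x) * vsum w) +
    2 * KL * (vsum (\<phi> n) * vsum (\<psi> n) * vsum (\<lambda>x. \<psi> n x - w x))" for n
  have "E \<longlonglongrightarrow> 2 * KL * (0 * vsum w * vsum w) + 2 * KL * (vsum v * 0 * vsum w) + 2 * KL * (vsum v * vsum w * 0)"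
    unfolding E_def by (intro tendsto_intros \<phi> \<psi>)
  then have E0: "E \<longlonglongrightarrow> 0" by simp
  have le: "\<bar>b_form a b v w w\<bar> \<le> E n" for n
  proof -
    note P = D1_V[OF \<phi>(1)[of n]] D1_V[OF \<psi>(1)[of n]]
    have "b_form a b v w w = - b_form a b (\<lambda>x. \<phi> n x - v x) w w - b_form a b (\<phi> n) (\<lambda>x. \<psi> n x - w x) w
        - b_form a b (\<phi> n) (\<psi> n) (\<lambda>x. \<psi> n x - w x) + b_form a b (\<phi> n) (\<psi> n) (\<psi> n)"
      using b_form_diff(1)[OF P(1) v w w] b_form_diff(2)[OF P(2) w P(1) w] b_form_diff(3)[OF P(2) w P(1) P(2)] by simp
    then show ?thesis
      unfolding E_def
      using b_form_vsum[OF V_diff[OF P(1) v] w w] b_form_vsum[OF P(1) V_diff[OF P(2) w] w]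
        b_form_vsum[OF P(1) P(2) V_diff[OF P(2) w]] b_form_D1_zero[OF \<phi>(1) \<psi>(1), of n n]
      by linarith
  qed
  have "\<bar>b_form a b v w w\<bar> \<le> 0"
    by (rule LIMSEQ_le_const[OF E0]) (use le in blast)
  then show ?thesis by simp
qed

lemma b_form_difference:
  assumes u: "u \<in> V" and v: "v \<in> V"
  defines "z \<equiv> \<lambda>x. u x - v x"
  shows "\<bar>b_form a b u u z - b_form a b v v z\<bar> \<le> 2 * KL * l2norm M z * (l2norm M z + Vn z) * Vn u"
proof -
  have z: "z \<in> V" unfolding z_def by (rule V_diff[OF u v])
  have "b_form a b u u z - b_form a b v v z = b_form a b z u z + b_form a b v z z"
    using b_form_diff(1)[OF u v u z] b_form_diff(2)[OF u v v z] by (simp add: z_def)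
  also have "\<dots> = b_form a b z u z" by (simp add: b_form_V_zero v z)
  finally have "\<bar>b_form a b u u z - b_form a b v v z\<bar> \<le> 2 * l4sq z * Vn u"
    using b_form_bound[OF z u z] by simp
  also have "\<dots> \<le> 2 * (KL * l2norm M z * (l2norm M z + Vn z)) * Vn u"
    using Ladyzhenskaya(2)[OF z] Vn_nonneg[OF V_H1[OF u]] by (intro mult_right_mono) auto
  finally show ?thesis by (simp add: mult_ac)
qed


section \<open>The curl and the domain of the Stokes operator\<close>

lemma weak_curl_eq: "weak_curl a b u = (\<lambda>x. D (1, 0) u x \<bullet> (0, 1) - D (0, 1) u x \<bullet> (1, 0))"
  by (auto simp: weak_curl_def fun_eq_iff)

lemma weak_curl_L2: "u \<in> H1 \<Longrightarrow> weak_curl a b u \<in> L2 M"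
  unfolding weak_curl_eq by (intro L2_diff L2_inner_const H1_wd(1)) auto

lemma l2norm_inner_le:
  assumes "f \<in> L2 M" "norm j \<le> 1"
  shows "l2norm M (\<lambda>x. f x \<bullet> j) \<le> l2norm M f"
proof (rule l2norm_mono[OF L2_inner_const[OF assms(1)] assms(1)])
  show "norm (f x \<bullet> j) \<le> norm (f x)" for x
    using Cauchy_Schwarz_ineq2[of "f x" j] mult_left_mono[OF assms(2), of "norm (f x)"] by simp
qed

lemma norm_e_le: "norm ((1, 0) :: plane) \<le> 1" "norm ((0, 1) :: plane) \<le> 1"
  by (simp_all add: norm_prod_def)

lemma weak_curl_tendsto:
  assumes \<phi>: "\<And>n::nat. \<phi> n \<in> H1" and u: "u \<in> H1"
    and lim: "\<And>e. e \<in> Basis \<Longrightarrow> (\<lambda>n. l2norm M (\<lambda>x. D e (\<phi> n) x - D e u x)) \<longlonglongrightarrow> 0"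
  shows "(\<lambda>n. l2norm M (\<lambda>x. weak_curl a b (\<phi> n) x - weak_curl a b u x)) \<longlonglongrightarrow> 0"
proof -
  note L = H1_wd(1)[OF \<phi>] H1_wd(1)[OF u]
  have *: "(\<lambda>n. l2norm M (\<lambda>x. D e (\<phi> n) x \<bullet> j - D e u x \<bullet> j)) \<longlonglongrightarrow> 0" if "e \<in> Basis" "norm j \<le> 1" for e j
  proof (rule Lim_null_comparison[OF always_eventually lim[OF that(1)]], rule allI)
    show "norm (l2norm M (\<lambda>x. D e (\<phi> n) x \<bullet> j - D e u x \<bullet> j)) \<le> l2norm M (\<lambda>x. D e (\<phi> n) x - D e u x)" for n
      using l2norm_inner_le[OF L2_diff[OF L(1)[OF that(1), of n] L(2)[OF that(1)]] that(2)] by (simp only: inner_diff_left) simp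
  qed
  show ?thesis
    unfolding weak_curl_eq by (rule L2_lim_diff) (intro L2_inner_const L * e_Basis norm_e_le)+
qed

text \<open>Both sides are continuous under L2 convergence of the first derivatives, so the identity
  for \<open>D1\<close> extends to its closure.\<close>

lemma V_inner_eq_curl:
  assumes u: "u \<in> V" and z: "z \<in> V"
  shows "V_inner a b u z = (LINT x|M. weak_curl a b u x * weak_curl a b z x)"
proof -
  obtain \<phi> where \<phi>: "\<And>n::nat. \<phi> n \<in> D1" "(\<lambda>n. l2norm M (\<lambda>x. \<phi> n x - u x)) \<longlonglongrightarrow> 0"
    "\<And>e. e \<in> Basis \<Longrightarrow> (\<lambda>n. l2norm M (\<lambda>x. D e (\<phi> n) x - D e u x)) \<longlonglongrightarrow> 0" using V_approx[OF u] by blast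
  obtain \<psi> where \<psi>: "\<And>n::nat. \<psi> n \<in> D1" "(\<lambda>n. l2norm M (\<lambda>x. \<psi> n x - z x)) \<longlonglongrightarrow> 0"
    "\<And>e. e \<in> Basis \<Longrightarrow> (\<lambda>n. l2norm M (\<lambda>x. D e (\<psi> n) x - D e z x)) \<longlonglongrightarrow> 0" using V_approx[OF z] by blast
  note H = D1_H1[OF \<phi>(1)] D1_H1[OF \<psi>(1)] V_H1[OF u] V_H1[OF z]
  have "(\<lambda>n. \<Sum>i\<in>Basis. LINT x|M. D i (\<phi> n) x \<bullet> D i (\<psi> n) x) \<longlonglongrightarrow> (\<Sum>i\<in>Basis. LINT x|M. D i u x \<bullet> D i z x)"
    by (intro tendsto_sum L2_tendsto_inner \<phi> \<psi> H1_wd(1) H)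
  then have 1: "(\<lambda>n. V_inner a b (\<phi> n) (\<psi> n)) \<longlonglongrightarrow> V_inner a b u z"
    by (simp add: V_inner_eq H)
  have 2: "(\<lambda>n. LINT x|M. weak_curl a b (\<phi> n) x \<bullet> weak_curl a b (\<psi> n) x) \<longlonglongrightarrow>
      (LINT x|M. weak_curl a b u x \<bullet> weak_curl a b z x)"
    by (intro L2_tendsto_inner weak_curl_L2 weak_curl_tendsto H \<phi> \<psi>)
  have "V_inner a b (\<phi> n) (\<psi> n) = (LINT x|M. weak_curl a b (\<phi> n) x \<bullet> weak_curl a b (\<psi> n) x)" for n
  proof -
    note s = D1_smooth[OF \<phi>(1)] D1_smooth[OF \<psi>(1)]
    have wc: "AE x in M. weak_curl a b v x = scurl v x" "weak_curl a b v \<in> L2 M" "scurl v \<in> L2 M"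
      if v: "v \<in> D1" for v
    proof -
      note sv = D1_smooth[OF v]
      show "AE x in M. weak_curl a b v x = scurl v x"
        using smooth_H1(2)[OF sv e_Basis(1)] smooth_H1(2)[OF sv e_Basis(2)]
        by eventually_elim (simp add: weak_curl_eq scurl_def)
      show "weak_curl a b v \<in> L2 M" by (rule weak_curl_L2[OF D1_H1[OF v]])
      show "scurl v \<in> L2 M"
        unfolding scurl_def [abs_def]
        by (intro continuous_L2 continuous_intros smooth_pd_continuous sv) auto
    qed
    have "V_inner a b (\<phi> n) (\<psi> n) = (\<Sum>i\<in>Basis. LINT p|M. pd cR i (\<phi> n) p \<bullet> pd cR i (\<psi> n) p)"
      unfolding V_inner_eq[OF H(1,2)]
    proof (intro sum.cong refl integral_cong_AE)
      fix i :: plane assume i: "i \<in> Basis"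
      show "AE x in M. D i (\<phi> n) x \<bullet> D i (\<psi> n) x = pd cR i (\<phi> n) x \<bullet> pd cR i (\<psi> n) x"
        using smooth_H1(2)[OF s(1) i, of n] smooth_H1(2)[OF s(2) i, of n] by eventually_elim simp
    qed (intro borel_measurable_integrable L2_inner_integrable H1_wd(1) H continuous_L2 smooth_pd_continuous s; assumption)+
    also have "\<dots> = (LINT p|M. scurl (\<phi> n) p * scurl (\<psi> n) p)"
      by (rule D1_dirichlet_eq_curl[OF \<phi>(1) \<psi>(1)])
    also have "\<dots> = (LINT x|M. weak_curl a b (\<phi> n) x \<bullet> weak_curl a b (\<psi> n) x)"
      unfolding inner_real_def[symmetric]
    proof (rule integral_cong_AE)
      show "AE x in M. scurl (\<phi> n) x \<bullet> scurl (\<psi> n) x = weak_curl a b (\<phi> n) x \<bullet> weak_curl a b (\<psi> n) x"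
        using wc(1)[OF \<phi>(1)[of n]] wc(1)[OF \<psi>(1)[of n]] by eventually_elim simp
    qed (intro borel_measurable_integrable L2_inner_integrable wc \<phi>(1) \<psi>(1))+
    finally show ?thesis .
  qed
  with 1 2 have "V_inner a b u z = (LINT x|M. weak_curl a b u x \<bullet> weak_curl a b z x)"
    using LIMSEQ_unique by (simp only:)
  then show ?thesis by simp
qed

section \<open>Edge integrals and functions with zero trace\<close>

lemma bdry_param_measurable [measurable]: "bdry_param a b \<in> borel_measurable borel"
  unfolding bdry_param_def [abs_def] by measurable

lemma bdry_nn_integral:
  fixes h :: "plane \<Rightarrow> ennreal"
  assumes [measurable]: "h \<in> borel_measurable borel"
  shows "(\<integral>\<^sup>+x. h x \<partial>bdry_measure a b) = (\<integral>\<^sup>+s. h (bdry_param a b s) * indicator {0<..<2 * a + 2 * b} s \<partial>lborel)"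
proof -
  have m: "bdry_param a b \<in> lebesgue_on {0<..<2 * a + 2 * b} \<rightarrow>\<^sub>M borel"
    by (intro measurable_restrict_space1 measurable_completion) measurable
  have "(\<integral>\<^sup>+x. h x \<partial>bdry_measure a b) = (\<integral>\<^sup>+s. h (bdry_param a b s) \<partial>lebesgue_on {0<..<2 * a + 2 * b})"
    unfolding bdry_measure_def by (rule nn_integral_distr[OF m]) simp
  also have "\<dots> = (\<integral>\<^sup>+s. h (bdry_param a b s) * indicator {0<..<2 * a + 2 * b} s \<partial>lebesgue)"
    by (subst nn_integral_restrict_space) auto
  finally show ?thesis by (simp add: nn_integral_completion)
qed

text \<open>An edge corresponds to an interval t + c x of the arc length parameter, with c = -1 on
  the edges that are run through backwards. Restricting a nonnegative integral to that interval can
  only decrease it.\<close>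

lemma edge_integral_le:
  fixes \<theta> :: "plane \<Rightarrow> real"
  assumes \<theta>: "continuous_on cR \<theta>" and c: "c = 1 \<or> c = - 1"
    and E: "\<And>x. x \<in> {0<..<l} \<Longrightarrow> t + c * x \<in> {0<..<2 * a + 2 * b} \<and> bdry_param a b (t + c * x) = E x"
    and Ec: "continuous_on {0..l} E" "E ` {0..l} \<subseteq> cR"
  shows "ennreal (integral {0..l} (\<lambda>x. (\<theta> (E x))\<^sup>2)) \<le> (\<integral>\<^sup>+x. ennreal ((norm (\<theta> x))\<^sup>2) \<partial>bdry_measure a b)"
proof -
  \<comment> \<open>Continuity of \<open>\<theta>\<close> is known on \<open>cR\<close> only.
    Setting it to zero elsewhere makes it Borel on the plane, as the boundary measure
    requires.\<close>
  define h where "h x = ennreal ((indicator cR x *\<^sub>R \<theta> x)\<^sup>2)" for x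
  have "(\<lambda>x. indicator cR x *\<^sub>R \<theta> x) \<in> borel_measurable borel"
    by (rule borel_measurable_continuous_on_indicator[OF _ \<theta>]) simp
  then have hm [measurable]: "h \<in> borel_measurable borel" unfolding h_def by measurable
  have "((\<lambda>x. (\<theta> (E x))\<^sup>2) has_integral integral {0..l} (\<lambda>x. (\<theta> (E x))\<^sup>2)) {0<..<l}"
  proof -
    have "continuous_on {0..l} (\<lambda>x. (\<theta> (E x))\<^sup>2)"
      by (intro continuous_intros continuous_on_compose2[OF \<theta> Ec])
    then show ?thesis
      using integrable_continuous_real has_integral_Icc_iff_Ioo by blast
  qed
  then have "ennreal (integral {0..l} (\<lambda>x. (\<theta> (E x))\<^sup>2)) = (\<integral>\<^sup>+x. ennreal ((\<theta> (E x))\<^sup>2) * indicator {0<..<l} x \<partial>lborel)"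
    by (intro nn_integral_has_integral_lebesgue'[symmetric]) auto
  also have "\<dots> \<le> (\<integral>\<^sup>+x. h (bdry_param a b (t + c * x)) * indicator {0<..<2 * a + 2 * b} (t + c * x) \<partial>lborel)"
  proof (rule nn_integral_mono)
    fix x
    show "ennreal ((\<theta> (E x))\<^sup>2) * indicator {0<..<l} x \<le> h (bdry_param a b (t + c * x)) * indicator {0<..<2 * a + 2 * b} (t + c * x)"
    proof (cases "x \<in> {0<..<l}")
      case True
      then have "E x \<in> cR" using Ec(2) by auto
      then show ?thesis using E[OF True] True by (simp add: h_def)
    qed simp
  qed
  also have "\<dots> = (\<integral>\<^sup>+s. h (bdry_param a b s) * indicator {0<..<2 * a + 2 * b} s \<partial>lborel)"
    using c by (subst nn_integral_real_affine[of _ c t]) auto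
  also have "\<dots> = (\<integral>\<^sup>+x. h x \<partial>bdry_measure a b)" by (rule bdry_nn_integral[OF hm, symmetric])
  also have "\<dots> \<le> (\<integral>\<^sup>+x. ennreal ((norm (\<theta> x))\<^sup>2) \<partial>bdry_measure a b)"
    by (rule nn_integral_mono) (auto simp: h_def indicator_def)
  finally show ?thesis .
qed

text \<open>Cauchy-Schwarz on the edge: functions tending to zero in L2 of the boundary lose every
  product with a fixed continuous function in the limit.\<close>

lemma edge_product_tendsto:
  fixes \<theta> :: "nat \<Rightarrow> plane \<Rightarrow> real" and \<psi> :: "plane \<Rightarrow> real"
  assumes \<theta>: "\<And>n. continuous_on cR (\<theta> n)" and \<psi>: "continuous_on cR \<psi>"
    and lim: "(\<lambda>n. \<integral>\<^sup>+x. ennreal ((norm (\<theta> n x))\<^sup>2) \<partial>bdry_measure a b) \<longlonglongrightarrow> 0"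
    and c: "c = 1 \<or> c = - 1"
    and E: "\<And>x. x \<in> {0<..<l} \<Longrightarrow> t + c * x \<in> {0<..<2 * a + 2 * b} \<and> bdry_param a b (t + c * x) = E x"
    and Ec: "continuous_on {0..l} E" "E ` {0..l} \<subseteq> cR"
  shows "(\<lambda>n. integral {0..l} (\<lambda>x. \<theta> n (E x) * \<psi> (E x))) \<longlonglongrightarrow> 0"
proof -
  let ?L = "lebesgue_on {0..l}"
  have cont: "continuous_on {0..l} (\<lambda>x. f (E x))" if "continuous_on cR f" for f :: "plane \<Rightarrow> real"
    by (rule continuous_on_compose2[OF that Ec])
  have int: "integrable ?L f \<and> (LINT x|?L. f x) = integral {0..l} f" if "continuous_on {0..l} f" for f :: "real \<Rightarrow> real"
    using continuous_imp_integrable_real[OF that] lebesgue_integral_eq_integral[of "{0..l}" f] by simp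
  have L2: "f \<in> L2 ?L" if f: "continuous_on {0..l} f" for f :: "real \<Rightarrow> real"
  proof (rule L2_bound)
    show "f \<in> borel_measurable ?L" using int[OF f] by auto
    show "integrable ?L (\<lambda>x. (norm (f x))\<^sup>2)"
      using int[of "\<lambda>x. (norm (f x))\<^sup>2"] f by (auto intro!: continuous_intros)
  qed simp
  have "(\<lambda>n. ennreal (integral {0..l} (\<lambda>x. (\<theta> n (E x))\<^sup>2))) \<longlonglongrightarrow> ennreal 0"
  proof (rule tendsto_sandwich[where f="\<lambda>n. 0"])
    show "\<forall>\<^sub>F n in sequentially. ennreal (integral {0..l} (\<lambda>x. (\<theta> n (E x))\<^sup>2)) \<le>
        (\<integral>\<^sup>+x. ennreal ((norm (\<theta> n x))\<^sup>2) \<partial>bdry_measure a b)"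
      by (intro always_eventually allI edge_integral_le[OF \<theta> c E Ec])
    show "(\<lambda>n. \<integral>\<^sup>+x. ennreal ((norm (\<theta> n x))\<^sup>2) \<partial>bdry_measure a b) \<longlonglongrightarrow> ennreal 0"
      using lim by simp
    show "(\<lambda>n::nat. 0) \<longlonglongrightarrow> ennreal 0" by simp
  qed (intro always_eventually allI zero_le)
  then have I0: "(\<lambda>n. integral {0..l} (\<lambda>x. (\<theta> n (E x))\<^sup>2)) \<longlonglongrightarrow> 0"
    by (rule tendsto_ennrealD)
      (auto intro!: always_eventually integral_nonneg integrable_continuous_real continuous_intros cont[OF \<theta>])
  have "(\<lambda>n. sqrt (integral {0..l} (\<lambda>x. (\<theta> n (E x))\<^sup>2)) * l2norm ?L (\<lambda>x. \<psi> (E x))) \<longlonglongrightarrow> sqrt 0 * l2norm ?L (\<lambda>x. \<psi> (E x))"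
    by (intro tendsto_intros I0)
  then have B0: "(\<lambda>n. sqrt (integral {0..l} (\<lambda>x. (\<theta> n (E x))\<^sup>2)) * l2norm ?L (\<lambda>x. \<psi> (E x))) \<longlonglongrightarrow> 0" by simp
  show ?thesis
  proof (rule Lim_null_comparison[OF always_eventually B0], rule allI)
    fix n
    have "\<bar>LINT x|?L. \<theta> n (E x) \<bullet> \<psi> (E x)\<bar> \<le> l2norm ?L (\<lambda>x. \<theta> n (E x)) * l2norm ?L (\<lambda>x. \<psi> (E x))"
      by (rule L2_Cauchy_Schwarz[OF L2[OF cont[OF \<theta>]] L2[OF cont[OF \<psi>]]])
    moreover have "(LINT x|?L. \<theta> n (E x) \<bullet> \<psi> (E x)) = integral {0..l} (\<lambda>x. \<theta> n (E x) * \<psi> (E x))"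
      using int[OF continuous_on_mult[OF cont[OF \<theta>] cont[OF \<psi>]]] by simp
    moreover have "l2norm ?L (\<lambda>x. \<theta> n (E x)) = sqrt (integral {0..l} (\<lambda>x. (\<theta> n (E x))\<^sup>2))"
      unfolding l2norm_def using int[OF continuous_on_power[OF cont[OF \<theta>]], of n 2] by simp
    ultimately show "norm (integral {0..l} (\<lambda>x. \<theta> n (E x) * \<psi> (E x))) \<le>
        sqrt (integral {0..l} (\<lambda>x. (\<theta> n (E x))\<^sup>2)) * l2norm ?L (\<lambda>x. \<psi> (E x))"
      by simp
  qed
qed

lemma rect_product_boundary:
  fixes f g :: "plane \<Rightarrow> real"
  assumes f: "smooth_on cR f" and g: "smooth_on cR g"
  shows "(LINT p|M. f p * pd cR (1, 0) g p) + (LINT p|M. pd cR (1, 0) f p * g p) =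
      integral {0..b} (\<lambda>y. f (a, y) * g (a, y)) - integral {0..b} (\<lambda>y. f (0, y) * g (0, y))"
    and "(LINT p|M. f p * pd cR (0, 1) g p) + (LINT p|M. pd cR (0, 1) f p * g p) =
      integral {0..a} (\<lambda>x. f (x, b) * g (x, b)) - integral {0..a} (\<lambda>x. f (x, 0) * g (x, 0))"
proof -
  define F' where "F' p h = f p * pd cR h g p + pd cR h f p * g p" for p h
  have der: "((\<lambda>p. f p * g p) has_derivative F' p) (at p within cR)" if "p \<in> cR" for p
    unfolding F'_def
    using has_derivative_mult[OF smooth_has_derivative[OF f that] smooth_has_derivative[OF g that]] by simp
  have c: "continuous_on cR (\<lambda>p. f p * pd cR h g p)" "continuous_on cR (\<lambda>p. pd cR h f p * g p)" if "h \<in> Basis" for h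
    by (intro continuous_intros smooth_continuous f g smooth_pd_continuous that)+
  have c': "continuous_on cR (\<lambda>p. F' p h)" if "h \<in> Basis" for h
    unfolding F'_def by (intro continuous_intros c that)
  have s: "(LINT p|M. F' p h) = (LINT p|M. f p * pd cR h g p) + (LINT p|M. pd cR h f p * g p)" if "h \<in> Basis" for h
    unfolding F'_def by (intro Bochner_Integration.integral_add rect_integrable_continuous c that)
  have fg: "continuous_on cR (\<lambda>p. f p * g p)" by (intro continuous_intros smooth_continuous f g)
  have i: "(\<lambda>y. f (x, y) * g (x, y)) integrable_on {0..b}" if "x \<in> {0..a}" for x
    using that by (intro integrable_continuous_real continuous_on_compose2[OF fg]) (auto intro!: continuous_intros)
  have j: "(\<lambda>x. f (x, y) * g (x, y)) integrable_on {0..a}" if "y \<in> {0..b}" for y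
    using that by (intro integrable_continuous_real continuous_on_compose2[OF fg]) (auto intro!: continuous_intros)
  show "(LINT p|M. f p * pd cR (1, 0) g p) + (LINT p|M. pd cR (1, 0) f p * g p) =
      integral {0..b} (\<lambda>y. f (a, y) * g (a, y)) - integral {0..b} (\<lambda>y. f (0, y) * g (0, y))"
    using rect_integral_partial(1)[OF der c'] s[of "(1, 0)"] i[of a] i[of 0] a_pos
    by (simp add: integral_diff)
  show "(LINT p|M. f p * pd cR (0, 1) g p) + (LINT p|M. pd cR (0, 1) f p * g p) =
      integral {0..a} (\<lambda>x. f (x, b) * g (x, b)) - integral {0..a} (\<lambda>x. f (x, 0) * g (x, 0))"
    using rect_integral_partial(2)[OF der c'] s[of "(0, 1)"] j[of b] j[of 0] b_pos
    by (simp add: integral_diff)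
qed

text \<open>Green's formula holds classically for the smooth approximations of
  \<open>\<omega>\<close>. Their edge terms tend to zero because their boundary values tend to the
  zero trace, and the area terms converge in L2.\<close>

lemma zero_trace_by_parts:
  fixes \<omega> g :: "plane \<Rightarrow> real"
  assumes tr: "has_trace a b \<omega> (\<lambda>x. 0)" and g: "smooth_on cR g" and i: "i \<in> Basis"
  shows "(LINT p|M. \<omega> p * pd cR i g p) = - (LINT p|M. D i \<omega> p * g p)"
proof -
  have \<omega>: "\<omega> \<in> H1" using tr unfolding has_trace_def H1_def by blast
  from tr[unfolded has_trace_def closure_R] obtain \<theta> where \<theta>: "\<And>n. smooth_on cR (\<theta> n)"
    "(\<lambda>n. sobolev_norm 1 R (\<lambda>x. \<theta> n x - \<omega> x)) \<longlonglongrightarrow> 0"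
    "(\<lambda>n. \<integral>\<^sup>+x. ennreal ((norm (\<theta> n x - 0))\<^sup>2) \<partial>bdry_measure a b) \<longlonglongrightarrow> 0"
    by blast
  note tH = smooth_H1(1)[OF \<theta>(1)] and tc = smooth_continuous[OF \<theta>(1)] and gc = smooth_continuous[OF g]
  have lim: "(\<lambda>n. \<integral>\<^sup>+x. ennreal ((norm (\<theta> n x))\<^sup>2) \<partial>bdry_measure a b) \<longlonglongrightarrow> 0" using \<theta>(3) by simp
  have L: "(\<lambda>n. l2norm M (\<lambda>x. \<theta> n x - \<omega> x)) \<longlonglongrightarrow> 0" "(\<lambda>n. l2norm M (\<lambda>x. D i (\<theta> n) x - D i \<omega> x)) \<longlonglongrightarrow> 0"
    using h1norm_tendsto_iff[OF tH \<omega>] \<theta>(2) i by (auto simp: h1norm_def)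
  define bd where "bd n = (LINT p|M. \<theta> n p * pd cR i g p) + (LINT p|M. pd cR i (\<theta> n) p * g p)" for n
  have "bd \<longlonglongrightarrow> 0"
  proof -
    \<comment> \<open>The boundary is run through counterclockwise from the origin. The arc length
      parameter is a + y on the right edge, 2a + 2b - y on the left, 2a + b - x on the top and x on
      the bottom.\<close>
    have 1: "(\<lambda>n. integral {0..b} (\<lambda>y. \<theta> n (a, y) * g (a, y))) \<longlonglongrightarrow> 0"
      by (rule edge_product_tendsto[OF tc gc lim, of 1 b a "\<lambda>y. (a, y)"])
        (use a_pos b_pos in \<open>auto simp: bdry_param_def intro!: continuous_intros\<close>)
    have 2: "(\<lambda>n. integral {0..b} (\<lambda>y. \<theta> n (0, y) * g (0, y))) \<longlonglongrightarrow> 0"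
      by (rule edge_product_tendsto[OF tc gc lim, of "- 1" b "2 * a + 2 * b" "\<lambda>y. (0, y)"])
        (use a_pos b_pos in \<open>auto simp: bdry_param_def intro!: continuous_intros\<close>)
    have 3: "(\<lambda>n. integral {0..a} (\<lambda>x. \<theta> n (x, b) * g (x, b))) \<longlonglongrightarrow> 0"
      by (rule edge_product_tendsto[OF tc gc lim, of "- 1" a "2 * a + b" "\<lambda>x. (x, b)"])
        (use a_pos b_pos in \<open>auto simp: bdry_param_def intro!: continuous_intros\<close>)
    have 4: "(\<lambda>n. integral {0..a} (\<lambda>x. \<theta> n (x, 0) * g (x, 0))) \<longlonglongrightarrow> 0"
      by (rule edge_product_tendsto[OF tc gc lim, of 1 a 0 "\<lambda>x. (x, 0)"])
        (use a_pos b_pos in \<open>auto simp: bdry_param_def intro!: continuous_intros\<close>)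
    show ?thesis
      using tendsto_diff[OF 1 2] tendsto_diff[OF 3 4] i
      unfolding bd_def Basis_plane by (auto simp: rect_product_boundary[OF \<theta>(1) g])
  qed
  moreover have "bd \<longlonglongrightarrow> (LINT p|M. \<omega> p * pd cR i g p) + (LINT p|M. D i \<omega> p * g p)"
  proof -
    have gL: "g \<in> L2 M" "pd cR i g \<in> L2 M" by (intro continuous_L2 gc smooth_pd_continuous g i)+
    have "(LINT p|M. pd cR i (\<theta> n) p * g p) = (LINT p|M. D i (\<theta> n) p * g p)" for n
    proof (rule integral_cong_AE)
      show "AE x in M. pd cR i (\<theta> n) x * g x = D i (\<theta> n) x * g x"
        using smooth_H1(2)[OF \<theta>(1) i, of n] by eventually_elim simp
      show "(\<lambda>x. D i (\<theta> n) x * g x) \<in> borel_measurable M"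
        using borel_measurable_integrable[OF L2_inner_integrable[OF H1_wd(1)[OF tH i] gL(1)], of n] by simp
      show "(\<lambda>x. pd cR i (\<theta> n) x * g x) \<in> borel_measurable M"
        by (intro borel_measurable_integrable[OF rect_integrable_continuous] continuous_on_mult gc
            smooth_pd_continuous[OF \<theta>(1) i])
    qed
    moreover have "(\<lambda>n. (LINT p|M. \<theta> n p \<bullet> pd cR i g p) + (LINT p|M. D i (\<theta> n) p \<bullet> g p)) \<longlonglongrightarrow>
        (LINT p|M. \<omega> p \<bullet> pd cR i g p) + (LINT p|M. D i \<omega> p \<bullet> g p)"
      by (intro tendsto_add L2_tendsto_inner H1_L2 tH \<omega> gL L H1_wd(1) i) (simp_all add: l2norm_def)
    ultimately show ?thesis unfolding bd_def [abs_def] by simp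
  qed
  ultimately have "(LINT p|M. \<omega> p * pd cR i g p) + (LINT p|M. D i \<omega> p * g p) = 0"
    using LIMSEQ_unique by blast
  then show ?thesis by simp
qed

text \<open>The zero trace of \<open>\<omega>\<close> moves the derivative off z, so on the right z
  enters through its values alone. With \<open>\<omega>\<close> the curl of u, this is the weak form
  of the fact that the Laplacian of a divergence-free field is a rotated gradient of its
  curl.\<close>

lemma curl_by_parts:
  fixes \<omega> :: "plane \<Rightarrow> real"
  assumes tr: "has_trace a b \<omega> (\<lambda>x. 0)" and z: "z \<in> V"
  shows "(LINT x|M. \<omega> x * weak_curl a b z x) = (LINT x|M. D (0, 1) \<omega> x * (z x \<bullet> (1, 0))) - (LINT x|M. D (1, 0) \<omega> x * (z x \<bullet> (0, 1)))"
proof -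
  have \<omega>: "\<omega> \<in> H1" using tr unfolding has_trace_def H1_def by blast
  note W = H1_L2[OF \<omega>] H1_wd(1)[OF \<omega> e_Basis(1)] H1_wd(1)[OF \<omega> e_Basis(2)]
  obtain \<psi> where \<psi>: "\<And>n::nat. \<psi> n \<in> D1" "(\<lambda>n. l2norm M (\<lambda>x. \<psi> n x - z x)) \<longlonglongrightarrow> 0"
    "\<And>e. e \<in> Basis \<Longrightarrow> (\<lambda>n. l2norm M (\<lambda>x. D e (\<psi> n) x - D e z x)) \<longlonglongrightarrow> 0" using V_approx[OF z] by blast
  note H = D1_H1[OF \<psi>(1)] V_H1[OF z]
  have comp: "(\<lambda>n. l2norm M (\<lambda>x. \<psi> n x \<bullet> j - z x \<bullet> j)) \<longlonglongrightarrow> 0" if "norm j \<le> 1" for j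
  proof (rule Lim_null_comparison[OF always_eventually \<psi>(2)], rule allI)
    show "norm (l2norm M (\<lambda>x. \<psi> n x \<bullet> j - z x \<bullet> j)) \<le> l2norm M (\<lambda>x. \<psi> n x - z x)" for n
      using l2norm_inner_le[OF L2_diff[OF H1_L2[OF H(1), of n] H1_L2[OF H(2)]] that] by (simp only: inner_diff_left) simp
  qed
  have zero: "(\<lambda>n. l2norm M (\<lambda>x. f x - f x)) \<longlonglongrightarrow> 0" for f :: "plane \<Rightarrow> real" by (simp add: l2norm_def)
  have 1: "(\<lambda>n. LINT x|M. \<omega> x \<bullet> weak_curl a b (\<psi> n) x) \<longlonglongrightarrow> (LINT x|M. \<omega> x \<bullet> weak_curl a b z x)"
    by (rule L2_tendsto_inner) (intro W weak_curl_L2 weak_curl_tendsto H \<psi> zero; assumption)+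
  have 2: "(\<lambda>n. (LINT x|M. D (0, 1) \<omega> x \<bullet> (\<psi> n x \<bullet> (1, 0))) - (LINT x|M. D (1, 0) \<omega> x \<bullet> (\<psi> n x \<bullet> (0, 1)))) \<longlonglongrightarrow>
      (LINT x|M. D (0, 1) \<omega> x \<bullet> (z x \<bullet> (1, 0))) - (LINT x|M. D (1, 0) \<omega> x \<bullet> (z x \<bullet> (0, 1)))"
    by (intro tendsto_diff; rule L2_tendsto_inner) (intro W L2_inner_const H1_L2 H zero comp norm_e_le)+
  have "(LINT x|M. \<omega> x \<bullet> weak_curl a b (\<psi> n) x) =
      (LINT x|M. D (0, 1) \<omega> x \<bullet> (\<psi> n x \<bullet> (1, 0))) - (LINT x|M. D (1, 0) \<omega> x \<bullet> (\<psi> n x \<bullet> (0, 1)))" for n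
  proof -
    note s = D1_smooth[OF \<psi>(1)[of n]]
    let ?p = "\<lambda>x. \<psi> n x \<bullet> (1, 0)" and ?q = "\<lambda>x. \<psi> n x \<bullet> (0, 1)"
    note sp = smooth_inner[OF s, of "(1, 0)"] and sq = smooth_inner[OF s, of "(0, 1)"]
    have L: "pd cR (1, 0) ?q \<in> L2 M" "pd cR (0, 1) ?p \<in> L2 M"
      by (intro continuous_L2 smooth_pd_continuous sp sq e_Basis)+
    have "(LINT x|M. \<omega> x \<bullet> weak_curl a b (\<psi> n) x) = (LINT x|M. \<omega> x \<bullet> pd cR (1, 0) ?q x - \<omega> x \<bullet> pd cR (0, 1) ?p x)"
    proof (rule integral_cong_AE)
      have "AE x in M. x \<in> cR" using R_subset_cR by (intro AE_I2) auto
      then show "AE x in M. \<omega> x \<bullet> weak_curl a b (\<psi> n) x = \<omega> x \<bullet> pd cR (1, 0) ?q x - \<omega> x \<bullet> pd cR (0, 1) ?p x"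
        using smooth_H1(2)[OF s e_Basis(1)] smooth_H1(2)[OF s e_Basis(2)]
      proof eventually_elim
        case (elim x)
        then show ?case
          unfolding pd_cR_inner[OF s elim(1)] weak_curl_eq by (simp add: algebra_simps)
      qed
    qed (intro borel_measurable_integrable Bochner_Integration.integrable_diff L2_inner_integrable W weak_curl_L2 H L)+
    also have "\<dots> = (LINT x|M. \<omega> x \<bullet> pd cR (1, 0) ?q x) - (LINT x|M. \<omega> x \<bullet> pd cR (0, 1) ?p x)"
      by (intro Bochner_Integration.integral_diff L2_inner_integrable W L)
    also have "\<dots> = - (LINT x|M. D (1, 0) \<omega> x * ?q x) + (LINT x|M. D (0, 1) \<omega> x * ?p x)"
      using zero_trace_by_parts[OF tr sq e_Basis(1)] zero_trace_by_parts[OF tr sp e_Basis(2)]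
      unfolding inner_real_def by linarith
    finally show ?thesis by simp
  qed
  with 1 2 have "(LINT x|M. \<omega> x \<bullet> weak_curl a b z x) =
      (LINT x|M. D (0, 1) \<omega> x \<bullet> (z x \<bullet> (1, 0))) - (LINT x|M. D (1, 0) \<omega> x \<bullet> (z x \<bullet> (0, 1)))"
    using LIMSEQ_unique by (simp only:)
  then show ?thesis by (simp only: inner_real_def)
qed

text \<open>\<open>sobolev 2\<close> provides some weak derivative in H1. The chosen one agrees with
  it almost everywhere and therefore lies in H1 as well, so second derivatives may be written as
  iterated \<open>D\<close>.\<close>

lemma sobolev_2_facts:
  fixes u :: field
  assumes u: "u \<in> sobolev 2 R"
  shows "u \<in> H1" "e \<in> Basis \<Longrightarrow> D e u \<in> H1"
    "e \<in> Basis \<Longrightarrow> i \<in> Basis \<Longrightarrow> l2norm M (D i (D e u)) \<le> sobolev_norm 2 R u"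
    "l2norm M u \<le> sobolev_norm 2 R u"
proof -
  have s2: "u \<in> L2 M" "\<And>e. e \<in> Basis \<Longrightarrow> \<exists>g. g \<in> H1 \<and> weak_pd R e u g"
    using u unfolding H1_def numeral_2_eq_2 One_nat_def sobolev.simps(2)[of "Suc 0"] L2_space_eq by auto
  show H: "u \<in> H1" unfolding H1_iff using s2 H1_L2 by blast
  show "D e u \<in> H1" if e: "e \<in> Basis"
  proof -
    obtain g where g: "g \<in> H1" "weak_pd R e u g" using s2(2)[OF e] by blast
    show ?thesis
      by (rule H1_cong_AE(1)[OF g(1) _ H1_wd(1)[OF H e]])
        (use wd_eq(1)[OF g(2) H1_L2[OF g(1)]] in eventually_elim, simp)
  qed
  have sq: "sobolev_sq 2 R u = (l2norm M u)\<^sup>2 + (\<Sum>e\<in>Basis. (l2norm M (D e u))\<^sup>2 + (\<Sum>i\<in>Basis. (l2norm M (D i (D e u)))\<^sup>2))"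
    by (subst numeral_2_eq_2) (simp add: l2norm_power2)
  show "l2norm M (D i (D e u)) \<le> sobolev_norm 2 R u" if "e \<in> Basis" "i \<in> Basis"
    unfolding sobolev_norm_def sq
    using that by (intro real_le_rsqrt) (auto simp: Basis_plane)
  show "l2norm M u \<le> sobolev_norm 2 R u"
    unfolding sobolev_norm_def sq by (intro real_le_rsqrt) (auto intro!: sum_nonneg add_nonneg_nonneg)
qed

text \<open>The factor 4 counts the two first derivatives of the curl, each of which is a difference
  of two second derivatives of u bounded by the D(A) norm.\<close>

lemma DA_V_inner_bound:
  assumes u: "u \<in> V" "u \<in> DA_space a b" and z: "z \<in> V"
  shows "\<bar>V_inner a b u z\<bar> \<le> 4 * DA_norm a b u * l2norm M z"
proof -
  define \<omega> where "\<omega> = weak_curl a b u"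
  have s2: "u \<in> sobolev 2 R" and tr: "has_trace a b \<omega> (\<lambda>x. 0)"
    using u(2) by (auto simp: DA_space_def \<omega>_def)
  note S = sobolev_2_facts[OF s2]
  have \<omega>: "\<omega> \<in> H1" using tr unfolding has_trace_def H1_def by blast
  have bound: "l2norm M (D i \<omega>) \<le> 2 * DA_norm a b u" if i: "i \<in> Basis" for i
  proof -
    note W = H1_wd[OF S(2)[OF e_Basis(1)] i] H1_wd[OF S(2)[OF e_Basis(2)] i]
    note L = H1_L2[OF S(2)[OF e_Basis(1)]] H1_L2[OF S(2)[OF e_Basis(2)]]
    let ?g = "\<lambda>x. D i (D (1, 0) u) x \<bullet> (0, 1) - D i (D (0, 1) u) x \<bullet> (1, 0)"
    have "weak_pd R i \<omega> ?g"
      unfolding \<omega>_def weak_curl_eq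
      by (intro weak_pd_diff weak_pd_inner L2_inner_const W L i)
    moreover have gL: "?g \<in> L2 M" by (intro L2_diff L2_inner_const W)
    ultimately have "AE x in M. D i \<omega> x = ?g x" by (rule wd_eq(1))
    then have "l2norm M (D i \<omega>) = l2norm M ?g"
      by (rule l2norm_cong_AE) (intro L2_measurable H1_wd(1) \<omega> i gL)+
    also have "\<dots> \<le> l2norm M (\<lambda>x. D i (D (1, 0) u) x \<bullet> (0, 1)) + l2norm M (\<lambda>x. D i (D (0, 1) u) x \<bullet> (1, 0))"
      by (intro l2norm_triangle_diff L2_inner_const W)
    also have "\<dots> \<le> l2norm M (D i (D (1, 0) u)) + l2norm M (D i (D (0, 1) u))"
      by (intro add_mono l2norm_inner_le W) (simp_all add: norm_e_le)
    also have "\<dots> \<le> 2 * DA_norm a b u"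
      using S(3)[OF e_Basis(1) i] S(3)[OF e_Basis(2) i] by (simp add: DA_norm_def)
    finally show ?thesis .
  qed
  have tm: "\<bar>LINT x|M. D i \<omega> x * (z x \<bullet> j)\<bar> \<le> 2 * DA_norm a b u * l2norm M z" if "i \<in> Basis" "norm j \<le> 1" for i j
  proof -
    have "\<bar>LINT x|M. D i \<omega> x \<bullet> (z x \<bullet> j)\<bar> \<le> l2norm M (D i \<omega>) * l2norm M (\<lambda>x. z x \<bullet> j)"
      by (intro L2_Cauchy_Schwarz H1_wd(1) \<omega> that(1) L2_inner_const V_L2 z)
    also have "\<dots> \<le> 2 * DA_norm a b u * l2norm M z"
      by (intro mult_mono bound that l2norm_inner_le V_L2 z)
        (use order_trans[OF l2norm_nonneg S(4)] in \<open>simp_all add: DA_norm_def\<close>)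
    finally show ?thesis by simp
  qed
  have "V_inner a b u z = (LINT x|M. D (0, 1) \<omega> x * (z x \<bullet> (1, 0))) - (LINT x|M. D (1, 0) \<omega> x * (z x \<bullet> (0, 1)))"
    unfolding V_inner_eq_curl[OF u(1) z] using curl_by_parts[OF tr z] by (simp add: \<omega>_def)
  then show ?thesis
    using tm[of "(0, 1)" "(1, 0)"] tm[of "(1, 0)" "(0, 1)"] by (simp add: norm_e_le)
qed

end

section \<open>Real functions of time\<close>

abbreviation (input) time_measure :: "real \<Rightarrow> real measure" where "time_measure T \<equiv> lebesgue_on {0<..<T}"

text \<open>The data live on the open interval, while the estimates use closed subintervals that may
  reach 0 or T; the endpoints form a null set. The Lebesgue integral is convenient for comparisons
  almost everywhere, the gauge integral for additivity and the fundamental theorem, hence both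
  forms.\<close>

lemma time_integrable:
  fixes f :: "real \<Rightarrow> real"
  assumes f: "integrable (time_measure T) f" and st: "0 \<le> s" "s \<le> t" "t \<le> T"
  shows "f absolutely_integrable_on {s..t}" "f integrable_on {s..t}"
    "integrable (lebesgue_on {s..t}) f" "(LINT r|lebesgue_on {s..t}. f r) = integral {s..t} f"
proof -
  have "f absolutely_integrable_on {0<..<T}"
    using f by (simp add: integrable_restrict_space set_integrable_def)
  moreover have "f absolutely_integrable_on {0<..<T} \<longleftrightarrow> f absolutely_integrable_on {0..T}"
    by (rule absolutely_integrable_spike_set_eq)
      (auto intro!: negligible_subset[OF negligible_finite[of "{0, T}"]])
  ultimately have "f absolutely_integrable_on {0..T}" by simp
  then show a: "f absolutely_integrable_on {s..t}"
    by (rule absolutely_integrable_on_subinterval) (use st in auto)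
  then show "f integrable_on {s..t}" by (rule set_lebesgue_integral_eq_integral)
  show i: "integrable (lebesgue_on {s..t}) f"
    using a by (simp add: integrable_restrict_space set_integrable_def)
  show "(LINT r|lebesgue_on {s..t}. f r) = integral {s..t} f"
    by (rule lebesgue_integral_eq_integral[OF i]) simp
qed

lemma time_AE:
  assumes "AE t in time_measure T. P t" "0 \<le> s" "t \<le> T"
  shows "AE r in lebesgue_on {s..t}. P r"
proof -
  have 1: "AE r in lebesgue. r \<in> {0<..<T} \<longrightarrow> P r"
    using assms(1) by (simp add: AE_restrict_space_iff)
  have "AE r in lebesgue. r \<noteq> 0" "AE r in lebesgue. r \<noteq> T"
    by (auto intro: AE_completion AE_lborel_singleton)
  with 1 have "AE r in lebesgue. r \<in> {s..t} \<longrightarrow> P r"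
    by eventually_elim (use assms in auto)
  then show ?thesis by (simp add: AE_restrict_space_iff)
qed

lemma time_integral_mono:
  fixes f g :: "real \<Rightarrow> real"
  assumes "integrable (time_measure T) f" "integrable (time_measure T) g" "AE t in time_measure T. f t \<le> g t"
    "0 \<le> s" "s \<le> t" "t \<le> T"
  shows "integral {s..t} f \<le> integral {s..t} g"
  using integral_mono_AE[OF time_integrable(3)[OF assms(1,4,5,6)] time_integrable(3)[OF assms(2,4,5,6)]
      time_AE[OF assms(3,4,6)]]
  by (simp add: time_integrable(4)[OF assms(1,4,5,6)] time_integrable(4)[OF assms(2,4,5,6)])

lemma time_integral_combine:
  fixes f :: "real \<Rightarrow> real"
  assumes "integrable (time_measure T) f" "0 \<le> s" "s \<le> r" "r \<le> t" "t \<le> T"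
  shows "integral {s..r} f + integral {r..t} f = integral {s..t} f"
  using assms by (intro Henstock_Kurzweil_Integration.integral_combine time_integrable(2)[of T]) auto

lemma indefinite_time_integral_continuous:
  fixes f :: "real \<Rightarrow> real"
  assumes "integrable (time_measure T) f" "0 \<le> T"
  shows "continuous_on {0..T} (\<lambda>t. integral {0..t} f)"
  by (intro indefinite_integral_continuous_1 time_integrable(2)[OF assms(1)]) (use assms(2) in auto)

text \<open>Otherwise \<open>k\<close>, the excess over the mean scaled by the length, would have
  integral zero and yet be positive almost everywhere on an interval of positive length. The point
  found may be required to lie in any set of full measure.\<close>

lemma exists_le_average:
  fixes f :: "real \<Rightarrow> real"
  assumes f: "integrable (time_measure T) f" and good: "AE t in time_measure T. t \<in> G"
    and st: "0 \<le> s" "s < t" "t \<le> T"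
  shows "\<exists>x\<in>G. s < x \<and> x < t \<and> (t - s) * f x \<le> integral {s..t} f"
proof (rule ccontr)
  assume "\<not> ?thesis"
  then have gt: "(t - s) * f x > integral {s..t} f" if "x \<in> G" "s < x" "x < t" for x
    using that by force
  let ?L = "lebesgue_on {s..t}"
  note I = time_integrable[OF f st(1) less_imp_le[OF st(2)] st(3)]
  define k where "k x = (t - s) * f x - integral {s..t} f" for x
  have ic: "integrable ?L (\<lambda>x. integral {s..t} f)"
    by (intro continuous_imp_integrable_real continuous_on_const)
  have ik: "integrable ?L k"
    unfolding k_def by (intro Bochner_Integration.integrable_diff integrable_mult_right I(3) ic)
  have "AE r in lebesgue. r \<noteq> s" "AE r in lebesgue. r \<noteq> t"
    by (auto intro: AE_completion AE_lborel_singleton)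
  then have "AE r in ?L. r \<noteq> s" "AE r in ?L. r \<noteq> t"
    by (auto simp: AE_restrict_space_iff elim: eventually_mono)
  with time_AE[OF good st(1,3)] AE_space[of ?L] have pos: "AE x in ?L. k x > 0"
  proof eventually_elim
    case (elim x)
    then show ?case using gt[of x] by (auto simp: k_def)
  qed
  have "(LINT x|?L. k x) = 0"
  proof -
    have "(LINT x|?L. k x) = (t - s) * integral {s..t} f - (LINT x|?L. integral {s..t} f)"
      unfolding k_def using I(3,4) ic by simp
    also have "(LINT x|?L. integral {s..t} f) = (t - s) * integral {s..t} f"
      using st by (simp add: measure_restrict_space)
    finally show ?thesis by simp
  qed
  moreover have "AE x in ?L. 0 \<le> k x" using pos by eventually_elim simp
  ultimately have "AE x in ?L. k x = 0"
    using integral_nonneg_eq_0_iff_AE[OF ik] by simp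
  with pos have "AE x in ?L. False" by eventually_elim simp
  then have "AE x in lebesgue. x \<notin> {s..t}" by (simp add: AE_restrict_space_iff)
  then have "{s..t} \<in> null_sets lebesgue" by (subst AE_iff_null_sets) auto
  then show False using st by (simp add: null_sets_def)
qed

text \<open>Pieces of length \<open>\<delta>\<close> are split off from the right, and the additive
  right-hand side adds up exactly. An error proportional to \<open>\<delta>\<close> in the local
  inequality thus stays proportional to \<open>\<delta>\<close> globally.\<close>

lemma interval_chain:
  fixes \<Phi> :: "real \<Rightarrow> real \<Rightarrow> real"
  assumes step: "\<And>s t. 0 < s \<Longrightarrow> s \<le> t \<Longrightarrow> t < T \<Longrightarrow> t - s \<le> \<delta> \<Longrightarrow> y t - y s \<le> \<Phi> s t"
    and add: "\<And>s r t. 0 < s \<Longrightarrow> s \<le> r \<Longrightarrow> r \<le> t \<Longrightarrow> t < T \<Longrightarrow> \<Phi> s r + \<Phi> r t = \<Phi> s t"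
    and \<delta>: "\<delta> > 0" and st: "0 < s" "s \<le> t" "t < T"
  shows "y t - y s \<le> (\<Phi> s t :: real)"
proof -
  have "y t - y s \<le> \<Phi> s t" if "t - s \<le> real n * \<delta>" "0 < s" "s \<le> t" "t < T" for n s t
    using that
  proof (induction n arbitrary: t)
    case 0
    then show ?case using step[of s t] \<delta> by simp
  next
    case (Suc n)
    show ?case
    proof (cases "t - s \<le> \<delta>")
      case True
      then show ?thesis using step Suc.prems by blast
    next
      case False
      have "y (t - \<delta>) - y s \<le> \<Phi> s (t - \<delta>)"
        using False Suc.prems \<delta> by (intro Suc.IH) (auto simp: algebra_simps)
      moreover have "y t - y (t - \<delta>) \<le> \<Phi> (t - \<delta>) t"
        using False Suc.prems \<delta> by (intro step) auto
      moreover have "\<Phi> s (t - \<delta>) + \<Phi> (t - \<delta>) t = \<Phi> s t"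
        using False Suc.prems \<delta> by (intro add) auto
      ultimately show ?thesis by linarith
    qed
  qed
  moreover obtain n :: nat where "t - s \<le> real n * \<delta>"
    using real_arch_simple[of "(t - s) / \<delta>"] \<delta> by (auto simp: field_simps)
  ultimately show ?thesis using st by blast
qed

lemma Gronwall_interval:
  fixes y :: "real \<Rightarrow> real"
  assumes y: "continuous_on {s..t} y" and C: "C \<ge> 0" and st: "s \<le> t"
    and le: "\<And>r. s \<le> r \<Longrightarrow> r \<le> t \<Longrightarrow> y r - y s \<le> C * integral {s..r} y"
  shows "y t \<le> exp (C * (t - s)) * y s"
proof -
  \<comment> \<open>An integrating factor times the right-hand side of the integral inequality. It
    is differentiable although \<open>y\<close> itself is only continuous.\<close>
  define Z where "Z r = exp (- C * r) * (y s + C * integral {s..r} y)" for r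
  have "Z t \<le> Z s"
  proof (rule DERIV_nonpos_imp_decreasing_open[OF st])
    show "continuous_on {s..t} Z"
      unfolding Z_def
      by (intro continuous_intros indefinite_integral_continuous_1 integrable_continuous_real y)
    fix r assume r: "s < r" "r < t"
    have "((\<lambda>r. integral {s..r} y) has_real_derivative y r) (at r within {s..t})"
      by (rule integral_has_real_derivative[OF y]) (use r in auto)
    then have "((\<lambda>r. integral {s..r} y) has_real_derivative y r) (at r)"
      using r by (simp add: at_within_Icc_at)
    then have "(Z has_real_derivative
        exp (- C * r) * (C * y r) + (- C) * exp (- C * r) * (y s + C * integral {s..r} y)) (at r)"
      unfolding Z_def by (auto intro!: derivative_eq_intros)
    moreover have "exp (- C * r) * (C * y r) + (- C) * exp (- C * r) * (y s + C * integral {s..r} y)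
        = C * exp (- C * r) * (y r - y s - C * integral {s..r} y)"
      by (simp add: algebra_simps)
    moreover have "\<dots> \<le> 0"
      using le[of r] r C by (intro mult_nonneg_nonpos) auto
    ultimately show "\<exists>y. (Z has_real_derivative y) (at r) \<and> y \<le> 0" by (metis)
  qed
  then have "exp (- C * t) * (y s + C * integral {s..t} y) \<le> exp (- C * s) * y s"
    by (simp add: Z_def)
  then have "exp (C * t) * (exp (- C * t) * (y s + C * integral {s..t} y)) \<le> exp (C * t) * (exp (- C * s) * y s)"
    by (intro mult_left_mono) auto
  then have "y s + C * integral {s..t} y \<le> exp (C * (t - s)) * y s"
    by (simp add: mult.assoc[symmetric] exp_add[symmetric] right_diff_distrib)
  with le[of t] st show ?thesis by simp
qed

text \<open>The points of a partition are chosen, one in each cell, such that \<open>\<alpha>\<^sup>2\<close> is there at most its average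
  over the cell; then the sum of the products in \<open>step\<close> is controlled although \<open>\<alpha>\<close> is only square integrable.\<close>

lemma chain_estimate:
  fixes E \<alpha> \<beta> :: "real \<Rightarrow> real"
  assumes good: "AE t in time_measure T. t \<in> G" and pq: "p \<in> G" "q \<in> G" "0 < p" "p < q" "q < T"
    and \<alpha>2: "integrable (time_measure T) (\<lambda>t. (\<alpha> t)\<^sup>2)" and \<alpha>: "\<And>t. \<alpha> t \<ge> 0" "A \<ge> 0"
    and \<beta>: "integrable (time_measure T) \<beta>" "\<And>t. \<beta> t \<ge> 0"
    and step: "\<And>r r'. r \<in> G \<Longrightarrow> r' \<in> G \<Longrightarrow> 0 < r \<Longrightarrow> r < r' \<Longrightarrow> r' < T \<Longrightarrow>
      \<bar>E r' - E r\<bar> \<le> (\<alpha> r + \<alpha> r' + 2 * A) * sqrt ((r' - r) * integral {r..r'} \<beta>)"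
  shows "\<bar>E q - E p\<bar> \<le> 6 * integral {p..q} (\<lambda>t. (\<alpha> t)\<^sup>2) + 12 * (q - p) * A\<^sup>2 + integral {p..q} \<beta> / 2"
proof -
  define I where "I = integral {p..q} (\<lambda>t. (\<alpha> t)\<^sup>2)"
  \<comment> \<open>\<open>K\<close> gathers what averaging does not control: the values of
    \<open>\<alpha>\<close> at the two endpoints, and the surplus term with \<open>A\<close> due to
    N + 1 increments over N cells. It occurs only with the mesh as a factor.\<close>
  define K where "K = 3 * (\<alpha> p)\<^sup>2 + 3 * (\<alpha> q)\<^sup>2 + 12 * A\<^sup>2"
  have K0: "K \<ge> 0" unfolding K_def by simp
  have main: "\<bar>E q - E p\<bar> \<le> 6 * I + 12 * (q - p) * A\<^sup>2 + integral {p..q} \<beta> / 2 + (q - p) / real N * K"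
    if N: "N > 0" for N :: nat
  proof -
    define d where "d = (q - p) / real N"
    have d: "d > 0" "real N * d = q - p" using pq N by (auto simp: d_def)
    define c where "c i = p + real i * d" for i
    have c: "c 0 = p" "c N = q" "c (Suc i) - c i = d" "c i < c (Suc i)" for i
      using d by (auto simp: c_def algebra_simps)
    have cmono: "c i \<le> c j" if "i \<le> j" for i j
      using that d by (auto simp: c_def intro!: mult_right_mono)
    have cpq: "p \<le> c i" "c i \<le> q" if "i \<le> N" for i
      using cmono[of 0 i] cmono[of i N] that c by auto
    have "\<exists>x\<in>G. c i < x \<and> x < c (Suc i) \<and> d * (\<alpha> x)\<^sup>2 \<le> integral {c i..c (Suc i)} (\<lambda>t. (\<alpha> t)\<^sup>2)" if "i < N" for i
      using exists_le_average[OF \<alpha>2 good, of "c i" "c (Suc i)"] c(3,4)[of i] cpq[of i] cpq[of "Suc i"] that pq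
      by auto
    then have "\<exists>x. \<forall>i\<in>{..<N}. x i \<in> G \<and> c i < x i \<and> x i < c (Suc i) \<and>
        d * (\<alpha> (x i))\<^sup>2 \<le> integral {c i..c (Suc i)} (\<lambda>t. (\<alpha> t)\<^sup>2)"
      by (intro bchoice) blast
    then obtain x where x: "\<And>i. i < N \<Longrightarrow> x i \<in> G" "\<And>i. i < N \<Longrightarrow> c i < x i" "\<And>i. i < N \<Longrightarrow> x i < c (Suc i)"
      "\<And>i. i < N \<Longrightarrow> d * (\<alpha> (x i))\<^sup>2 \<le> integral {c i..c (Suc i)} (\<lambda>t. (\<alpha> t)\<^sup>2)" by blast
    \<comment> \<open>One point from each of the N cells together with both endpoints gives N + 1
      increments. Consecutive points lie in the same or in adjacent cells, so their distance is at
      most 2d.\<close>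
    define z where "z j = (if j = 0 then p else if j = Suc N then q else x (j - 1))" for j
    have z0: "z 0 = p" "z (Suc N) = q" "\<And>i. i < N \<Longrightarrow> z (Suc i) = x i" by (auto simp: z_def)
    have lo: "z j \<le> c j \<and> (0 < j \<longrightarrow> c (j - 1) < z j) \<and> z j \<in> G \<and> p \<le> z j" if "j \<le> N" for j
    proof (cases j)
      case 0
      then show ?thesis using z0 c pq by simp
    next
      case (Suc i)
      then have "i < N" using that by simp
      then show ?thesis using Suc z0(3) x(1-3)[of i] cpq(1)[of i] by auto
    qed
    have hi: "c j < z (Suc j) \<and> z (Suc j) \<in> G \<and> z (Suc j) \<le> q \<and> z (Suc j) \<le> c j + d" if "j < N" for j
      using x(1-3)[OF that] z0(3)[OF that] cpq(2)[of "Suc j"] that c(3)[of j] by auto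
    have zstep: "z j < z (Suc j)" "z (Suc j) - z j \<le> 2 * d" "z j \<in> G" "z (Suc j) \<in> G" "p \<le> z j" "z (Suc j) \<le> q"
      if "j < Suc N" for j
    proof -
      have j: "j \<le> N" using that by simp
      have low: "c j - d \<le> z j"
      proof (cases j)
        case (Suc i)
        then show ?thesis using lo[OF j] c(3)[of i] by simp
      qed (use d c z0 in simp)
      have "c j \<le> z (Suc j) \<and> (0 < j \<or> j < N \<longrightarrow> z j < z (Suc j)) \<and> z (Suc j) \<le> c j + d \<and> z (Suc j) \<in> G \<and> z (Suc j) \<le> q"
      proof (cases "j < N")
        case True
        then show ?thesis using hi[OF True] lo[OF j] by auto
      next
        case False
        then have jN: "j = N" using j by simp
        then obtain i where i: "N = Suc i" using N by (cases N) auto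
        have "z N < q" using x(3)[of i] z0(3)[of i] c(2) i by simp
        then show ?thesis using jN z0(2) c(2) pq d by simp
      qed
      then show "z j < z (Suc j)" "z (Suc j) - z j \<le> 2 * d" "z j \<in> G" "z (Suc j) \<in> G" "p \<le> z j" "z (Suc j) \<le> q"
        using low lo[OF j] N that by auto
    qed
    have tm: "\<bar>E (z (Suc j)) - E (z j)\<bar> \<le> 3 * d * (\<alpha> (z j))\<^sup>2 + 3 * d * (\<alpha> (z (Suc j)))\<^sup>2 + 12 * d * A\<^sup>2
        + (integral {p..z (Suc j)} \<beta> - integral {p..z j} \<beta>) / 2" if j: "j < Suc N" for j
    proof -
      note zs = zstep[OF j]
      define B where "B = integral {z j..z (Suc j)} \<beta>"
      have B: "B \<ge> 0" "B = integral {p..z (Suc j)} \<beta> - integral {p..z j} \<beta>"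
      proof -
        show "B = integral {p..z (Suc j)} \<beta> - integral {p..z j} \<beta>"
          unfolding B_def using time_integral_combine[OF \<beta>(1), of p "z j" "z (Suc j)"] zs pq by simp
        show "B \<ge> 0" unfolding B_def
          by (rule Henstock_Kurzweil_Integration.integral_nonneg[OF time_integrable(2)[OF \<beta>(1)]]) (use zs pq \<beta>(2) in auto)
      qed
      define S where "S = \<alpha> (z j) + \<alpha> (z (Suc j)) + 2 * A"
      have "\<bar>E (z (Suc j)) - E (z j)\<bar> \<le> S * sqrt ((z (Suc j) - z j) * B)"
        unfolding S_def B_def using zs pq by (intro step) auto
      also have "\<dots> \<le> S * sqrt (2 * d * B)"
        using zs B \<alpha> by (intro mult_left_mono real_sqrt_le_mono mult_right_mono) (auto simp: S_def)
      also have "\<dots> = (sqrt (2 * d) * S) * sqrt B" by (simp add: real_sqrt_mult)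
      also have "\<dots> \<le> ((sqrt (2 * d) * S)\<^sup>2 + (sqrt B)\<^sup>2) / 2"
        using sum_squares_bound[of "sqrt (2 * d) * S" "sqrt B"] by simp
      also have "\<dots> = d * S\<^sup>2 + B / 2"
        using d B(1) by (simp add: power_mult_distrib field_simps)
      \<comment> \<open>The square of a sum of three terms is at most three times the sum of their
        squares. The third term 2A gives the 12, and each interior point is an end of two
        increments, so 3 becomes 6 in the total.\<close>
      also have "S\<^sup>2 \<le> 3 * (\<alpha> (z j))\<^sup>2 + 3 * (\<alpha> (z (Suc j)))\<^sup>2 + 12 * A\<^sup>2"
      proof -
        have "0 \<le> (\<alpha> (z j) - \<alpha> (z (Suc j)))\<^sup>2 + (\<alpha> (z j) - 2 * A)\<^sup>2 + (\<alpha> (z (Suc j)) - 2 * A)\<^sup>2" by simp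
        then show ?thesis unfolding S_def by (simp add: power2_eq_square algebra_simps)
      qed
      finally show ?thesis using d unfolding B(2) by (simp add: algebra_simps)
    qed
    have "\<bar>E q - E p\<bar> = \<bar>\<Sum>j<Suc N. E (z (Suc j)) - E (z j)\<bar>"
      using sum_lessThan_telescope[of "\<lambda>j. E (z j)" "Suc N"] z0 by simp
    also have "\<dots> \<le> (\<Sum>j<Suc N. \<bar>E (z (Suc j)) - E (z j)\<bar>)" by (rule sum_abs)
    also have "\<dots> \<le> (\<Sum>j<Suc N. 3 * d * (\<alpha> (z j))\<^sup>2 + 3 * d * (\<alpha> (z (Suc j)))\<^sup>2 + 12 * d * A\<^sup>2
        + (integral {p..z (Suc j)} \<beta> - integral {p..z j} \<beta>) / 2)"
      by (intro sum_mono tm) simp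
    also have "\<dots> = 3 * (\<Sum>j<Suc N. d * (\<alpha> (z j))\<^sup>2) + 3 * (\<Sum>j<Suc N. d * (\<alpha> (z (Suc j)))\<^sup>2) + real (Suc N) * (12 * d * A\<^sup>2)
        + (\<Sum>j<Suc N. integral {p..z (Suc j)} \<beta> - integral {p..z j} \<beta>) / 2"
      by (simp only: sum.distrib sum_distrib_left sum_divide_distrib sum_constant card_lessThan mult.assoc)
    also have "(\<Sum>j<Suc N. integral {p..z (Suc j)} \<beta> - integral {p..z j} \<beta>) = integral {p..q} \<beta>"
      using sum_lessThan_telescope[of "\<lambda>j. integral {p..z j} \<beta>" "Suc N"] z0 by simp
    also have "(\<Sum>j<Suc N. d * (\<alpha> (z j))\<^sup>2) = d * (\<alpha> p)\<^sup>2 + (\<Sum>i<N. d * (\<alpha> (x i))\<^sup>2)"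
      by (subst sum.lessThan_Suc_shift) (simp add: z0)
    also have "(\<Sum>j<Suc N. d * (\<alpha> (z (Suc j)))\<^sup>2) = (\<Sum>i<N. d * (\<alpha> (x i))\<^sup>2) + d * (\<alpha> q)\<^sup>2"
      by (simp add: z0)
    finally have 1: "\<bar>E q - E p\<bar> \<le> 6 * (\<Sum>i<N. d * (\<alpha> (x i))\<^sup>2) + 3 * (d * (\<alpha> p)\<^sup>2) + 3 * (d * (\<alpha> q)\<^sup>2)
        + real (Suc N) * (12 * d * A\<^sup>2) + integral {p..q} \<beta> / 2" by simp
    have "(\<Sum>i<N. d * (\<alpha> (x i))\<^sup>2) \<le> (\<Sum>i<N. integral {c i..c (Suc i)} (\<lambda>t. (\<alpha> t)\<^sup>2))"
      by (intro sum_mono x) simp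
    also have "\<dots> = (\<Sum>i<N. integral {p..c (Suc i)} (\<lambda>t. (\<alpha> t)\<^sup>2) - integral {p..c i} (\<lambda>t. (\<alpha> t)\<^sup>2))"
    proof (intro sum.cong refl)
      fix i assume "i \<in> {..<N}"
      then show "integral {c i..c (Suc i)} (\<lambda>t. (\<alpha> t)\<^sup>2) = integral {p..c (Suc i)} (\<lambda>t. (\<alpha> t)\<^sup>2) - integral {p..c i} (\<lambda>t. (\<alpha> t)\<^sup>2)"
        using time_integral_combine[OF \<alpha>2, of p "c i" "c (Suc i)"] cpq[of i] cpq[of "Suc i"] c(4)[of i] pq by simp
    qed
    also have "\<dots> = I"
      using sum_lessThan_telescope[of "\<lambda>j. integral {p..c j} (\<lambda>t. (\<alpha> t)\<^sup>2)" N] c by (simp add: I_def)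
    finally have 2: "(\<Sum>i<N. d * (\<alpha> (x i))\<^sup>2) \<le> I" .
    have "real (Suc N) * (12 * d * A\<^sup>2) = 12 * (q - p) * A\<^sup>2 + d * (12 * A\<^sup>2)"
    proof -
      have "real (Suc N) * (12 * d * A\<^sup>2) = 12 * (real N * d) * A\<^sup>2 + d * (12 * A\<^sup>2)"
        by (simp add: algebra_simps)
      then show ?thesis unfolding d(2) .
    qed
    with 1 2 show ?thesis unfolding K_def d_def[symmetric] by (simp add: algebra_simps)
  qed
  show ?thesis
  proof (rule field_le_epsilon)
    fix e :: real assume e: "e > 0"
    obtain N :: nat where N: "(q - p) * K / e < real N" using reals_Archimedean2 by blast
    moreover have "0 \<le> (q - p) * K / e" using pq K0 e by simp
    ultimately have N0: "N > 0" by (metis le_less_trans of_nat_0_less_iff)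
    have "(q - p) / real N * K \<le> e"
      using N N0 e by (simp add: field_simps)
    with main[OF N0] show "\<bar>E q - E p\<bar> \<le> 6 * integral {p..q} (\<lambda>t. (\<alpha> t)\<^sup>2) + 12 * (q - p) * A\<^sup>2 + integral {p..q} \<beta> / 2 + e"
      unfolding I_def by linarith
  qed
qed

text \<open>Completeness of Lebesgue measure. Scalar functions of time arise below as limits or
  differences known only almost everywhere, and measurability must survive this.\<close>

lemma time_measurable_AE:
  fixes u v :: "real \<Rightarrow> real"
  assumes u: "u \<in> borel_measurable (time_measure T)" and ae: "AE t in time_measure T. u t = v t"
  shows "v \<in> borel_measurable (time_measure T)"
proof -
  have "(\<lambda>t. indicator {0<..<T} t *\<^sub>R v t) \<in> borel_measurable lebesgue"
  proof (rule borel_measurable_AE)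
    show "(\<lambda>t. indicator {0<..<T} t *\<^sub>R u t) \<in> borel_measurable lebesgue"
      using u by (subst borel_measurable_restrict_space_iff[symmetric]) auto
    have "AE t in lebesgue. t \<in> {0<..<T} \<longrightarrow> u t = v t"
      using ae by (simp add: AE_restrict_space_iff)
    then show "AE t in lebesgue. indicator {0<..<T} t *\<^sub>R u t = indicator {0<..<T} t *\<^sub>R v t"
      by eventually_elim (auto simp: indicator_def)
  qed
  then show ?thesis by (subst borel_measurable_restrict_space_iff) auto
qed

subsection \<open>A weak derivative is a derivative\<close>

text \<open>The primitive of a normalised bump. Its steep rescalings at two times s < t differ by a
  test function that approximates the indicator of [s,t], and their derivatives approximate point
  masses at s and t.\<close>

lemma smooth_step:
  obtains \<Phi> P :: "real \<Rightarrow> real" where "\<And>x. (\<Phi> has_real_derivative P x) (at x)" "\<And>k. Ck_on k UNIV \<Phi>"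
    "\<And>x. P x \<ge> 0" "\<And>x. x \<le> -1 \<Longrightarrow> \<Phi> x = 0" "\<And>x. x \<ge> 1 \<Longrightarrow> \<Phi> x = 1" "continuous_on UNIV P"
    "\<And>x. \<bar>x\<bar> \<ge> 1 \<Longrightarrow> P x = 0" "\<And>x. \<Phi> x \<ge> 0" "\<And>x. \<Phi> x \<le> 1"
proof -
  \<comment> \<open>The index is 2 because with index 1 the two cutoff factors are never positive
    together; here the support is [-1/2, 1/2].\<close>
  define Q where "Q = bump (-1) (1::real) 2"
  have Qc: "continuous_on UNIV Q" using bump_Ck[of 0 "-1" 1 2] by (simp add: Q_def)
  have Q0: "Q x \<ge> 0" for x by (simp add: Q_def bump_nonneg)
  have Qz: "Q x = 0" if "\<bar>x\<bar> \<ge> 1" for x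
    unfolding Q_def by (rule bump_eq_0) (use that in \<open>auto simp: abs_le_iff\<close>)
  have Qpos: "Q 0 > 0" unfolding Q_def bump_def by (simp add: cutoff_pos)
  define Z where "Z = integral {-1..1} Q"
  have Qi: "Q integrable_on {s..t}" for s t
    by (intro integrable_continuous_real continuous_on_subset[OF Qc]) auto
  have Zpos: "Z > 0"
  proof -
    have "Z \<ge> 0" unfolding Z_def by (rule Henstock_Kurzweil_Integration.integral_nonneg[OF Qi]) (use Q0 in auto)
    moreover have "Z \<noteq> 0"
    proof
      assume "Z = 0"
      then have "Q 0 = 0"
        using integral_eq_0_iff[of "-1" 1 Q] continuous_on_subset[OF Qc] Q0 by (auto simp: Z_def)
      with Qpos show False by simp
    qed
    ultimately show ?thesis by simp
  qed
  define \<Phi> where "\<Phi> x = integral {-1..x} Q / Z" for x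
  have der: "(\<Phi> has_real_derivative Q x / Z) (at x)" for x
  proof (cases "x > -1")
    case True
    have "((\<lambda>x. integral {-1..x} Q) has_real_derivative Q x) (at x within {-1..x + 1})"
      by (rule integral_has_real_derivative) (use True continuous_on_subset[OF Qc] in auto)
    then have "((\<lambda>x. integral {-1..x} Q) has_real_derivative Q x) (at x)"
      using True by (simp add: at_within_Icc_at)
    then show ?thesis unfolding \<Phi>_def by (rule DERIV_cdivide)
  next
    case False
    have z: "\<Phi> y = 0" if "y \<le> -1" for y
      using that by (cases "y = -1") (auto simp: \<Phi>_def)
    show ?thesis
    proof (cases "x = -1")
      \<comment> \<open>Below -1 the integral is over an empty interval, so at -1 the two one-sided
        derivatives are computed separately and glued.\<close>
      case x: True
      have "((\<lambda>x. integral {-1..x} Q) has_real_derivative Q x) (at x within {-1..0})"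
        by (rule integral_has_real_derivative) (use x continuous_on_subset[OF Qc] in auto)
      then have 1: "(\<Phi> has_real_derivative Q x / Z) (at x within {-1..0})"
        unfolding \<Phi>_def by (rule DERIV_cdivide)
      have "((\<lambda>x. 0) has_real_derivative Q x / Z) (at x within {-2..-1})"
        using Qz[of x] x by simp
      then have 2: "(\<Phi> has_real_derivative Q x / Z) (at x within {-2..-1})"
        by (rule has_field_derivative_transform_within[OF _ zero_less_one]) (use x z in auto)
      have "(\<Phi> has_real_derivative Q x / Z) (at x within {-1..0} \<union> {-2..-1})"
        using 1 2 by (simp add: has_field_derivative_def has_derivative_within Lim_within_Un)
      moreover have "{-1..0} \<union> {-2..-1} = {-2..0::real}" by auto
      ultimately show ?thesis
        using x by (simp add: at_within_Icc_at)
    next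
      case False
      then have x: "x < -1" using \<open>\<not> x > -1\<close> by simp
      have "((\<lambda>x. 0) has_real_derivative Q x / Z) (at x)"
        using Qz[of x] x by simp
      then show ?thesis
        by (rule has_field_derivative_transform_within_open[of _ _ _ "{..<-1}"]) (use x z in auto)
    qed
  qed
  have one: "\<Phi> x = 1" if "x \<ge> 1" for x
  proof -
    have "integral {-1..1} Q + integral {1..x} Q = integral {-1..x} Q"
      by (rule Henstock_Kurzweil_Integration.integral_combine) (use that Qi in auto)
    moreover have "integral {1..x} Q = integral {1..x} (\<lambda>x. 0)"
      by (rule Henstock_Kurzweil_Integration.integral_cong) (use Qz in auto)
    ultimately show ?thesis using Zpos by (simp add: \<Phi>_def Z_def)
  qed
  have zero: "\<Phi> x = 0" if "x \<le> -1" for x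
    using that by (cases "x = -1") (auto simp: \<Phi>_def)
  have mono: "\<Phi> x \<le> \<Phi> y" if "x \<le> y" for x y
    using DERIV_nonneg_imp_nondecreasing[OF that, of \<Phi>] der Q0 Zpos by (metis divide_nonneg_pos)
  have "Ck_on k UNIV \<Phi>" for k
  proof (cases k)
    case 0
    then show ?thesis using der by (auto intro!: continuous_at_imp_continuous_on DERIV_isCont)
  next
    case (Suc j)
    have "pd UNIV 1 \<Phi> = (\<lambda>x. Q x * (1 / Z))" by (rule ext) (simp add: pd_real_eq[OF der])
    moreover have "Ck_on j UNIV (\<lambda>x. Q x * (1 / Z))"
      unfolding Q_def by (intro Ck_on_mult bump_Ck Ck_on_const)
    moreover have "\<Phi> differentiable_on UNIV"
      unfolding differentiable_on_def using der real_differentiable_def by blast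
    ultimately show ?thesis using Suc by simp
  qed
  moreover have "continuous_on UNIV (\<lambda>x. Q x / Z)" using Qc Zpos by (intro continuous_intros) auto
  moreover have "\<Phi> x \<ge> 0" "\<Phi> x \<le> 1" for x
    using mono[of "min x (-1)" x] mono[of x "max x 1"] zero[of "min x (-1)"] one[of "max x 1"] by auto
  ultimately show ?thesis
    using that[of \<Phi> "\<lambda>x. Q x / Z"] der Q0 Qz Zpos zero one by (simp add: divide_nonneg_pos)
qed

text \<open>The weak identity is tested with \<open>\<phi> n\<close>, a smoothed indicator of [s,t].
  The left side tends to U(s) - U(t) by continuity of U, the right side to minus the integral of W
  by dominated convergence. Continuity of U gives the formula at all s < t, not merely at almost
  all.\<close>

lemma weak_derivative_FTC:
  fixes U W :: "real \<Rightarrow> real"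
  assumes U: "continuous_on {0<..<T} U" and W: "integrable (time_measure T) W"
    and weak: "\<And>\<phi>. test_fun {0<..<T} \<phi> \<Longrightarrow>
      (LINT t|time_measure T. deriv \<phi> t * U t) = - (LINT t|time_measure T. \<phi> t * W t)"
    and st: "0 < s" "s < t" "t < T"
  shows "U t - U s = integral {s..t} W"
proof -
  obtain \<Phi> P :: "real \<Rightarrow> real" where P: "\<And>x. (\<Phi> has_real_derivative P x) (at x)" "\<And>k. Ck_on k UNIV \<Phi>"
    "\<And>x. P x \<ge> 0" "\<And>x. x \<le> -1 \<Longrightarrow> \<Phi> x = 0" "\<And>x. x \<ge> 1 \<Longrightarrow> \<Phi> x = 1" "continuous_on UNIV P"
    "\<And>x. \<bar>x\<bar> \<ge> 1 \<Longrightarrow> P x = 0" "\<And>x. \<Phi> x \<ge> 0" "\<And>x. \<Phi> x \<le> 1" by (rule smooth_step) blast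
  \<comment> \<open>This lower bound on the steepness keeps the supports of all
    \<open>\<phi> n\<close> inside the open interval.\<close>
  obtain m :: nat where m: "1 / real m < min s (T - t)" "m > 0"
    using reals_Archimedean[of "min s (T - t)"] st by (auto simp: inverse_eq_divide intro: that[of "Suc _"])
  define k where "k n = real (n + m)" for n
  have k: "k n > 0" "1 / k n < s" "1 / k n < T - t" for n
  proof -
    show "k n > 0" using m by (simp add: k_def)
    have "1 / k n \<le> 1 / real m" using m by (simp add: k_def frac_le)
    with m show "1 / k n < s" "1 / k n < T - t" by auto
  qed
  have kinf: "filterlim k at_top sequentially"
    by (rule filterlim_at_top_mono[OF filterlim_real_sequentially]) (simp add: k_def)
  \<comment> \<open>An approximate identity at c, supported within distance 1 /
    \<open>k n\<close>.\<close>
  define q where "q n c r = k n * P (k n * (r - c))" for n c r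
  define \<phi> where "\<phi> n r = \<Phi> (k n * (r - s)) - \<Phi> (k n * (r - t))" for n r
  have der: "(\<phi> n has_real_derivative q n s r - q n t r) (at r)" for n r
    unfolding \<phi>_def q_def by (auto intro!: derivative_eq_intros DERIV_chain2[OF P(1)])
  have qc: "continuous_on S (q n c)" for S n c
    unfolding q_def by (intro continuous_intros continuous_on_compose2[OF P(6)]) auto
  have q0: "q n c r = 0" if "\<bar>r - c\<bar> \<ge> 1 / k n" for n c r
  proof -
    have "\<bar>k n * (r - c)\<bar> = k n * \<bar>r - c\<bar>" using k(1)[of n] by (simp add: abs_mult)
    then have "\<bar>k n * (r - c)\<bar> \<ge> 1" using that k(1)[of n] by (simp only:) (simp add: field_simps)
    then show ?thesis by (simp add: q_def P(7))
  qed
  have qnn: "q n c r \<ge> 0" for n c r using k(1)[of n] P(3) by (simp add: q_def)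
  have test: "test_fun {0<..<T} (\<phi> n)" for n
    unfolding test_fun_def smooth_on_def
  proof (intro conjI allI exI[of _ "{s - 1 / k n..t + 1 / k n}"] impI)
    fix j
    have 1: "Ck_on j UNIV (\<lambda>r. \<Phi> (k n * (r - c)))" for c
      using Ck_on_affine[OF P(2) bounded_linear_mult_right[of "k n"], of j "- (k n * c)"] by (simp add: algebra_simps)
    have "Ck_on j UNIV (\<lambda>r. \<Phi> (k n * (r - s)) + (-1) * \<Phi> (k n * (r - t)))"
      by (intro Ck_on_add Ck_on_mult Ck_on_const 1)
    then show "Ck_on j UNIV (\<phi> n)" by (simp add: \<phi>_def [abs_def])
    show "{s - 1 / k n..t + 1 / k n} \<subseteq> {0<..<T}" using k[of n] by auto
    fix r assume "r \<notin> {s - 1 / k n..t + 1 / k n}"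
    then consider "r < s - 1 / k n" | "r > t + 1 / k n" by fastforce
    then show "\<phi> n r = 0"
    proof cases
      case 1
      then have "k n * (r - s) \<le> -1" "k n * (r - t) \<le> k n * (r - s)"
        using k(1)[of n] st by (auto simp: field_simps)
      then show ?thesis by (simp add: \<phi>_def P(4))
    next
      case 2
      then have "k n * (r - t) \<ge> 1" "k n * (r - s) \<ge> k n * (r - t)"
        using k(1)[of n] st by (auto simp: field_simps)
      then show ?thesis by (simp add: \<phi>_def P(5))
    qed
  qed simp
  have conc: "integrable (time_measure T) (\<lambda>r. q n c r * U r) \<and>
      (LINT r|time_measure T. q n c r * U r) = integral {c - 1 / k n..c + 1 / k n} (\<lambda>r. q n c r * U r)"
    if c: "c = s \<or> c = t" for n c
  proof -
    let ?J = "{c - 1 / k n..c + 1 / k n}"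
    have sub: "?J \<subseteq> {0<..<T}" using c k[of n] st by auto
    have cont: "continuous_on ?J (\<lambda>r. q n c r * U r)"
      by (intro continuous_intros qc continuous_on_subset[OF U sub])
    have i: "integrable (lebesgue_on ?J) (\<lambda>r. q n c r * U r)"
      by (rule continuous_imp_integrable_real[OF cont])
    have eq: "(\<lambda>r. indicator {0<..<T} r *\<^sub>R (q n c r * U r)) = (\<lambda>r. indicator ?J r *\<^sub>R (q n c r * U r))"
    proof
      fix r
      show "indicator {0<..<T} r *\<^sub>R (q n c r * U r) = indicator ?J r *\<^sub>R (q n c r * U r)"
      proof (cases "r \<in> ?J")
        case False
        then have "q n c r = 0" by (intro q0) (auto simp: abs_if split: if_splits)
        then show ?thesis by simp
      qed (use sub in auto)
    qed
    show ?thesis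
      using i eq lebesgue_integral_eq_integral[OF i]
      by (simp add: integrable_restrict_space integral_restrict_space)
  qed
  have lim: "(\<lambda>n. LINT r|time_measure T. q n c r * U r) \<longlonglongrightarrow> U c" if c: "c = s \<or> c = t" for c
  proof (rule LIMSEQ_I)
    fix e :: real assume e: "e > 0"
    have "c \<in> {0<..<T}" using c st by auto
    then have "isCont U c" using U by (simp add: continuous_on_eq_continuous_at)
    then obtain \<delta> where \<delta>: "\<delta> > 0" "\<And>r. \<bar>r - c\<bar> < \<delta> \<Longrightarrow> \<bar>U r - U c\<bar> < e / 2"
      using e unfolding continuous_at_eps_delta by (metis dist_real_def half_gt_zero)
    obtain N where N: "\<And>n. n \<ge> N \<Longrightarrow> k n > 1 / \<delta>"
      using kinf unfolding filterlim_at_top_dense eventually_sequentially by blast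
    show "\<exists>N. \<forall>n\<ge>N. norm ((LINT r|time_measure T. q n c r * U r) - U c) < e"
    proof (intro exI allI impI)
      fix n assume "n \<ge> N"
      then have small: "1 / k n < \<delta>" using N[of n] \<delta>(1) k(1)[of n] by (simp add: field_simps)
      let ?l = "c - 1 / k n" and ?h = "c + 1 / k n"
      have le: "?l \<le> ?h" using k(1)[of n] by simp
      have "(q n c has_integral \<Phi> (k n * (?h - c)) - \<Phi> (k n * (?l - c))) {?l..?h}"
      proof (rule fundamental_theorem_of_calculus[OF le])
        fix r
        have "((\<lambda>r. k n * (r - c)) has_real_derivative k n) (at r)"
          by (auto intro!: derivative_eq_intros)
        from DERIV_chain2[OF P(1) this]
        have "((\<lambda>r. \<Phi> (k n * (r - c))) has_real_derivative q n c r) (at r)"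
          by (simp add: q_def mult.commute)
        then show "((\<lambda>r. \<Phi> (k n * (r - c))) has_vector_derivative q n c r) (at r within {?l..?h})"
          by (simp add: has_real_derivative_iff_has_vector_derivative has_vector_derivative_at_within)
      qed
      moreover have "\<Phi> (k n * (?h - c)) - \<Phi> (k n * (?l - c)) = 1"
        using k(1)[of n] P(4)[of "-1"] P(5)[of 1] by simp
      ultimately have hq: "(q n c has_integral 1) {?l..?h}" by simp
      have cont: "continuous_on {?l..?h} U"
        by (rule continuous_on_subset[OF U]) (use c k[of n] st in auto)
      have i1: "(\<lambda>r. q n c r * U r) integrable_on {?l..?h}" "(\<lambda>r. q n c r * (U r - U c)) integrable_on {?l..?h}"
        by (intro integrable_continuous_real continuous_intros qc cont)+
      have "integral {?l..?h} (\<lambda>r. q n c r * U r) - U c = integral {?l..?h} (\<lambda>r. q n c r * (U r - U c))"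
      proof -
        have "((\<lambda>r. q n c r * U r - q n c r * U c) has_integral integral {?l..?h} (\<lambda>r. q n c r * U r) - 1 * U c) {?l..?h}"
          by (intro has_integral_diff integrable_integral i1 has_integral_mult_left hq)
        then show ?thesis by (simp add: right_diff_distrib integral_unique)
      qed
      moreover have "norm (integral {?l..?h} (\<lambda>r. q n c r * (U r - U c))) \<le> integral {?l..?h} (\<lambda>r. q n c r * (e / 2))"
      proof (rule integral_norm_bound_integral[OF i1(2)])
        show "(\<lambda>r. q n c r * (e / 2)) integrable_on {?l..?h}"
          by (intro integrable_continuous_real continuous_intros qc)
        fix r assume "r \<in> {?l..?h}"
        then have "\<bar>r - c\<bar> < \<delta>" using small by auto
        from mult_left_mono[OF less_imp_le[OF \<delta>(2)[OF this]] qnn[of n c r]]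
        show "norm (q n c r * (U r - U c)) \<le> q n c r * (e / 2)"
          using qnn[of n c r] by (simp add: abs_mult)
      qed
      moreover have "integral {?l..?h} (\<lambda>r. q n c r * (e / 2)) = e / 2"
        using integral_unique[OF hq] by simp
      ultimately show "norm ((LINT r|time_measure T. q n c r * U r) - U c) < e"
        using conc[OF c, of n] e by simp
    qed
  qed
  have L1: "(\<lambda>n. LINT r|time_measure T. deriv (\<phi> n) r * U r) \<longlonglongrightarrow> U s - U t"
  proof -
    have "(LINT r|time_measure T. deriv (\<phi> n) r * U r) =
        (LINT r|time_measure T. q n s r * U r) - (LINT r|time_measure T. q n t r * U r)" for n
      using conc[of s n] conc[of t n] by (simp add: DERIV_imp_deriv[OF der] left_diff_distrib)
    then show ?thesis using tendsto_diff[OF lim[of s] lim[of t]] by simp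
  qed
  have [measurable]: "W \<in> borel_measurable (time_measure T)" using W by auto
  have "(\<lambda>n. LINT r|time_measure T. \<phi> n r * W r) \<longlonglongrightarrow> (LINT r|time_measure T. indicator {s..t} r * W r)"
  proof (rule integral_dominated_convergence[where w="\<lambda>r. norm (W r)"])
    show "(\<lambda>r. indicator {s..t} r * W r) \<in> borel_measurable (time_measure T)"
    proof (intro borel_measurable_times)
      show "indicator {s..t} \<in> borel_measurable (time_measure T)"
        by (intro measurable_restrict_space1 borel_measurable_indicator) simp
    qed simp
    show "(\<lambda>r. \<phi> n r * W r) \<in> borel_measurable (time_measure T)" for n
    proof (intro borel_measurable_times)
      have "continuous_on UNIV (\<phi> n)" by (auto intro!: continuous_at_imp_continuous_on DERIV_isCont[OF der])
      then have "continuous_on {0<..<T} (\<phi> n)" using continuous_on_subset by blast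
      then show "\<phi> n \<in> borel_measurable (time_measure T)"
        by (rule continuous_imp_measurable_on_sets_lebesgue) simp
    qed simp
    have "AE r in lebesgue. r \<noteq> s" "AE r in lebesgue. r \<noteq> t"
      by (auto intro: AE_completion AE_lborel_singleton)
    then have "AE r in time_measure T. r \<noteq> s" "AE r in time_measure T. r \<noteq> t"
      by (auto simp: AE_restrict_space_iff elim: eventually_mono)
    then show "AE r in time_measure T. (\<lambda>n. \<phi> n r * W r) \<longlonglongrightarrow> indicator {s..t} r * W r"
    proof eventually_elim
      case (elim r)
      have ev: "\<forall>\<^sub>F n in sequentially. \<bar>k n * (r - c)\<bar> \<ge> 1" if "c \<noteq> r" for c
      proof -
        have "\<forall>\<^sub>F n in sequentially. k n > 1 / \<bar>r - c\<bar>"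
          using kinf unfolding filterlim_at_top_dense by blast
        then show ?thesis
        proof eventually_elim
          case (elim n)
          have "\<bar>k n * (r - c)\<bar> = k n * \<bar>r - c\<bar>" using k(1)[of n] by (simp add: abs_mult)
          moreover have "k n * \<bar>r - c\<bar> \<ge> 1" using elim that by (simp add: field_simps)
          ultimately show ?case by linarith
        qed
      qed
      have "\<forall>\<^sub>F n in sequentially. \<phi> n r = indicator {s..t} r"
        using eventually_conj[OF ev[OF elim(1)[symmetric]] ev[OF elim(2)[symmetric]]]
      proof (rule eventually_mono)
        fix n assume n: "1 \<le> \<bar>k n * (r - s)\<bar> \<and> 1 \<le> \<bar>k n * (r - t)\<bar>"
        have sgn: "(k n * (r - c) \<ge> 1 \<longleftrightarrow> r > c) \<and> (k n * (r - c) \<le> -1 \<longleftrightarrow> r < c)" if "1 \<le> \<bar>k n * (r - c)\<bar>" for c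
        proof -
          have "k n * (r - c) > 0 \<longleftrightarrow> r > c" "k n * (r - c) < 0 \<longleftrightarrow> r < c"
            using k(1)[of n] by (simp_all add: zero_less_mult_iff mult_less_0_iff)
          then show ?thesis using that by linarith
        qed
        show "\<phi> n r = indicator {s..t} r"
          using sgn[OF conjunct1[OF n]] sgn[OF conjunct2[OF n]] st elim
          by (cases "r < s"; cases "r < t") (auto simp: \<phi>_def P(4,5) indicator_def)
      qed
      then have "\<forall>\<^sub>F n in sequentially. \<phi> n r * W r = indicator {s..t} r * W r" by eventually_elim simp
      then show ?case by (rule tendsto_eventually)
    qed
    show "AE r in time_measure T. norm (\<phi> n r * W r) \<le> norm (W r)" for n
    proof (rule AE_I2)
      fix r
      have "\<bar>\<phi> n r\<bar> \<le> 1"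
        using P(8,9)[of "k n * (r - s)"] P(8,9)[of "k n * (r - t)"] unfolding \<phi>_def by linarith
      then show "norm (\<phi> n r * W r) \<le> norm (W r)" by (simp add: abs_mult mult_left_le_one_le)
    qed
  qed (use W in auto)
  moreover have "(LINT r|time_measure T. indicator {s..t} r * W r) = integral {s..t} W"
  proof -
    have "(LINT r|time_measure T. indicator {s..t} r * W r) = (LINT r|lebesgue_on {s..t}. W r)"
      using st by (subst (1 2) integral_restrict_space)
        (auto intro!: Bochner_Integration.integral_cong simp: indicator_def)
    then show ?thesis using time_integrable(4)[OF W, of s t] st by simp
  qed
  ultimately have "(\<lambda>n. - (LINT r|time_measure T. \<phi> n r * W r)) \<longlonglongrightarrow> - integral {s..t} W"
    by (simp add: tendsto_minus)
  then have "(\<lambda>n. LINT r|time_measure T. deriv (\<phi> n) r * U r) \<longlonglongrightarrow> - integral {s..t} W"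
    using weak[OF test] by simp
  with L1 have "U s - U t = - integral {s..t} W" by (rule LIMSEQ_unique)
  then show ?thesis by simp
qed

context rectangle
begin

section \<open>Time derivatives in the scalar product of \<open>H\<close>\<close>

abbreviation ip :: "field \<Rightarrow> field \<Rightarrow> real" where "ip \<equiv> H_inner a b"
abbreviation Hs :: "field set" where "Hs \<equiv> H_space a b"

lemma H_norm_eq: "H_norm a b u = l2norm M u"
  unfolding H_norm_def H_inner_def l2norm_inner by simp

lemma Hs_L2: "u \<in> Hs \<Longrightarrow> u \<in> L2 M"
  by (simp add: H_space_def L2_space_eq)

lemma ip_bound: "f \<in> L2 M \<Longrightarrow> g \<in> L2 M \<Longrightarrow> \<bar>ip f g\<bar> \<le> l2norm M f * l2norm M g"
  unfolding H_inner_def by (rule L2_Cauchy_Schwarz)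

lemma ip_self: "ip f f = (l2norm M f)\<^sup>2"
  unfolding H_inner_def by (rule l2norm_inner)

lemma ip_diff_left: "f \<in> L2 M \<Longrightarrow> g \<in> L2 M \<Longrightarrow> h \<in> L2 M \<Longrightarrow> ip (\<lambda>x. f x - g x) h = ip f h - ip g h"
  unfolding H_inner_def by (simp add: inner_diff_left L2_inner_integrable)

lemma ip_diff_right: "f \<in> L2 M \<Longrightarrow> g \<in> L2 M \<Longrightarrow> h \<in> L2 M \<Longrightarrow> ip h (\<lambda>x. f x - g x) = ip h f - ip h g"
  unfolding H_inner_def by (simp add: inner_diff_right L2_inner_integrable)

lemma ip_add_right: "f \<in> L2 M \<Longrightarrow> g \<in> L2 M \<Longrightarrow> h \<in> L2 M \<Longrightarrow> ip h (\<lambda>x. f x + g x) = ip h f + ip h g"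
  unfolding H_inner_def by (simp add: inner_add_right L2_inner_integrable)

lemma ip_commute: "ip f g = ip g f"
  unfolding H_inner_def by (simp add: inner_commute)

lemma ip_scaleR_left: "ip (\<lambda>x. c *\<^sub>R f x) g = c * ip f g"
  unfolding H_inner_def by simp

lemma ip_scaleR_right: "ip f (\<lambda>x. c *\<^sub>R g x) = c * ip f g"
  unfolding H_inner_def by simp

lemma ip_cong_AE:
  assumes "AE x in M. f x = f' x" "f \<in> L2 M" "f' \<in> L2 M" "g \<in> L2 M"
  shows "ip f g = ip f' g"
  unfolding H_inner_def
proof (rule integral_cong_AE)
  show "AE x in M. f x \<bullet> g x = f' x \<bullet> g x" using assms(1) by eventually_elim simp
qed (intro borel_measurable_integrable L2_inner_integrable assms)+

lemma simple_into_L2: "simple_into T Hs s \<Longrightarrow> t \<in> {0<..<T} \<Longrightarrow> s t \<in> L2 M"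
  unfolding simple_into_def by (blast intro: Hs_L2)

lemma mult_le_half_squares: "x * y \<le> (x\<^sup>2 + y\<^sup>2) / 2" for x y :: real
  using sum_squares_bound[of x y] by simp

text \<open>Vector-valued integrals are read only through scalar products with a fixed g. For simple
  functions this commutation is a finite sum; the next lemmas pass to limits.\<close>

lemma simple_into_ip:
  assumes s: "simple_into T Hs s" and g: "g \<in> L2 M"
  shows "integrable (time_measure T) (\<lambda>t. ip (s t) g)"
    "(LINT t|time_measure T. ip (s t) g) = ip (simple_time_integral T s) g"
    "simple_time_integral T s \<in> L2 M"
proof -
  let ?S = "s ` {0<..<T}"
  let ?A = "\<lambda>h. {t \<in> {0<..<T}. s t = h}"
  have sf: "simple_function (time_measure T) s" and sub: "?S \<subseteq> Hs"
    using s by (auto simp: simple_into_def)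
  have fin: "finite ?S" using sf by (auto simp: simple_function_def)
  have L: "h \<in> L2 M" if "h \<in> ?S" for h using sub that Hs_L2 by blast
  have A: "?A h \<in> sets (time_measure T)" for h
    using simple_functionD(2)[OF sf, of "{h}"] by (simp add: vimage_def Int_def conj_commute)
  have meas: "measure (time_measure T) (?A h) = measure lebesgue (?A h)" for h
    by (rule measure_restrict_space) auto
  have fm: "emeasure (time_measure T) (?A h) < \<infinity>" for h
  proof -
    have "emeasure (time_measure T) (?A h) = emeasure lebesgue (?A h)"
      by (rule emeasure_restrict_space) auto
    also have "\<dots> \<le> emeasure lebesgue {0<..<T}" by (rule emeasure_mono) auto
    also have "\<dots> < \<infinity>" using emeasure_lborel_box_finite[of 0 T] by (simp add: less_top)
    finally show ?thesis .
  qed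
  have eq: "ip (s t) g = (\<Sum>h\<in>?S. ip h g * indicator (?A h) t)" if "t \<in> {0<..<T}" for t
  proof -
    have "(\<Sum>h\<in>?S. ip h g * indicator (?A h) t) = (\<Sum>h\<in>?S. if h = s t then ip h g else 0)"
      by (intro sum.cong refl) (use that in \<open>auto simp: indicator_def\<close>)
    also have "\<dots> = ip (s t) g" using fin that by (subst sum.delta) auto
    finally show ?thesis by simp
  qed
  have hb: "has_bochner_integral (time_measure T) (\<lambda>t. \<Sum>h\<in>?S. ip h g * indicator (?A h) t)
      (\<Sum>h\<in>?S. ip h g * measure (time_measure T) (?A h))"
    by (intro has_bochner_integral_sum has_bochner_integral_mult_right has_bochner_integral_real_indicator A fm)
  have hb': "has_bochner_integral (time_measure T) (\<lambda>t. ip (s t) g) (\<Sum>h\<in>?S. ip h g * measure lebesgue (?A h))"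
    using hb unfolding meas by (subst has_bochner_integral_cong[OF refl eq refl]) auto
  then show "integrable (time_measure T) (\<lambda>t. ip (s t) g)" by (rule integrable.intros)
  have sti: "simple_time_integral T s = (\<lambda>x. \<Sum>h\<in>?S. measure lebesgue (?A h) *\<^sub>R h x)"
    by (rule ext) (simp add: simple_time_integral_def)
  show "simple_time_integral T s \<in> L2 M"
    unfolding sti by (intro L2_sum L2_scaleR L)
  have "ip (simple_time_integral T s) g = (\<Sum>h\<in>?S. measure lebesgue (?A h) * ip h g)"
    unfolding sti H_inner_def inner_sum_left inner_scaleR_left
    by (subst Bochner_Integration.integral_sum) (auto intro!: L2_inner_integrable L g)
  with has_bochner_integral_integral_eq[OF hb']
  show "(LINT t|time_measure T. ip (s t) g) = ip (simple_time_integral T s) g"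
    by (simp add: mult.commute)
qed

lemma strongly_measurable_ip:
  assumes f: "strongly_measurable T Hs (H_norm a b) f" and g: "g \<in> L2 M"
  shows "(\<lambda>t. ip (f t) g) \<in> borel_measurable (time_measure T)"
proof -
  obtain s where s: "\<And>n::nat. simple_into T Hs (s n)"
    "AE t in time_measure T. (\<lambda>n. H_norm a b (\<lambda>x. f t x - s n t x)) \<longlonglongrightarrow> 0"
    using f by (auto simp: strongly_measurable_def)
  have fH: "AE t in time_measure T. f t \<in> Hs" using f by (simp add: strongly_measurable_def)
  have m: "(\<lambda>t. lim (\<lambda>n. ip (s n t) g)) \<in> borel_measurable (time_measure T)"
    by (intro borel_measurable_lim_metric borel_measurable_integrable simple_into_ip(1)[OF s(1) g])
  show ?thesis
  proof (rule time_measurable_AE[OF m])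
    show "AE t in time_measure T. lim (\<lambda>n. ip (s n t) g) = ip (f t) g"
      using s(2) fH AE_space
    proof eventually_elim
      case (elim t)
      have sL: "s n t \<in> L2 M" for n
        by (rule simple_into_L2[OF s(1)]) (use elim(3) in simp)
      note fL = Hs_L2[OF elim(2)]
      have "(\<lambda>n. ip (s n t) g - ip (f t) g) \<longlonglongrightarrow> 0"
      proof (rule Lim_null_comparison[OF always_eventually], rule allI)
        show "(\<lambda>n. l2norm M (\<lambda>x. f t x - s n t x) * l2norm M g) \<longlonglongrightarrow> 0"
          using tendsto_mult_right[OF elim(1), of "l2norm M g"] by (simp add: H_norm_eq)
        show "norm (ip (s n t) g - ip (f t) g) \<le> l2norm M (\<lambda>x. f t x - s n t x) * l2norm M g" for n
          using ip_bound[OF L2_diff[OF fL sL] g, of n] ip_diff_left[OF fL sL g, of n] by simp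
      qed
      then have "(\<lambda>n. ip (s n t) g) \<longlonglongrightarrow> ip (f t) g" by (simp add: LIM_zero_iff)
      then show ?case by (rule limI)
    qed
  qed
qed

text \<open>With |g| <= 1 the scalar errors are dominated by the vector errors without a constant
  inside the extended nonnegative integrals. \<open>has_time_integral_ip\<close> removes the
  normalisation by scaling.\<close>

lemma has_time_integral_ip_aux:
  assumes f: "has_time_integral T Hs (H_norm a b) f h" and g: "g \<in> L2 M" and g1: "l2norm M g \<le> 1"
  shows "integrable (time_measure T) (\<lambda>t. ip (f t) g) \<and> (LINT t|time_measure T. ip (f t) g) = ip h g"
proof -
  let ?T = "time_measure T"
  have sm: "strongly_measurable T Hs (H_norm a b) f" and hL: "h \<in> L2 M"
    using f Hs_L2 by (auto simp: has_time_integral_def)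
  obtain s where s: "\<And>n::nat. simple_into T Hs (s n)"
    "(\<lambda>n. \<integral>\<^sup>+t. ennreal (H_norm a b (\<lambda>x. f t x - s n t x)) \<partial>?T) \<longlonglongrightarrow> 0"
    "(\<lambda>n. H_norm a b (\<lambda>x. h x - simple_time_integral T (s n) x)) \<longlonglongrightarrow> 0"
    using f by (auto simp: has_time_integral_def)
  note S = simple_into_ip[OF s(1) g]
  have fm: "(\<lambda>t. ip (f t) g) \<in> borel_measurable ?T" by (rule strongly_measurable_ip[OF sm g])
  have fH: "AE t in ?T. f t \<in> Hs" using sm by (simp add: strongly_measurable_def)
  have le: "(\<integral>\<^sup>+t. ennreal (norm (ip (f t) g - ip (s n t) g)) \<partial>?T) \<le> (\<integral>\<^sup>+t. ennreal (H_norm a b (\<lambda>x. f t x - s n t x)) \<partial>?T)" for n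
  proof (rule nn_integral_mono_AE, use fH AE_space in eventually_elim)
    case (elim t)
    have sL: "s n t \<in> L2 M" by (rule simple_into_L2[OF s(1)]) (use elim(2) in simp)
    note fL = Hs_L2[OF elim(1)]
    have "\<bar>ip (f t) g - ip (s n t) g\<bar> \<le> l2norm M (\<lambda>x. f t x - s n t x) * l2norm M g"
      using ip_bound[OF L2_diff[OF fL sL] g] ip_diff_left[OF fL sL g] by simp
    also have "\<dots> \<le> l2norm M (\<lambda>x. f t x - s n t x)" using g1 by (simp add: mult_left_le)
    finally show ?case by (simp add: H_norm_eq ennreal_leI)
  qed
  have lim0: "(\<lambda>n. \<integral>\<^sup>+t. ennreal (norm (ip (f t) g - ip (s n t) g)) \<partial>?T) \<longlonglongrightarrow> 0"
    by (rule tendsto_sandwich[OF _ _ tendsto_const s(2)]) (use le in auto)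
  have int: "integrable ?T (\<lambda>t. ip (f t) g)"
  proof -
    have "\<forall>\<^sub>F n in sequentially. (\<integral>\<^sup>+t. ennreal (norm (ip (f t) g - ip (s n t) g)) \<partial>?T) < 1"
      by (rule order_tendstoD(2)[OF lim0]) simp
    then obtain n where "(\<integral>\<^sup>+t. ennreal (norm (ip (f t) g - ip (s n t) g)) \<partial>?T) < 1"
      by (auto simp: eventually_sequentially)
    then have "integrable ?T (\<lambda>t. ip (f t) g - ip (s n t) g)"
      using fm borel_measurable_integrable[OF S(1)]
      by (intro integrableI_bounded) (auto intro: less_trans)
    from Bochner_Integration.integrable_add[OF this S(1)[of n]] show ?thesis by simp
  qed
  have "(\<lambda>n. LINT t|?T. ip (s n t) g) \<longlonglongrightarrow> (LINT t|?T. ip (f t) g)"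
  proof -
    have "ennreal (norm ((LINT t|?T. ip (s n t) g) - (LINT t|?T. ip (f t) g))) \<le>
        (\<integral>\<^sup>+t. ennreal (norm (ip (f t) g - ip (s n t) g)) \<partial>?T)" for n
    proof -
      have "norm ((LINT t|?T. ip (s n t) g) - (LINT t|?T. ip (f t) g)) = norm (LINT t|?T. ip (f t) g - ip (s n t) g)"
        using int S(1)[of n] by (simp add: norm_minus_commute)
      then show ?thesis
        using integral_norm_bound_ennreal[OF Bochner_Integration.integrable_diff[OF int S(1)[of n]]] by simp
    qed
    then have "(\<lambda>n. ennreal (norm ((LINT t|?T. ip (s n t) g) - (LINT t|?T. ip (f t) g)))) \<longlonglongrightarrow> 0"
      by (intro tendsto_sandwich[OF _ _ tendsto_const lim0]) auto
    then have "(\<lambda>n. ennreal (norm ((LINT t|?T. ip (s n t) g) - (LINT t|?T. ip (f t) g)))) \<longlonglongrightarrow> ennreal 0" by simp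
    then have "(\<lambda>n. norm ((LINT t|?T. ip (s n t) g) - (LINT t|?T. ip (f t) g))) \<longlonglongrightarrow> 0"
      by (rule tendsto_ennrealD) auto
    then show ?thesis by (rule LIM_zero_cancel[OF tendsto_norm_zero_cancel])
  qed
  moreover have "(\<lambda>n. LINT t|?T. ip (s n t) g) \<longlonglongrightarrow> ip h g"
  proof -
    have "(\<lambda>n. ip (simple_time_integral T (s n)) g - ip h g) \<longlonglongrightarrow> 0"
    proof (rule Lim_null_comparison[OF always_eventually s(3)], rule allI)
      fix n
      have "\<bar>ip h g - ip (simple_time_integral T (s n)) g\<bar> \<le> l2norm M (\<lambda>x. h x - simple_time_integral T (s n) x) * l2norm M g"
        using ip_bound[OF L2_diff[OF hL S(3)[of n]] g] ip_diff_left[OF hL S(3)[of n] g] by simp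
      also have "\<dots> \<le> l2norm M (\<lambda>x. h x - simple_time_integral T (s n) x)" using g1 by (simp add: mult_left_le)
      finally show "norm (ip (simple_time_integral T (s n)) g - ip h g) \<le> H_norm a b (\<lambda>x. h x - simple_time_integral T (s n) x)"
        by (simp add: H_norm_eq abs_minus_commute)
    qed
    then show ?thesis unfolding S(2) by (simp add: LIM_zero_iff)
  qed
  ultimately show ?thesis using int LIMSEQ_unique by blast
qed

lemma has_time_integral_ip:
  assumes f: "has_time_integral T Hs (H_norm a b) f h" and g: "g \<in> L2 M"
  shows "integrable (time_measure T) (\<lambda>t. ip (f t) g)" "(LINT t|time_measure T. ip (f t) g) = ip h g"
proof -
  \<comment> \<open>The summand 1 covers g of norm zero.\<close>
  define c where "c = inverse (1 + l2norm M g)"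
  have c: "c > 0" unfolding c_def by (simp add: add_pos_nonneg)
  have "l2norm M (\<lambda>x. c *\<^sub>R g x) \<le> 1"
    unfolding l2norm_scaleR c_def by (simp add: add_pos_nonneg inverse_eq_divide divide_le_eq)
  from has_time_integral_ip_aux[OF f L2_scaleR[OF g] this]
  have "integrable (time_measure T) (\<lambda>t. c * ip (f t) g)" "(LINT t|time_measure T. c * ip (f t) g) = c * ip h g"
    by (simp_all add: ip_scaleR_right)
  then show "integrable (time_measure T) (\<lambda>t. ip (f t) g)" "(LINT t|time_measure T. ip (f t) g) = ip h g"
    using c by simp_all
qed

text \<open>\<open>w\<close> is a weak primitive of \<open>d\<close>.  The bound \<open>\<beta>\<close> is a parameter because the measurability of \<open>\<bar>d\<bar>\<close>
  would not pass to differences.\<close>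

definition path :: "real \<Rightarrow> (real \<Rightarrow> field) \<Rightarrow> (real \<Rightarrow> field) \<Rightarrow> (real \<Rightarrow> real) \<Rightarrow> bool"
  where "path T w d \<beta> \<longleftrightarrow> (\<forall>t\<in>{0<..<T}. w t \<in> L2 M) \<and> (AE t in time_measure T. d t \<in> L2 M) \<and>
    integrable (time_measure T) \<beta> \<and> (\<forall>t. \<beta> t \<ge> 0) \<and> (AE t in time_measure T. (l2norm M (d t))\<^sup>2 \<le> \<beta> t) \<and>
    (\<forall>g\<in>L2 M. integrable (time_measure T) (\<lambda>t. ip (d t) g)) \<and>
    (\<forall>g\<in>L2 M. \<forall>s t. 0 < s \<and> s < t \<and> t < T \<longrightarrow> ip (w t) g - ip (w s) g = integral {s..t} (\<lambda>r. ip (d r) g))"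

lemma pathD:
  assumes "path T w d \<beta>"
  shows "\<And>t. 0 < t \<Longrightarrow> t < T \<Longrightarrow> w t \<in> L2 M" "AE t in time_measure T. d t \<in> L2 M"
    "integrable (time_measure T) \<beta>" "\<And>t. \<beta> t \<ge> 0" "AE t in time_measure T. (l2norm M (d t))\<^sup>2 \<le> \<beta> t"
    "\<And>g. g \<in> L2 M \<Longrightarrow> integrable (time_measure T) (\<lambda>t. ip (d t) g)"
    "\<And>g s t. g \<in> L2 M \<Longrightarrow> 0 < s \<Longrightarrow> s < t \<Longrightarrow> t < T \<Longrightarrow> ip (w t) g - ip (w s) g = integral {s..t} (\<lambda>r. ip (d r) g)"
  using assms by (simp_all add: path_def)

lemma path_diff:
  assumes p: "path T w d \<beta>" and p': "path T w' d' \<beta>'"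
  shows "path T (\<lambda>t x. w t x - w' t x) (\<lambda>t x. d t x - d' t x) (\<lambda>t. 2 * \<beta> t + 2 * \<beta>' t)"
proof -
  note P = pathD[OF p] and P' = pathD[OF p']
  have ipd: "AE t in time_measure T. ip (\<lambda>x. d t x - d' t x) g = ip (d t) g - ip (d' t) g"
    if "g \<in> L2 M" for g :: field
    using P(2) P'(2) by eventually_elim (rule ip_diff_left[OF _ _ that])
  have meas: "(\<lambda>t. ip (\<lambda>x. d t x - d' t x) g) \<in> borel_measurable (time_measure T)" if g: "g \<in> L2 M" for g :: field
  proof (rule time_measurable_AE)
    show "(\<lambda>t. ip (d t) g - ip (d' t) g) \<in> borel_measurable (time_measure T)"
      using P(6)[OF g] P'(6)[OF g] by (intro borel_measurable_diff borel_measurable_integrable)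
    show "AE t in time_measure T. ip (d t) g - ip (d' t) g = ip (\<lambda>x. d t x - d' t x) g"
      using ipd[OF g] by eventually_elim simp
  qed
  have int: "integrable (time_measure T) (\<lambda>t. ip (\<lambda>x. d t x - d' t x) g)" if g: "g \<in> L2 M" for g :: field
    by (rule integrable_cong_AE_imp[OF Bochner_Integration.integrable_diff[OF P(6)[OF g] P'(6)[OF g]] meas[OF g]])
      (use ipd[OF g] in eventually_elim, simp)
  show ?thesis
    unfolding path_def
  proof (intro conjI ballI allI impI)
    show "AE t in time_measure T. (\<lambda>x. d t x - d' t x) \<in> L2 M"
      using P(2) P'(2) by eventually_elim auto
    show "integrable (time_measure T) (\<lambda>t. 2 * \<beta> t + 2 * \<beta>' t)" using P(3) P'(3) by simp
    show "AE t in time_measure T. (l2norm M (\<lambda>x. d t x - d' t x))\<^sup>2 \<le> 2 * \<beta> t + 2 * \<beta>' t"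
      using P(2,5) P'(2,5)
    proof eventually_elim
      case (elim t)
      have "(l2norm M (\<lambda>x. d t x - d' t x))\<^sup>2 \<le> (l2norm M (d t) + l2norm M (d' t))\<^sup>2"
        by (intro power_mono l2norm_triangle_diff elim) simp
      also have "\<dots> \<le> 2 * (l2norm M (d t))\<^sup>2 + 2 * (l2norm M (d' t))\<^sup>2"
        using sum_squares_bound[of "l2norm M (d t)" "l2norm M (d' t)"] by (simp add: power2_sum)
      finally show ?case using elim by linarith
    qed
    fix g :: field and s t assume g: "g \<in> L2 M" and st: "0 < s \<and> s < t \<and> t < T"
    have "integral {s..t} (\<lambda>r. ip (\<lambda>x. d r x - d' r x) g) = (LINT r|lebesgue_on {s..t}. ip (\<lambda>x. d r x - d' r x) g)"
      by (rule time_integrable(4)[OF int[OF g], symmetric]) (use st in auto)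
    also have "\<dots> = (LINT r|lebesgue_on {s..t}. ip (d r) g - ip (d' r) g)"
    proof (rule integral_cong_AE)
      show "AE r in lebesgue_on {s..t}. ip (\<lambda>x. d r x - d' r x) g = ip (d r) g - ip (d' r) g"
        by (rule time_AE[OF ipd[OF g]]) (use st in auto)
      show "(\<lambda>r. ip (\<lambda>x. d r x - d' r x) g) \<in> borel_measurable (lebesgue_on {s..t})"
        by (rule borel_measurable_integrable[OF time_integrable(3)[OF int[OF g]]]) (use st in auto)
      show "(\<lambda>r. ip (d r) g - ip (d' r) g) \<in> borel_measurable (lebesgue_on {s..t})"
        by (intro borel_measurable_diff borel_measurable_integrable time_integrable(3)[OF P(6)[OF g]]
            time_integrable(3)[OF P'(6)[OF g]]) (use st in auto)
    qed
    also have "\<dots> = integral {s..t} (\<lambda>r. ip (d r) g) - integral {s..t} (\<lambda>r. ip (d' r) g)"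
      using time_integrable(3,4)[OF P(6)[OF g], of s t] time_integrable(3,4)[OF P'(6)[OF g], of s t] st by simp
    also have "\<dots> = ip (\<lambda>x. w t x - w' t x) g - ip (\<lambda>x. w s x - w' s x) g"
      using P(7)[OF g, of s t] P'(7)[OF g, of s t] st P(1) P'(1)
      by (simp add: ip_diff_left g)
    finally show "ip (\<lambda>x. w t x - w' t x) g - ip (\<lambda>x. w s x - w' s x) g
        = integral {s..t} (\<lambda>r. ip (\<lambda>x. d r x - d' r x) g)" by simp
  qed (use P(1,4) P'(1,4) int in auto)
qed

text \<open>The primitive relation is tested with the increment w(t) - w(s) itself, so the square
  \<open>k\<^sup>2\<close> of its norm equals an integral of (d, g). Young's inequality with weight
  t - s leaves half of \<open>k\<^sup>2\<close> on the right, which is absorbed. Only the bound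
  \<open>\<beta>\<close> is integrated, never the norm of d.\<close>

lemma path_bound:
  assumes p: "path T w d \<beta>" and st: "0 < s" "s < t" "t < T"
  shows "(l2norm M (\<lambda>x. w t x - w s x))\<^sup>2 \<le> (t - s) * integral {s..t} \<beta>"
proof -
  note P = pathD[OF p]
  let ?g = "\<lambda>x. w t x - w s x"
  define k where "k = l2norm M ?g"
  have w: "w t \<in> L2 M" "w s \<in> L2 M" using P(1) st by auto
  have g: "?g \<in> L2 M" using w by auto
  have ic: "integrable (time_measure T) (\<lambda>r. ((t - s) * \<beta> r + k\<^sup>2 / (t - s)) / 2)"
  proof -
    have "integrable (time_measure T) (\<lambda>r. k\<^sup>2 / (t - s))"
      using emeasure_lborel_box_finite[of 0 T]
      by (intro finite_measure.integrable_const finite_measureI) (simp add: emeasure_restrict_space)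
    then show ?thesis using P(3) by simp
  qed
  have "k\<^sup>2 = ip (w t) ?g - ip (w s) ?g"
    unfolding k_def ip_self[symmetric] by (rule ip_diff_left[OF w g])
  also have "\<dots> = integral {s..t} (\<lambda>r. ip (d r) ?g)" by (rule P(7)[OF g st])
  also have "\<dots> \<le> integral {s..t} (\<lambda>r. ((t - s) * \<beta> r + k\<^sup>2 / (t - s)) / 2)"
  proof (rule time_integral_mono[OF P(6)[OF g] ic])
    show "AE r in time_measure T. ip (d r) ?g \<le> ((t - s) * \<beta> r + k\<^sup>2 / (t - s)) / 2"
      using P(2,5)
    proof eventually_elim
      case (elim r)
      have "ip (d r) ?g \<le> l2norm M (d r) * k"
        using ip_bound[OF elim(1) g] by (simp add: k_def)
      also have "\<dots> = (sqrt (t - s) * l2norm M (d r)) * (k / sqrt (t - s))" using st by simp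
      also have "\<dots> \<le> ((sqrt (t - s) * l2norm M (d r))\<^sup>2 + (k / sqrt (t - s))\<^sup>2) / 2"
        by (rule mult_le_half_squares)
      also have "\<dots> = ((t - s) * (l2norm M (d r))\<^sup>2 + k\<^sup>2 / (t - s)) / 2"
        using st by (simp add: power_mult_distrib power_divide)
      also have "\<dots> \<le> ((t - s) * \<beta> r + k\<^sup>2 / (t - s)) / 2"
        using elim(2) st by (intro divide_right_mono add_right_mono mult_left_mono) auto
      finally show ?case .
    qed
  qed (use st in auto)
  also have "\<dots> = ((t - s) * integral {s..t} \<beta> + k\<^sup>2) / 2"
  proof -
    have "((\<lambda>r. ((t - s) * \<beta> r + k\<^sup>2 / (t - s)) / 2) has_integral
        ((t - s) * integral {s..t} \<beta> + (t - s) *\<^sub>R (k\<^sup>2 / (t - s))) / 2) {s..t}"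
      by (intro has_integral_divide has_integral_add has_integral_mult_right integrable_integral
          time_integrable(2)[OF P(3)] has_integral_const_real[of "k\<^sup>2 / (t - s)" s t, unfolded content_real_if]
          has_integral_eq_rhs[OF has_integral_const_real]) (use st in auto)
    then have "((\<lambda>r. ((t - s) * \<beta> r + k\<^sup>2 / (t - s)) / 2) has_integral
        ((t - s) * integral {s..t} \<beta> + k\<^sup>2) / 2) {s..t}" using st by simp
    then show ?thesis by (rule integral_unique)
  qed
  finally show ?thesis unfolding k_def by simp
qed

section \<open>Uniqueness\<close>

text \<open>The difference of the energies at s and t is tested exactly with the fixed field w(t) +
  w(s). Replacing this field by 2 w(r) under the integral costs, by \<open>path_bound\<close>, at
  most 2 (t - s) times the integral of \<open>\<beta>\<close>. Over short intervals this error is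
  negligible after chaining, and an integral inequality for |w|^2 remains.\<close>

lemma path_energy_zero:
  assumes p: "path T w d \<beta>" and y: "continuous_on {0..T} (\<lambda>t. (l2norm M (w t))\<^sup>2)" and y0: "l2norm M (w 0) = 0"
    and C: "C \<ge> 0" and le: "AE r in time_measure T. ip (d r) (w r) \<le> C * (l2norm M (w r))\<^sup>2" and t: "0 < t" "t < T"
  shows "l2norm M (w t) = 0"
proof -
  note P = pathD[OF p]
  define y where "y t = (l2norm M (w t))\<^sup>2" for t
  have yc: "continuous_on {0..T} y" using y by (simp add: y_def [abs_def])
  have ysub: "continuous_on {s..t} y" if "0 \<le> s" "t \<le> T" for s t
    by (rule continuous_on_subset[OF yc]) (use that in auto)
  have yint: "integrable (time_measure T) y"
  proof -
    have "integrable (lebesgue_on {0..T}) y" by (rule continuous_imp_integrable_real[OF yc])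
    then have "y absolutely_integrable_on {0..T}" by (simp add: integrable_restrict_space set_integrable_def)
    then have "y absolutely_integrable_on {0<..<T}" by (rule set_integrable_subset) auto
    then show ?thesis by (simp add: integrable_restrict_space set_integrable_def)
  qed
  have step: "y t - y s \<le> 2 * C * integral {s..t} y + 2 * \<delta> * integral {s..t} \<beta>"
    if st: "0 < s" "s \<le> t" "t < T" "t - s \<le> \<delta>" for s t \<delta>
  proof (cases "s = t")
    case False
    then have st': "s < t" using st by simp
    let ?g = "\<lambda>x. w t x + w s x"
    define B where "B = integral {s..t} \<beta>"
    have w: "w t \<in> L2 M" "w s \<in> L2 M" using P(1) st st' by auto
    have g: "?g \<in> L2 M" using w by auto
    have B0: "B \<ge> 0" unfolding B_def
      by (rule Henstock_Kurzweil_Integration.integral_nonneg[OF time_integrable(2)[OF P(3)]]) (use st P(4) in auto)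
    have Bmono: "integral {l..h} \<beta> \<le> B" if "s \<le> l" "l \<le> h" "h \<le> t" for l h
      unfolding B_def
      by (rule integral_subset_le) (use that st P(4) in \<open>auto intro!: time_integrable(2)[OF P(3)]\<close>)
    have "y t - y s = ip (w t) ?g - ip (w s) ?g"
      using ip_add_right[OF w w(1)] ip_add_right[OF w w(2)] ip_commute[of "w s" "w t"]
      by (simp add: y_def ip_self)
    also have "\<dots> = integral {s..t} (\<lambda>r. ip (d r) ?g)" by (rule P(7)[OF g st(1) st' st(3)])
    also have "\<dots> = (LINT r|lebesgue_on {s..t}. ip (d r) ?g)"
      by (rule time_integrable(4)[OF P(6)[OF g], symmetric]) (use st in auto)
    also have "\<dots> \<le> (LINT r|lebesgue_on {s..t}. 2 * C * y r + (t - s) * \<beta> r + B)"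
    proof (rule integral_mono_AE)
      show "integrable (lebesgue_on {s..t}) (\<lambda>r. ip (d r) ?g)"
        by (rule time_integrable(3)[OF P(6)[OF g]]) (use st in auto)
      show "integrable (lebesgue_on {s..t}) (\<lambda>r. 2 * C * y r + (t - s) * \<beta> r + B)"
        by (intro Bochner_Integration.integrable_add integrable_mult_right time_integrable(3)[OF yint]
            time_integrable(3)[OF P(3)] continuous_imp_integrable_real continuous_on_const) (use st in auto)
      have "AE r in lebesgue_on {s..t}. r \<in> {s..t}" by (rule AE_I2) simp
      moreover have "AE r in lebesgue_on {s..t}. d r \<in> L2 M" "AE r in lebesgue_on {s..t}. (l2norm M (d r))\<^sup>2 \<le> \<beta> r"
        "AE r in lebesgue_on {s..t}. ip (d r) (w r) \<le> C * (l2norm M (w r))\<^sup>2"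
        by (rule time_AE[OF P(2)] time_AE[OF P(5)] time_AE[OF le]; use st in simp)+
      ultimately show "AE r in lebesgue_on {s..t}. ip (d r) ?g \<le> 2 * C * y r + (t - s) * \<beta> r + B"
      proof eventually_elim
        case (elim r)
        have r: "s \<le> r" "r \<le> t" using elim(1) by auto
        have wr: "w r \<in> L2 M" using P(1)[of r] r st by auto
        have k: "l2norm M (\<lambda>x. w t x - w r x) \<le> sqrt ((t - s) * B)" "l2norm M (\<lambda>x. w s x - w r x) \<le> sqrt ((t - s) * B)"
        proof -
          show "l2norm M (\<lambda>x. w t x - w r x) \<le> sqrt ((t - s) * B)"
          proof (cases "r = t")
            case False
            have "(l2norm M (\<lambda>x. w t x - w r x))\<^sup>2 \<le> (t - r) * integral {r..t} \<beta>"
              by (rule path_bound[OF p]) (use False r st in auto)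
            also have "\<dots> \<le> (t - s) * B"
              using r P(4) st by (intro mult_mono Bmono Henstock_Kurzweil_Integration.integral_nonneg time_integrable(2)[OF P(3)]) auto
            finally show ?thesis by (rule real_le_rsqrt)
          qed (use B0 st in \<open>simp add: l2norm_def\<close>)
          show "l2norm M (\<lambda>x. w s x - w r x) \<le> sqrt ((t - s) * B)"
          proof (cases "r = s")
            case False
            have "(l2norm M (\<lambda>x. w r x - w s x))\<^sup>2 \<le> (r - s) * integral {s..r} \<beta>"
              by (rule path_bound[OF p]) (use False r st in auto)
            also have "\<dots> \<le> (t - s) * B"
              using r P(4) st by (intro mult_mono Bmono Henstock_Kurzweil_Integration.integral_nonneg time_integrable(2)[OF P(3)]) auto
            finally show ?thesis unfolding l2norm_diff_commute[of M "w s"] by (rule real_le_rsqrt)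
          qed (use B0 st in \<open>simp add: l2norm_def\<close>)
        qed
        \<comment> \<open>The first term is the one that the hypothesis controls; the other two
          compare the endpoint values with the current value of the path.\<close>
        have "ip (d r) ?g = 2 * ip (d r) (w r) + ip (d r) (\<lambda>x. w t x - w r x) + ip (d r) (\<lambda>x. w s x - w r x)"
          by (simp add: ip_add_right ip_diff_right w wr elim(2))
        also have "\<dots> \<le> 2 * (C * y r) + l2norm M (d r) * sqrt ((t - s) * B) + l2norm M (d r) * sqrt ((t - s) * B)"
        proof -
          have "ip (d r) (\<lambda>x. w t x - w r x) \<le> l2norm M (d r) * sqrt ((t - s) * B)"
            using ip_bound[OF elim(2) L2_diff[OF w(1) wr]] mult_left_mono[OF k(1), of "l2norm M (d r)"] by simp
          moreover have "ip (d r) (\<lambda>x. w s x - w r x) \<le> l2norm M (d r) * sqrt ((t - s) * B)"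
            using ip_bound[OF elim(2) L2_diff[OF w(2) wr]] mult_left_mono[OF k(2), of "l2norm M (d r)"] by simp
          ultimately show ?thesis using elim(4) unfolding y_def by linarith
        qed
        also have "\<dots> = 2 * (C * y r) + 2 * ((sqrt (t - s) * l2norm M (d r)) * sqrt B)"
          by (simp add: real_sqrt_mult mult_ac)
        also have "\<dots> \<le> 2 * (C * y r) + ((t - s) * (l2norm M (d r))\<^sup>2 + B)"
          using sum_squares_bound[of "sqrt (t - s) * l2norm M (d r)" "sqrt B"] st B0
          by (simp add: power_mult_distrib)
        also have "\<dots> \<le> 2 * (C * y r) + ((t - s) * \<beta> r + B)"
          using elim(3) st by (intro add_left_mono add_right_mono mult_left_mono) auto
        finally show ?case by simp
      qed
    qed
    also have "\<dots> = 2 * C * integral {s..t} y + (t - s) * B + (t - s) * B"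
    proof -
      have "integrable (lebesgue_on {s..t}) (\<lambda>r. B)" by (intro continuous_imp_integrable_real continuous_on_const)
      moreover have "(LINT r|lebesgue_on {s..t}. B) = (t - s) * B" using st by (simp add: measure_restrict_space)
      ultimately show ?thesis
        using time_integrable(3,4)[OF yint, of s t] time_integrable(3,4)[OF P(3), of s t] st
        by (simp add: B_def)
    qed
    also have "\<dots> \<le> 2 * C * integral {s..t} y + 2 * \<delta> * B"
      using mult_right_mono[OF st(4) B0] by linarith
    finally show ?thesis by (simp add: B_def)
  qed (use st C in simp)
  have incr: "y t - y s \<le> 2 * C * integral {s..t} y" if st: "0 < s" "s \<le> t" "t < T" for s t
  proof (rule field_le_epsilon)
    fix e :: real assume e: "e > 0"
    define B where "B = integral {s..t} \<beta>"
    have B0: "B \<ge> 0" unfolding B_def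
      by (rule Henstock_Kurzweil_Integration.integral_nonneg[OF time_integrable(2)[OF P(3)]]) (use st P(4) in auto)
    \<comment> \<open>Chosen so that the accumulated error 2 \<open>\<delta>\<close> B is at most e;
      adding 1 keeps the denominator positive when B = 0.\<close>
    define \<delta> where "\<delta> = e / (2 * (B + 1))"
    have \<delta>: "\<delta> > 0" using e B0 by (simp add: \<delta>_def)
    have "y t - y s \<le> 2 * C * integral {s..t} y + 2 * \<delta> * integral {s..t} \<beta>"
    proof (rule interval_chain[OF _ _ \<delta> st])
      fix s r t assume "0 < s" "s \<le> r" "r \<le> t" "t < T"
      then show "2 * C * integral {s..r} y + 2 * \<delta> * integral {s..r} \<beta> + (2 * C * integral {r..t} y + 2 * \<delta> * integral {r..t} \<beta>) =
          2 * C * integral {s..t} y + 2 * \<delta> * integral {s..t} \<beta>"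
        using time_integral_combine[OF yint, of s r t, symmetric] time_integral_combine[OF P(3), of s r t, symmetric]
        by (simp add: algebra_simps)
    qed (use step in blast)
    also have "2 * \<delta> * integral {s..t} \<beta> \<le> e"
      using e B0 unfolding B_def[symmetric] \<delta>_def by (simp add: field_simps)
    finally show "y t - y s \<le> 2 * C * integral {s..t} y + e" by simp
  qed
  have G: "y t \<le> exp (2 * C * T) * y s" if s: "0 < s" "s < t" for s
  proof -
    have "y t \<le> exp (2 * C * (t - s)) * y s"
      by (rule Gronwall_interval[OF ysub]) (use s t C incr in auto)
    also have "\<dots> \<le> exp (2 * C * T) * y s"
      using s t C by (intro mult_right_mono) (auto simp: y_def intro!: mult_left_mono)
    finally show ?thesis .
  qed
  \<comment> \<open>The primitive relation is available for s > 0 only, so the initial value is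
    reached by letting s tend to 0.\<close>
  have "(y \<longlongrightarrow> y 0) (at 0 within {0..T})"
    using yc t by (simp add: continuous_on)
  then have "(y \<longlongrightarrow> y 0) (at_right 0)"
    using t by (simp add: at_within_Icc_at_right)
  then have "((\<lambda>s. exp (2 * C * T) * y s) \<longlongrightarrow> exp (2 * C * T) * y 0) (at_right 0)"
    by (intro tendsto_intros)
  moreover have "\<forall>\<^sub>F s in at_right 0. y t \<le> exp (2 * C * T) * y s"
    using eventually_at_right_less[of 0] eventually_at_right_real[OF t(1)] by eventually_elim (use G in auto)
  ultimately have "y t \<le> exp (2 * C * T) * y 0"
    by (intro tendsto_lowerbound[of _ _ "at_right 0"]) auto
  then show ?thesis using y0 by (simp add: y_def)
qed


section \<open>Continuity in \<open>V\<close>\<close>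

text \<open>This is ((x,x)) - ((y,y)) = ((x + y, x - y)) for x = u' - s and y = u - s. The base
  point s cancels in x - y, so every term pairs one point of the path with the increment, and the
  latter need be small in L2 only.\<close>

lemma V_inner_square_diff:
  assumes "u' \<in> H1" "u \<in> H1" "s \<in> H1"
  shows "V_inner a b (\<lambda>x. u' x - s x) (\<lambda>x. u' x - s x) - V_inner a b (\<lambda>x. u x - s x) (\<lambda>x. u x - s x)
    = V_inner a b u' (\<lambda>x. u' x - u x) + V_inner a b u (\<lambda>x. u' x - u x) - 2 * V_inner a b s (\<lambda>x. u' x - u x)"
  using V_inner_commute[of u' u] V_inner_commute[of s u] V_inner_commute[of s u']
  by (simp add: V_inner_diff_left V_inner_diff_right H1_diff(1) assms)

lemma Vn_diff_self:
  assumes "u \<in> H1"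
  shows "Vn (\<lambda>x. u x - u x) = 0"
proof -
  have "V_inner a b (\<lambda>x. u x - u x) (\<lambda>x. u x - u x) = 0"
    by (subst V_inner_diff_left[OF assms assms H1_diff(1)[OF assms assms]]) (rule diff_self)
  then show ?thesis unfolding V_norm_def by (simp only: real_sqrt_zero)
qed

text \<open>\<open>chain_estimate\<close> is applied on [r,s] and on [s,q] to the squared distance
  from w(s), which vanishes at s. Both ends are thereby compared with w(s), and the triangle
  inequality gives the factor 2.\<close>

lemma path_V_increment:
  assumes p: "path T w d \<beta>" and good: "AE t in time_measure T. t \<in> G"
    and \<alpha>2: "integrable (time_measure T) (\<lambda>t. (\<alpha> t)\<^sup>2)" and \<alpha>: "\<And>t. \<alpha> t \<ge> 0"
    and V: "\<And>t. t \<in> G \<Longrightarrow> w t \<in> V"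
    and bound: "\<And>t z. t \<in> G \<Longrightarrow> z \<in> V \<Longrightarrow> \<bar>V_inner a b (w t) z\<bar> \<le> \<alpha> t * l2norm M z"
    and rq: "r \<in> G" "q \<in> G" "0 < r" "r < q" "q < T"
  shows "Vn (\<lambda>x. w q x - w r x) \<le> 2 * sqrt (18 * integral {r..q} (\<lambda>t. (\<alpha> t)\<^sup>2) + integral {r..q} \<beta> / 2)"
proof -
  note P = pathD[OF p]
  have H: "w t \<in> H1" if "t \<in> G" for t by (rule V_H1[OF V[OF that]])
  obtain s where s: "s \<in> G" "r < s" "s < q" "(q - r) * (\<alpha> s)\<^sup>2 \<le> integral {r..q} (\<lambda>t. (\<alpha> t)\<^sup>2)"
    using exists_le_average[OF \<alpha>2 good, of r q] rq by auto
  \<comment> \<open>18 = 6 + 12: the 12 comes from the base point term, since (q - r)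
    \<open>(\<alpha> s)\<^sup>2\<close> is at most the integral of
    \<open>\<alpha>\<^sup>2\<close>.\<close>
  define X where "X = 18 * integral {r..q} (\<lambda>t. (\<alpha> t)\<^sup>2) + integral {r..q} \<beta> / 2"
  define E where "E t = (Vn (\<lambda>x. w t x - w s x))\<^sup>2" for t
  have step: "\<bar>E t' - E t\<bar> \<le> (\<alpha> t + \<alpha> t' + 2 * \<alpha> s) * sqrt ((t' - t) * integral {t..t'} \<beta>)"
    if t: "t \<in> G" "t' \<in> G" "0 < t" "t < t'" "t' < T" for t t'
  proof -
    let ?z = "\<lambda>x. w t' x - w t x"
    have z: "?z \<in> V" by (intro V_diff V t)
    have "E t' - E t = V_inner a b (w t') ?z + V_inner a b (w t) ?z - 2 * V_inner a b (w s) ?z"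
      unfolding E_def Vn_power2(2)[OF H1_diff(1)[OF H H], OF t(2) s(1), symmetric]
        Vn_power2(2)[OF H1_diff(1)[OF H H], OF t(1) s(1), symmetric]
      by (rule V_inner_square_diff[OF H[OF t(2)] H[OF t(1)] H[OF s(1)]])
    then have "\<bar>E t' - E t\<bar> \<le> (\<alpha> t + \<alpha> t' + 2 * \<alpha> s) * l2norm M ?z"
      using bound[OF t(1) z] bound[OF t(2) z] bound[OF s(1) z] unfolding distrib_right by linarith
    also have "\<dots> \<le> (\<alpha> t + \<alpha> t' + 2 * \<alpha> s) * sqrt ((t' - t) * integral {t..t'} \<beta>)"
      using path_bound[OF p t(3-5)] \<alpha>[of t] \<alpha>[of t'] \<alpha>[of s]
      by (intro mult_left_mono real_le_rsqrt) auto
    finally show ?thesis .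
  qed
  have sub: "integral {l..h} f \<le> integral {r..q} f"
    if "integrable (time_measure T) f" "\<And>t. f t \<ge> 0" "r \<le> l" "l \<le> h" "h \<le> q"
    for f :: "real \<Rightarrow> real" and l h
    by (rule integral_subset_le) (use that rq in \<open>auto intro!: time_integrable(2)[OF that(1)]\<close>)
  have Es: "E s = 0"
    unfolding E_def by (subst Vn_diff_self[OF H[OF s(1)]]) simp
  have Xle: "6 * integral {l..h} (\<lambda>t. (\<alpha> t)\<^sup>2) + 12 * (h - l) * (\<alpha> s)\<^sup>2 + integral {l..h} \<beta> / 2 \<le> X"
    if lh: "r \<le> l" "l \<le> h" "h \<le> q" for l h
  proof -
    have "12 * (h - l) * (\<alpha> s)\<^sup>2 \<le> 12 * ((q - r) * (\<alpha> s)\<^sup>2)"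
      unfolding mult.assoc[of 12] using lh by (intro mult_left_mono mult_right_mono) auto
    then show ?thesis
      using sub[OF \<alpha>2 _ lh] sub[OF P(3) P(4) lh] s(4) unfolding X_def by simp
  qed
  have "E r \<le> X"
    using chain_estimate[OF good rq(1) s(1) rq(3) s(2) _ \<alpha>2 \<alpha> \<alpha>[of s] P(3) P(4) step] s(3) rq(5) Es Xle[of r s] s(2)
    by simp
  moreover have "E q \<le> X"
    using chain_estimate[OF good s(1) rq(2) _ s(3) rq(5) \<alpha>2 \<alpha> \<alpha>[of s] P(3) P(4) step] s(2) rq(3) Es Xle[of s q] s(3)
    by simp
  ultimately have "Vn (\<lambda>x. w r x - w s x) \<le> sqrt X" "Vn (\<lambda>x. w q x - w s x) \<le> sqrt X"
    unfolding E_def by (auto intro: real_le_rsqrt)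
  then show ?thesis
    using Vn_triangle[OF H[OF rq(2)] H[OF s(1)] H[OF rq(1)]] Vn_diff_commute[OF H[OF s(1)] H[OF rq(1)]]
    unfolding X_def by linarith
qed

text \<open>The increments between times of \<open>G\<close> are controlled by those of the
  continuous function \<open>h\<close>, so \<open>w\<close> is uniformly continuous on
  \<open>G\<close> in the V norm. Any other time is a limit of times in \<open>G\<close>; along them
  \<open>w\<close> is Cauchy in V and converges in L2, so \<open>V_closed\<close> identifies the
  limit.\<close>

lemma V_continuity:
  assumes T: "T > 0" and p: "path T w d \<beta>" and good: "AE t in time_measure T. t \<in> G"
    and \<alpha>2: "integrable (time_measure T) (\<lambda>t. (\<alpha> t)\<^sup>2)" and \<alpha>: "\<And>t. \<alpha> t \<ge> 0"
    and V: "\<And>t. t \<in> G \<Longrightarrow> w t \<in> V"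
    and bound: "\<And>t z. t \<in> G \<Longrightarrow> z \<in> V \<Longrightarrow> \<bar>V_inner a b (w t) z\<bar> \<le> \<alpha> t * l2norm M z"
    and wL: "\<And>t. t \<in> {0..T} \<Longrightarrow> w t \<in> L2 M"
    and wc: "\<And>t. t \<in> {0..T} \<Longrightarrow> ((\<lambda>s. l2norm M (\<lambda>x. w s x - w t x)) \<longlongrightarrow> 0) (at t within {0..T})"
  shows "continuous_into T V Vn w"
proof -
  note P = pathD[OF p]
  have H: "w t \<in> H1" if "t \<in> G" for t by (rule V_H1[OF V[OF that]])
  define h where "h t = 18 * integral {0..t} (\<lambda>t. (\<alpha> t)\<^sup>2) + integral {0..t} \<beta> / 2" for t
  have hc: "continuous_on {0..T} h"
    unfolding h_def using T
    by (intro continuous_intros indefinite_time_integral_continuous[OF \<alpha>2] indefinite_time_integral_continuous[OF P(3)]) auto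
  have hdiff: "18 * integral {r..q} (\<lambda>t. (\<alpha> t)\<^sup>2) + integral {r..q} \<beta> / 2 = h q - h r" if "0 \<le> r" "r \<le> q" "q \<le> T" for r q
    using time_integral_combine[OF \<alpha>2, of 0 r q, symmetric] time_integral_combine[OF P(3), of 0 r q, symmetric] that
    by (simp add: h_def algebra_simps add_divide_distrib)
  have unif: "\<exists>\<eta>>0. \<forall>r\<in>G. \<forall>q\<in>G. 0 < r \<and> r < T \<and> 0 < q \<and> q < T \<and> \<bar>q - r\<bar> < \<eta> \<longrightarrow> Vn (\<lambda>x. w q x - w r x) < e" if e: "e > 0" for e
  proof -
    have "uniformly_continuous_on {0..T} h" by (rule compact_uniformly_continuous[OF hc]) simp
    then obtain \<eta> where \<eta>: "\<eta> > 0" "\<And>t t'. t \<in> {0..T} \<Longrightarrow> t' \<in> {0..T} \<Longrightarrow> dist t' t < \<eta> \<Longrightarrow> dist (h t') (h t) < (e / 2)\<^sup>2"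
      unfolding uniformly_continuous_on_def using e by (metis half_gt_zero zero_less_power)
    have lt: "Vn (\<lambda>x. w q x - w r x) < e" if "r \<in> G" "q \<in> G" "0 < r" "r < q" "q < T" "q - r < \<eta>" for r q
    proof -
      have "h q - h r < (e / 2)\<^sup>2" using \<eta>(2)[of r q] that by (simp add: dist_real_def)
      then have "sqrt (h q - h r) < e / 2" using e by (intro real_less_lsqrt) auto
      then show ?thesis
        using path_V_increment[OF p good \<alpha>2 \<alpha> V bound that(1-5)] hdiff[of r q] that by simp
    qed
    have "Vn (\<lambda>x. w q x - w r x) < e" if "r \<in> G" "q \<in> G" "0 < r" "r < T" "0 < q" "q < T" "\<bar>q - r\<bar> < \<eta>" for r q
    proof (cases r q rule: linorder_cases)
      case less
      then show ?thesis using that by (intro lt) auto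
    next
      case equal
      show ?thesis unfolding equal using e by (subst Vn_diff_self[OF H[OF that(2)]])
    next
      case greater
      have "Vn (\<lambda>x. w r x - w q x) < e" using that greater by (intro lt) auto
      then show ?thesis using Vn_diff_commute[OF H[OF that(1)] H[OF that(2)]] by simp
    qed
    with \<eta>(1) show ?thesis by blast
  qed
  have approx: "\<exists>r::nat \<Rightarrow> real. (\<forall>n. r n \<in> G \<and> 0 < r n \<and> r n < T) \<and> r \<longlonglongrightarrow> t" if t: "t \<in> {0..T}" for t
  proof -
    have "\<exists>x. x \<in> G \<and> 0 < x \<and> x < T \<and> \<bar>x - t\<bar> < inverse (real (Suc n))" for n
    proof -
      define c where "c = inverse (real (Suc n))"
      have inv: "c > 0" by (simp add: c_def)
      define l u where "l = max 0 (t - c)" and "u = min T (t + c)"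
      have lu: "0 \<le> l" "l < u" "u \<le> T" using t T inv unfolding l_def u_def by (auto simp: max_def min_def)
      \<comment> \<open>Only the existence of a point of \<open>G\<close> in the interval matters
        here; the averaging inequality is discarded.\<close>
      obtain x where "x \<in> G" "l < x" "x < u"
        using exists_le_average[OF P(3) good lu] by blast
      then show ?thesis unfolding c_def[symmetric] by (intro exI[of _ x]) (auto simp: l_def u_def)
    qed
    then have "\<exists>r. \<forall>n. r n \<in> G \<and> 0 < r n \<and> r n < T \<and> \<bar>r n - t\<bar> < inverse (real (Suc n))"
      by (intro choice allI)
    then obtain r where r: "\<And>n. r n \<in> G \<and> 0 < r n \<and> r n < T \<and> \<bar>r n - t\<bar> < inverse (real (Suc n))" by blast
    have "(\<lambda>n. r n - t) \<longlonglongrightarrow> 0"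
      by (rule Lim_null_comparison[OF always_eventually LIMSEQ_inverse_real_of_nat])
        (use r in \<open>auto intro: less_imp_le\<close>)
    then have "r \<longlonglongrightarrow> t" by (simp add: LIM_zero_iff)
    with r show ?thesis by blast
  qed
  have lim: "w t \<in> V \<and> (\<lambda>n. Vn (\<lambda>x. w (r n) x - w t x)) \<longlonglongrightarrow> 0"
    if t: "t \<in> {0..T}" and r: "\<And>n. r n \<in> G \<and> 0 < r n \<and> r n < T" "r \<longlonglongrightarrow> t" for t and r :: "nat \<Rightarrow> real"
  proof -
    have l2: "(\<lambda>n. l2norm M (\<lambda>x. w (r n) x - w t x)) \<longlonglongrightarrow> 0"
    proof (rule LIMSEQ_I)
      fix e :: real assume e: "e > 0"
      have "\<forall>\<^sub>F s in at t within {0..T}. l2norm M (\<lambda>x. w s x - w t x) < e"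
        by (rule order_tendstoD(2)[OF wc[OF t] e])
      then obtain \<delta> where \<delta>: "\<delta> > 0" "\<And>s. s \<in> {0..T} \<Longrightarrow> s \<noteq> t \<Longrightarrow> dist s t < \<delta> \<Longrightarrow> l2norm M (\<lambda>x. w s x - w t x) < e"
        unfolding eventually_at by blast
      have "\<forall>\<^sub>F n in sequentially. dist (r n) t < \<delta>" using r(2) \<delta>(1) by (simp add: tendsto_iff)
      then obtain N where N: "\<And>n. n \<ge> N \<Longrightarrow> dist (r n) t < \<delta>" by (auto simp: eventually_sequentially)
      have "l2norm M (\<lambda>x. w (r n) x - w t x) < e" if "n \<ge> N" for n
      proof (cases "r n = t")
        case False
        then show ?thesis using \<delta>(2)[of "r n"] N[OF that] r(1)[of n] by auto
      qed (use e in \<open>simp add: l2norm_def\<close>)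
      then show "\<exists>N. \<forall>n\<ge>N. norm (l2norm M (\<lambda>x. w (r n) x - w t x) - 0) < e" by auto
    qed
    have cau: "\<exists>N. \<forall>m\<ge>N. \<forall>n\<ge>N. Vn (\<lambda>x. w (r m) x - w (r n) x) < e" if e: "e > 0" for e
    proof -
      obtain \<eta> where \<eta>: "\<eta> > 0" "\<And>r q. r \<in> G \<Longrightarrow> q \<in> G \<Longrightarrow> 0 < r \<and> r < T \<and> 0 < q \<and> q < T \<and> \<bar>q - r\<bar> < \<eta> \<Longrightarrow> Vn (\<lambda>x. w q x - w r x) < e"
        using unif[OF e] by blast
      have "Cauchy r" using r(2) by (rule LIMSEQ_imp_Cauchy)
      then obtain N where "\<And>m n. m \<ge> N \<Longrightarrow> n \<ge> N \<Longrightarrow> dist (r m) (r n) < \<eta>"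
        using \<eta>(1) unfolding Cauchy_def by blast
      then show ?thesis using \<eta>(2) r(1) by (intro exI[of _ N]) (auto simp: dist_real_def)
    qed
    have VV: "w (r n) \<in> V" for n using V r(1) by blast
    show ?thesis using V_closed[OF VV wL[OF t] l2 cau] by blast
  qed
  have wV: "w t \<in> V" if "t \<in> {0..T}" for t
    using approx[OF that] lim[OF that] by blast
  have cont: "((\<lambda>s. Vn (\<lambda>x. w s x - w t x)) \<longlongrightarrow> 0) (at t within {0..T})" if t: "t \<in> {0..T}" for t
  proof (rule tendstoI)
    fix e :: real assume e: "e > 0"
    then have e3: "e / 3 > 0" by simp
    obtain \<eta> where \<eta>: "\<eta> > 0" "\<And>r q. r \<in> G \<Longrightarrow> q \<in> G \<Longrightarrow> 0 < r \<and> r < T \<and> 0 < q \<and> q < T \<and> \<bar>q - r\<bar> < \<eta> \<Longrightarrow> Vn (\<lambda>x. w q x - w r x) < e / 3"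
      using unif[OF e3] by blast
    have near: "\<exists>r\<in>G. 0 < r \<and> r < T \<and> \<bar>r - s\<bar> < \<eta> / 3 \<and> Vn (\<lambda>x. w r x - w s x) < e / 3" if s: "s \<in> {0..T}" for s
    proof -
      obtain r where r: "\<And>n::nat. r n \<in> G \<and> 0 < r n \<and> r n < T" "r \<longlonglongrightarrow> s" using approx[OF s] by blast
      have "\<forall>\<^sub>F n in sequentially. dist (r n) s < \<eta> / 3 \<and> Vn (\<lambda>x. w (r n) x - w s x) < e / 3"
        by (intro eventually_conj tendstoD[OF r(2)] order_tendstoD(2)[OF conjunct2[OF lim[OF s r]] e3])
          (use \<eta>(1) in simp)
      then obtain n where "dist (r n) s < \<eta> / 3" "Vn (\<lambda>x. w (r n) x - w s x) < e / 3"
        by (auto simp: eventually_sequentially)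
      then show ?thesis using r(1)[of n] by (auto simp: dist_real_def)
    qed
    have "Vn (\<lambda>x. w s x - w t x) < e" if s: "s \<in> {0..T}" "\<bar>s - t\<bar> < \<eta> / 3" for s
    proof -
      obtain r where r: "r \<in> G" "0 < r" "r < T" "\<bar>r - s\<bar> < \<eta> / 3" "Vn (\<lambda>x. w r x - w s x) < e / 3"
        using near[OF s(1)] by blast
      obtain q where q: "q \<in> G" "0 < q" "q < T" "\<bar>q - t\<bar> < \<eta> / 3" "Vn (\<lambda>x. w q x - w t x) < e / 3"
        using near[OF t] by blast
      have "Vn (\<lambda>x. w r x - w q x) < e / 3"
      proof (rule \<eta>(2)[OF q(1) r(1)])
        have "\<bar>r - q\<bar> < \<eta>" using r(4) q(4) s(2) by linarith
        then show "0 < q \<and> q < T \<and> 0 < r \<and> r < T \<and> \<bar>r - q\<bar> < \<eta>" using r q by simp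
      qed
      note Hs = V_H1[OF wV[OF s(1)]] H[OF r(1)] H[OF q(1)] V_H1[OF wV[OF t]]
      show ?thesis
        using Vn_triangle[OF Hs(1,2,4)] Vn_triangle[OF Hs(2,3,4)] Vn_diff_commute[OF Hs(1,2)] r(5) q(5)
          \<open>Vn (\<lambda>x. w r x - w q x) < e / 3\<close> by linarith
    qed
    moreover have "Vn (\<lambda>x. w s x - w t x) \<ge> 0" if "s \<in> {0..T}" for s
      by (intro Vn_nonneg H1_diff(1) V_H1 wV that t)
    ultimately show "\<forall>\<^sub>F s in at t within {0..T}. dist (Vn (\<lambda>x. w s x - w t x)) 0 < e"
      unfolding eventually_at using \<eta>(1) by (intro exI[of _ "\<eta> / 3"]) (auto simp: dist_real_def)
  qed
  show ?thesis using wV cont by (simp add: continuous_into_def)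
qed

section \<open>Solutions\<close>

text \<open>Pairing the H-valued distributional identity with a fixed g gives a scalar one for
  (u(t), g), where u may be replaced by \<open>w\<close>. Since (w(t), g) is continuous,
  \<open>weak_derivative_FTC\<close> applies for each g.\<close>

lemma weak_time_derivative_path:
  assumes u': "u' \<in> L2_time T Hs (H_norm a b)" and der: "has_time_derivative T Hs (H_norm a b) u u'"
    and w: "continuous_into T Hs (H_norm a b) w" and uw: "AE t in time_measure T. ae_eq R (u t) (w t)"
    and uL: "AE t in time_measure T. u t \<in> L2 M"
  shows "path T w u' (\<lambda>t. (l2norm M (u' t))\<^sup>2)"
proof -
  have sm: "strongly_measurable T Hs (H_norm a b) u'" and i2: "integrable (time_measure T) (\<lambda>t. (l2norm M (u' t))\<^sup>2)"
    using u' by (auto simp: L2_time_def H_norm_eq)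
  have u'L: "AE t in time_measure T. u' t \<in> L2 M"
    using sm unfolding strongly_measurable_def by (auto elim: eventually_mono intro: Hs_L2)
  have wL: "w t \<in> L2 M" if "t \<in> {0..T}" for t
    using w that Hs_L2 by (auto simp: continuous_into_def)
  have fin: "finite_measure (time_measure T)"
    using emeasure_lborel_box_finite[of 0 T]
    by (intro finite_measureI) (simp add: emeasure_restrict_space)
  have int: "integrable (time_measure T) (\<lambda>t. ip (u' t) g)" if g: "g \<in> L2 M" for g
  proof (rule Bochner_Integration.integrable_bound)
    show "integrable (time_measure T) (\<lambda>t. ((l2norm M (u' t))\<^sup>2 + (l2norm M g)\<^sup>2) / 2)"
      using Bochner_Integration.integrable_add[OF i2 finite_measure.integrable_const[OF fin, of "(l2norm M g)\<^sup>2"]]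
      by simp
    show "(\<lambda>t. ip (u' t) g) \<in> borel_measurable (time_measure T)" by (rule strongly_measurable_ip[OF sm g])
    show "AE t in time_measure T. norm (ip (u' t) g) \<le> norm (((l2norm M (u' t))\<^sup>2 + (l2norm M g)\<^sup>2) / 2)"
      using u'L
    proof eventually_elim
      case (elim t)
      then show ?case
        using ip_bound[OF elim g] mult_le_half_squares[of "l2norm M (u' t)" "l2norm M g"] by simp
    qed
  qed
  have ftc: "ip (w t) g - ip (w s) g = integral {s..t} (\<lambda>r. ip (u' r) g)"
    if g: "g \<in> L2 M" and st: "0 < s" "s < t" "t < T" for g s t
  proof (rule weak_derivative_FTC[OF _ int[OF g] _ st])
    show "continuous_on {0<..<T} (\<lambda>t. ip (w t) g)"
    proof (rule continuous_on_subset)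
      show "continuous_on {0..T} (\<lambda>t. ip (w t) g)"
        unfolding continuous_on
      proof
        fix t assume t: "t \<in> {0..T}"
        have "((\<lambda>s. l2norm M (\<lambda>x. w s x - w t x)) \<longlongrightarrow> 0) (at t within {0..T})"
          using w t by (simp add: continuous_into_def H_norm_eq)
        from tendsto_mult_right[OF this, of "l2norm M g"]
        have 0: "((\<lambda>s. l2norm M (\<lambda>x. w s x - w t x) * l2norm M g) \<longlongrightarrow> 0) (at t within {0..T})" by simp
        have "\<forall>\<^sub>F s in at t within {0..T}. s \<in> {0..T}" by (simp add: eventually_at_filter)
        then have "\<forall>\<^sub>F s in at t within {0..T}. norm (ip (w s) g - ip (w t) g) \<le> l2norm M (\<lambda>x. w s x - w t x) * l2norm M g"
        proof eventually_elim
          case (elim s)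
          show ?case
            using ip_bound[OF L2_diff[OF wL[OF elim] wL[OF t]] g] ip_diff_left[OF wL[OF elim] wL[OF t] g] by simp
        qed
        from Lim_null_comparison[OF this 0]
        show "((\<lambda>s. ip (w s) g) \<longlongrightarrow> ip (w t) g) (at t within {0..T})" by (simp add: LIM_zero_iff)
      qed
    qed auto
    fix \<phi> assume "test_fun {0<..<T} \<phi>"
    then obtain h where h: "has_time_integral T Hs (H_norm a b) (\<lambda>t x. deriv \<phi> t *\<^sub>R u t x) h"
      "has_time_integral T Hs (H_norm a b) (\<lambda>t x. \<phi> t *\<^sub>R u' t x) (\<lambda>x. - h x)"
      using der unfolding has_time_derivative_def by blast
    note I = has_time_integral_ip[OF h(1) g, unfolded ip_scaleR_left] has_time_integral_ip[OF h(2) g, unfolded ip_scaleR_left]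
    have neg: "ip (\<lambda>x. - h x) g = - ip h g"
      using ip_scaleR_left[of "-1" h g] by simp
    have ae: "AE t in time_measure T. deriv \<phi> t * ip (u t) g = deriv \<phi> t * ip (w t) g"
      using uL uw AE_space
    proof eventually_elim
      case (elim t)
      have "ip (u t) g = ip (w t) g"
        by (rule ip_cong_AE[OF _ elim(1) wL g]) (use elim in \<open>auto simp: ae_eq_def\<close>)
      then show ?case by simp
    qed
    have "(LINT t|time_measure T. deriv \<phi> t * ip (w t) g) = (LINT t|time_measure T. deriv \<phi> t * ip (u t) g)"
      by (rule integral_cong_AE[OF time_measurable_AE[OF borel_measurable_integrable[OF I(1)] ae] borel_measurable_integrable[OF I(1)]])
        (use ae in eventually_elim, simp only:)
    then show "(LINT t|time_measure T. deriv \<phi> t * ip (w t) g) = - (LINT t|time_measure T. \<phi> t * ip (u' t) g)"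
      using I(2,4) neg by simp
  qed
  show ?thesis
    unfolding path_def using wL u'L i2 int ftc by auto
qed

lemma NS_solution_facts:
  assumes "NS_solution a b T \<nu> F u0 u"
  obtains u' w C where
    "AE t in time_measure T. u t \<in> V \<and> Vn (u t) \<le> C \<and> u t \<in> DA_space a b"
    "integrable (time_measure T) (\<lambda>t. (DA_norm a b (u t))\<^sup>2)"
    "AE t in time_measure T. \<forall>v\<in>V. ip (u' t) v + \<nu> * V_inner a b (u t) v + b_form a b (u t) (u t) v = ip (F t) v"
    "continuous_into T Hs (H_norm a b) w" "AE t in time_measure T. ae_eq R (u t) (w t)" "ae_eq R (w 0) u0"
    "path T w u' (\<lambda>t. (l2norm M (u' t))\<^sup>2)"
proof -
  have DA: "AE t in time_measure T. u t \<in> DA_space a b" and i: "integrable (time_measure T) (\<lambda>t. (DA_norm a b (u t))\<^sup>2)"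
    using assms by (auto simp: NS_solution_def L2_time_def strongly_measurable_def)
  obtain C where VC: "AE t in time_measure T. u t \<in> V" "AE t in time_measure T. Vn (u t) \<le> C"
    using assms by (auto simp: NS_solution_def Linf_time_def strongly_measurable_def)
  obtain u' where u': "u' \<in> L2_time T Hs (H_norm a b)" "has_time_derivative T Hs (H_norm a b) u u'"
    "AE t in time_measure T. \<forall>v\<in>V. ip (u' t) v + \<nu> * V_inner a b (u t) v + b_form a b (u t) (u t) v = ip (F t) v"
    using assms unfolding NS_solution_def A_op_def B_op_def by blast
  obtain w where w: "continuous_into T Hs (H_norm a b) w" "AE t in time_measure T. ae_eq R (u t) (w t)" "ae_eq R (w 0) u0"
    using assms unfolding NS_solution_def initial_value_def by blast
  have uL: "AE t in time_measure T. u t \<in> L2 M"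
    using VC(1) by eventually_elim (rule V_L2)
  have "AE t in time_measure T. u t \<in> V \<and> Vn (u t) \<le> C \<and> u t \<in> DA_space a b"
    using DA VC by eventually_elim simp
  then show ?thesis
    by (rule that[OF _ i u'(3) w weak_time_derivative_path[OF u'(1,2) w(1,2) uL]])
qed

lemma continuous_into_L2:
  assumes "continuous_into T Hs (H_norm a b) w" "t \<in> {0..T}"
  shows "w t \<in> L2 M" "((\<lambda>s. l2norm M (\<lambda>x. w s x - w t x)) \<longlongrightarrow> 0) (at t within {0..T})"
  using assms Hs_L2 by (auto simp: continuous_into_def H_norm_eq)

lemma NS_solution_V_continuous:
  assumes T: "T > 0" and u: "NS_solution a b T \<nu> F u0 u"
  shows "\<exists>w. continuous_into T V Vn w \<and> (AE t in time_measure T. ae_eq R (u t) (w t))"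
proof (rule NS_solution_facts[OF u])
  fix u' w C
  assume A: "AE t in time_measure T. u t \<in> V \<and> Vn (u t) \<le> C \<and> u t \<in> DA_space a b"
    and i: "integrable (time_measure T) (\<lambda>t. (DA_norm a b (u t))\<^sup>2)"
    and w: "continuous_into T Hs (H_norm a b) w" "AE t in time_measure T. ae_eq R (u t) (w t)"
    and p: "path T w u' (\<lambda>t. (l2norm M (u' t))\<^sup>2)"
  note wL = continuous_into_L2[OF w(1)]
  define G where "G = {t \<in> {0..T}. u t \<in> V \<and> u t \<in> DA_space a b \<and> ae_eq R (u t) (w t)}"
  define \<alpha> where "\<alpha> t = 4 * DA_norm a b (u t)" for t
  have good: "AE t in time_measure T. t \<in> G"
    using A w(2) AE_space by eventually_elim (auto simp: G_def)
  have ae: "AE x in M. u t x = w t x" if "t \<in> G" for t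
    using that by (auto simp: G_def ae_eq_def)
  have wV: "w t \<in> V" if "t \<in> G" for t
    by (rule V_cong_AE[OF _ ae[OF that]]) (use that wL(1) in \<open>auto simp: G_def\<close>)
  have "continuous_into T V Vn w"
  proof (rule V_continuity[OF T p good])
    \<comment> \<open>The weight is taken as an absolute value so that it is nonnegative at every
      time, as \<open>V_continuity\<close> requires.\<close>
    show "integrable (time_measure T) (\<lambda>t. (\<bar>\<alpha> t\<bar>)\<^sup>2)" using i by (simp add: \<alpha>_def power_mult_distrib)
    fix t z assume t: "t \<in> G" and z: "z \<in> V"
    have uV: "u t \<in> V" "u t \<in> DA_space a b" using t by (auto simp: G_def)
    have "V_inner a b (w t) z = V_inner a b (u t) z"
      unfolding V_inner_eq[OF V_H1[OF wV[OF t]] V_H1[OF z]] V_inner_eq[OF V_H1[OF uV(1)] V_H1[OF z]]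
    proof (intro sum.cong refl)
      fix i :: plane assume i: "i \<in> Basis"
      note L = V_wd_L2[OF wV[OF t] i] V_wd_L2[OF uV(1) i] V_wd_L2[OF z i]
      have wt: "w t \<in> L2 M" by (rule V_L2[OF wV[OF t]])
      show "(LINT x|M. D i (w t) x \<bullet> D i z x) = (LINT x|M. D i (u t) x \<bullet> D i z x)"
        by (rule integral_cong_AE[OF borel_measurable_integrable[OF L2_inner_integrable[OF L(1,3)]]
            borel_measurable_integrable[OF L2_inner_integrable[OF L(2,3)]]],
            use H1_cong_AE(2)[OF V_H1[OF uV(1)] ae[OF t] wt i] in eventually_elim, simp)
    qed
    then show "\<bar>V_inner a b (w t) z\<bar> \<le> \<bar>\<alpha> t\<bar> * l2norm M z"
      using DA_V_inner_bound[OF uV z] mult_right_mono[OF abs_ge_self[of "\<alpha> t"] l2norm_nonneg[of M z]]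
      by (simp add: \<alpha>_def)
  qed (use wV wL in auto)
  with w(2) show ?thesis by blast
qed

text \<open>Viscosity contributes - \<open>\<nu>\<close> q^2, and the nonlinear term at most 2
  \<open>KL\<close> C p (p + q). Young's inequality absorbs the mixed term in p q into the viscous
  one, which leaves \<open>(KL * C)\<^sup>2 / \<nu>\<close> in front of p^2.\<close>

lemma NS_difference_estimate:
  assumes \<nu>: "\<nu> > 0" and u: "u \<in> V" "Vn u \<le> C" and v: "v \<in> V"
    and u': "u' \<in> L2 M" and v': "v' \<in> L2 M"
    and eq: "\<And>z. z \<in> V \<Longrightarrow> ip u' z + \<nu> * V_inner a b u z + b_form a b u u z = ip f z"
      "\<And>z. z \<in> V \<Longrightarrow> ip v' z + \<nu> * V_inner a b v z + b_form a b v v z = ip f z"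
  shows "ip (\<lambda>x. u' x - v' x) (\<lambda>x. u x - v x) \<le> (2 * KL * C + (KL * C)\<^sup>2 / \<nu>) * (l2norm M (\<lambda>x. u x - v x))\<^sup>2"
proof -
  let ?z = "\<lambda>x. u x - v x"
  define p q where "p = l2norm M ?z" and "q = Vn ?z"
  have z: "?z \<in> V" by (rule V_diff[OF u(1) v])
  have C0: "C \<ge> 0" using Vn_nonneg[OF V_H1[OF u(1)]] u(2) by linarith
  have pq: "p \<ge> 0" "q \<ge> 0" by (auto simp: p_def q_def Vn_nonneg[OF V_H1[OF z]])
  have Vz: "V_inner a b u ?z - V_inner a b v ?z = q\<^sup>2"
    unfolding q_def Vn_power2(2)[OF V_H1[OF z], symmetric]
    by (rule V_inner_diff_left[OF V_H1[OF u(1)] V_H1[OF v] V_H1[OF z], symmetric])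
  have "ip (\<lambda>x. u' x - v' x) ?z = ip u' ?z - ip v' ?z"
    by (rule ip_diff_left[OF u' v' V_L2[OF z]])
  also have "\<dots> = - \<nu> * q\<^sup>2 - (b_form a b u u ?z - b_form a b v v ?z)"
    unfolding Vz[symmetric] using eq(1)[OF z] eq(2)[OF z] by (simp add: algebra_simps)
  also have "\<dots> \<le> - \<nu> * q\<^sup>2 + 2 * KL * p * (p + q) * C"
  proof -
    have "2 * KL * p * (p + q) * Vn u \<le> 2 * KL * p * (p + q) * C"
      using u(2) pq KL_pos by (intro mult_left_mono) auto
    then show ?thesis using b_form_difference[OF u(1) v] unfolding p_def q_def by linarith
  qed
  \<comment> \<open>The mixed term is split with weights sqrt(\<open>\<nu>\<close>) and 1 /
    sqrt(\<open>\<nu>\<close>), so that Young's inequality returns exactly \<open>\<nu>\<close>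
    q^2.\<close>
  also have "\<dots> = - \<nu> * q\<^sup>2 + 2 * ((sqrt \<nu> * q) * (KL * C * p / sqrt \<nu>)) + 2 * KL * C * p\<^sup>2"
    using \<nu> by (simp add: algebra_simps power2_eq_square)
  also have "\<dots> \<le> - \<nu> * q\<^sup>2 + ((sqrt \<nu> * q)\<^sup>2 + (KL * C * p / sqrt \<nu>)\<^sup>2) + 2 * KL * C * p\<^sup>2"
  proof -
    have "2 * (x * y) \<le> x\<^sup>2 + y\<^sup>2" for x y :: real using sum_squares_bound[of x y] by (simp only: mult.assoc)
    then show ?thesis by (intro add_right_mono add_left_mono)
  qed
  also have "\<dots> = (2 * KL * C + (KL * C)\<^sup>2 / \<nu>) * p\<^sup>2"
    using \<nu> by (simp add: power_mult_distrib power_divide algebra_simps)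
  finally show ?thesis by (simp add: p_def)
qed

lemma NS_solution_unique:
  assumes T: "T > 0" and \<nu>: "\<nu> > 0" and u: "NS_solution a b T \<nu> F u0 u" and v: "NS_solution a b T \<nu> F u0 v"
  shows "AE t in time_measure T. ae_eq R (u t) (v t)"
proof (rule NS_solution_facts[OF u], rule NS_solution_facts[OF v])
  fix u' w C v' y C'
  assume Au: "AE t in time_measure T. u t \<in> V \<and> Vn (u t) \<le> C \<and> u t \<in> DA_space a b"
    and eu: "AE t in time_measure T. \<forall>z\<in>V. ip (u' t) z + \<nu> * V_inner a b (u t) z + b_form a b (u t) (u t) z = ip (F t) z"
    and w: "continuous_into T Hs (H_norm a b) w" "AE t in time_measure T. ae_eq R (u t) (w t)" "ae_eq R (w 0) u0"
    and pu: "path T w u' (\<lambda>t. (l2norm M (u' t))\<^sup>2)"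
    and Av: "AE t in time_measure T. v t \<in> V \<and> Vn (v t) \<le> C' \<and> v t \<in> DA_space a b"
    and ev: "AE t in time_measure T. \<forall>z\<in>V. ip (v' t) z + \<nu> * V_inner a b (v t) z + b_form a b (v t) (v t) z = ip (F t) z"
    and y: "continuous_into T Hs (H_norm a b) y" "AE t in time_measure T. ae_eq R (v t) (y t)" "ae_eq R (y 0) u0"
    and pv: "path T y v' (\<lambda>t. (l2norm M (v' t))\<^sup>2)"
  note wL = continuous_into_L2[OF w(1)] and yL = continuous_into_L2[OF y(1)]
  note p = path_diff[OF pu pv]
  \<comment> \<open>The Gronwall constant must be nonnegative. The absolute value ensures this
    without exhibiting a time at which C bounds a norm.\<close>
  define K where "K = \<bar>2 * KL * C + (KL * C)\<^sup>2 / \<nu>\<bar>"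
  let ?z = "\<lambda>t x. w t x - y t x"
  have cont: "continuous_on {0..T} (\<lambda>t. (l2norm M (?z t))\<^sup>2)"
    unfolding continuous_on
  proof
    fix t assume t: "t \<in> {0..T}"
    have 0: "((\<lambda>s. l2norm M (\<lambda>x. w s x - w t x) + l2norm M (\<lambda>x. y s x - y t x)) \<longlongrightarrow> 0) (at t within {0..T})"
      using tendsto_add[OF wL(2)[OF t] yL(2)[OF t]] by simp
    have "\<forall>\<^sub>F s in at t within {0..T}. s \<in> {0..T}" by (simp add: eventually_at_filter)
    then have "\<forall>\<^sub>F s in at t within {0..T}. norm (l2norm M (?z s) - l2norm M (?z t)) \<le>
        l2norm M (\<lambda>x. w s x - w t x) + l2norm M (\<lambda>x. y s x - y t x)"
    proof eventually_elim
      case (elim s)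
      note L = wL(1)[OF elim] wL(1)[OF t] yL(1)[OF elim] yL(1)[OF t]
      have "\<bar>l2norm M (?z s) - l2norm M (?z t)\<bar> \<le> l2norm M (\<lambda>x. ?z s x - ?z t x)"
        by (intro l2norm_bounded_diff L2_diff L)
      also have "(\<lambda>x. ?z s x - ?z t x) = (\<lambda>x. (w s x - w t x) - (y s x - y t x))" by (auto simp: algebra_simps)
      also have "l2norm M \<dots> \<le> l2norm M (\<lambda>x. w s x - w t x) + l2norm M (\<lambda>x. y s x - y t x)"
        by (intro l2norm_triangle_diff L2_diff L)
      finally show ?case by simp
    qed
    from Lim_null_comparison[OF this 0]
    have "((\<lambda>s. l2norm M (?z s)) \<longlongrightarrow> l2norm M (?z t)) (at t within {0..T})" by (simp add: LIM_zero_iff)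
    then show "((\<lambda>s. (l2norm M (?z s))\<^sup>2) \<longlongrightarrow> (l2norm M (?z t))\<^sup>2) (at t within {0..T})"
      by (rule tendsto_power)
  qed
  have zero: "l2norm M (?z 0) = 0"
  proof -
    have "AE x in M. ?z 0 x = 0"
      using w(3) y(3) unfolding ae_eq_def by eventually_elim simp
    then have "l2norm M (?z 0) = l2norm M (\<lambda>x. 0 :: plane)"
      by (rule l2norm_cong_AE) (use wL(1) yL(1) T in \<open>auto intro!: L2_measurable L2_diff\<close>)
    then show ?thesis by (simp add: l2norm_def)
  qed
  have est: "AE t in time_measure T. ip (\<lambda>x. u' t x - v' t x) (?z t) \<le> K * (l2norm M (?z t))\<^sup>2"
    using Au eu Av ev w(2) y(2) pathD(2)[OF pu] pathD(2)[OF pv] AE_space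
  proof eventually_elim
    case (elim t)
    have t: "t \<in> {0..T}" using elim(9) by auto
    have ae: "AE x in M. u t x - v t x = ?z t x"
      using elim(5,6) unfolding ae_eq_def by eventually_elim simp
    have L: "(\<lambda>x. u t x - v t x) \<in> L2 M" "?z t \<in> L2 M" "(\<lambda>x. u' t x - v' t x) \<in> L2 M"
      using elim wL(1)[OF t] yL(1)[OF t] by (auto intro: V_L2)
    \<comment> \<open>The equation holds for u and v, the path relation for their continuous
      representatives. The test field is exchanged here, and its norm is exchanged back at the
      end.\<close>
    have "ip (\<lambda>x. u' t x - v' t x) (?z t) = ip (\<lambda>x. u' t x - v' t x) (\<lambda>x. u t x - v t x)"
      using ip_cong_AE[OF ae L] ip_commute by metis
    also have "\<dots> \<le> (2 * KL * C + (KL * C)\<^sup>2 / \<nu>) * (l2norm M (\<lambda>x. u t x - v t x))\<^sup>2"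
      by (rule NS_difference_estimate[OF \<nu>, where f="F t"]) (use elim in auto)
    also have "\<dots> \<le> K * (l2norm M (\<lambda>x. u t x - v t x))\<^sup>2"
      unfolding K_def by (intro mult_right_mono) auto
    also have "l2norm M (\<lambda>x. u t x - v t x) = l2norm M (?z t)"
      by (rule l2norm_cong_AE[OF ae]) (intro L2_measurable L)+
    finally show ?case .
  qed
  have z0: "l2norm M (?z t) = 0" if "0 < t" "t < T" for t
    by (rule path_energy_zero[OF p cont zero _ est that]) (simp add: K_def)
  show "AE t in time_measure T. ae_eq R (u t) (v t)"
    using w(2) y(2) AE_space
  proof eventually_elim
    case (elim t)
    then have t: "0 < t" "t < T" by auto
    have L: "?z t \<in> L2 M" using wL(1)[of t] yL(1)[of t] t by auto
    have "(LINT x|M. (norm (?z t x))\<^sup>2) = 0"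
      using z0[OF t] l2norm_power2[of M "?z t"] by simp
    then have "AE x in M. (norm (?z t x))\<^sup>2 = 0"
      using integral_nonneg_eq_0_iff_AE[OF L2_integrable[OF L]] by simp
    then show ?case
      using elim(1,2) unfolding ae_eq_def by eventually_elim simp
  qed
qed

end

theorem theorem2p12p2:
  fixes a b T \<nu> :: real
    and F :: "real \<Rightarrow> real \<times> real \<Rightarrow> real \<times> real"
    and u0 :: "real \<times> real \<Rightarrow> real \<times> real"
  assumes "a > 0" and "b > 0" and "T > 0" and "\<nu> > 0"
    and "F \<in> L2_time T (H_space a b) (H_norm a b)"
    and "u0 \<in> V_space a b"
  shows "(\<forall>u v. NS_solution a b T \<nu> F u0 u \<and> NS_solution a b T \<nu> F u0 v \<longrightarrow>
            (AE t in lebesgue_on {0<..<T}. ae_eq (rect a b) (u t) (v t))) \<and>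
         (\<forall>u. NS_solution a b T \<nu> F u0 u \<longrightarrow>
            (\<exists>w. continuous_into T (V_space a b) (V_norm a b) w \<and>
              (AE t in lebesgue_on {0<..<T}. ae_eq (rect a b) (u t) (w t))))"
proof -
  interpret rectangle a b by standard (use assms in auto)
  show ?thesis
    using NS_solution_unique[OF assms(3,4)] NS_solution_V_continuous[OF assms(3)] by blast
qed

end
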